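(* Let $\gamma>0$ and $\alpha>0$, let $d\ge 1$ be an integer and $s>-2$, and let $V(x)=\gamma|x|^\alpha$ on $\mathbb{R}^d$. Let $\mu_{\mathrm{eq}}$ denote the equilibrium measure on $\mathbb{R}^d$ associated with the Riesz kernel $K_s$ and the external field $V$, i.e. the unique minimizer of $\mathrm{I}_{s,V}$ over $\mathcal{M}_1(\mathbb{R}^d)$. Then the following hold (in particular the unique minimizer exists and is as stated). (i) Suppose that $d\geq 4$ and $s=d-4\geq 0$. (a) If $0<\alpha<2$, then $$\mu_{\mathrm{eq}}=\beta f\, m_d+(1-\beta)\sigma_R,$$ where $$\beta:=\frac{2-\alpha}{s+2},\qquad f(x):=\frac{\alpha+s}{R^{\alpha+s}|\mathbb{S}^{d-1}|}|x|^{\alpha-4}\mathbf{1}_{|x|\leq R},$$ $$R:=\begin{cases}\left(\dfrac{2|s|}{(\alpha+s+2)\gamma\alpha}\right)^{\frac{1}{\alpha+s}}&\text{if } s\neq 0,\\[2mm] \left(\dfrac{2}{(\alpha+2)\gamma\alpha}\right)^{\frac1\alpha}&\text{if } s=0.\end{cases}$$ (b) If $\alpha\geq 2$, then $\mu_{\mathrm{eq}}=\sigma_R$ where $$R:=\begin{cases}\left(\dfrac{2|s|}{(s+4)\gamma\alpha}\right)^{\frac{1}{\alpha+s}}&\text{if } s\neq 0,\\[2mm] \left(\dfrac{1}{2\gamma\alpha}\right)^{\frac1\alpha}&\text{if } s=0.\end{cases}$$ Moreover, when $s=0$ and $\alpha\ge 2$, the measure $\sigma_R$ with $R=\left(\frac{1}{2\gamma\alpha}\right)^{1/\alpha}$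 remains the equilibrium measure on $\mathbb{R}^d$ (for the kernel $K_0$ and the external field $V$) for all $d\geq 4$. (ii) Suppose that $d=3$ and $s=d-4=-1$. (a) If $\alpha=1$ and $\gamma\geq 1$, then $\mu_{\mathrm{eq}}=\delta_0$ (this holds in particular when $\alpha=\gamma=1$). (b) If $1<\alpha<2$, then $\mu_{\mathrm{eq}}=\beta f\,m_d+(1-\beta)\sigma_R$ with $\beta$, $f$ and $R$ given by the same formulas as in (i)(a), taken with $d=3$, $s=-1$. (c) If $\alpha\geq 2$, then $\mu_{\mathrm{eq}}=\sigma_R$ with $R$ given by the same formula as in (i)(b), taken with $s=-1$.
   Context: $|x|$ is the Euclidean norm on $\mathbb{R}^d$. For $s>-2$ and $x\in\mathbb{R}^d$, $x\ne 0$, the Riesz $s$-kernel is $K_s(x)=\mathrm{sign}(s)|x|^{-s}$ if $s\neq 0$ and $K_0(x)=-\log|x|$; it is extended to $x=0$ by continuity (value $+\infty$ if $s\ge 0$, value $0$ if $-2<s<0$). $\mathcal{M}_1(\mathbb{R}^d)$ is the set of Borel probability measures on $\mathbb{R}^d$. For $\mu\in\mathcal{M}_1(\mathbb{R}^d)$, the energy with external field $V$ is $$\mathrm{I}_{s,V}(\mu):=\iint_{\mathbb{R}^d\times\mathbb{R}^d}\bigl(K_s(x-y)+V(x)+V(y)\bigr)\,\mu(\mathrm{d}x)\mu(\mathrm{d}y)\in(-\infty,+\infty],$$ which is well defined when $\inf_{x\neq y}(K_s(x-y)+V(x)+V(y))>-\infty$ (this holds in all the cases of the claim). The equilibrium measure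 is the unique global minimizer of $\mathrm{I}_{s,V}$ on $\mathcal{M}_1(\mathbb{R}^d)$. Notation: $\mathbb{S}^{d-1}$ is the unit sphere of $\mathbb{R}^d$ and $|\mathbb{S}^{d-1}|=2\pi^{d/2}/\Gamma(d/2)$ its surface area; $\sigma_R$ is the uniform probability measure on the sphere $\{x\in\mathbb{R}^d:|x|=R\}$; $m_d$ is Lebesgue measure on $\mathbb{R}^d$, and $f\,m_d$ is the measure with density $f$; $\delta_0$ is the unit point mass at the origin. *)

theory Defs
  imports "HOL-Probability.Probability"
begin

text \<open>The Riesz kernel, with its continuous extension to the origin.\<close>

definition riesz_kernel :: "real \<Rightarrow> 'a::real_normed_vector \<Rightarrow> ereal" where
  "riesz_kernel s x =
     (if x = 0 then (if s \<ge> 0 then \<infinity> else 0)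
      else if s = 0 then ereal (- ln (norm x))
      else ereal (sgn s * norm x powr (- s)))"

definition borel_prob_measures :: "'a::topological_space measure set" where
  "borel_prob_measures = {\<mu>. prob_space \<mu> \<and> sets \<mu> = sets borel}"

text \<open>
  Lebesgue integral of an extended real function as the integral of the positive part minus the
  integral of the negative part (\<^const>\<open>e2ennreal\<close> sends negative numbers to 0). It is
  only meaningful if one of the two is finite; see \<open>neg_part_finite\<close> below for the case at hand.
\<close>

definition ereal_integral :: "'a measure \<Rightarrow> ('a \<Rightarrow> ereal) \<Rightarrow> ereal" where
  "ereal_integral M f =
     enn2ereal (\<integral>\<^sup>+ x. e2ennreal (f x) \<partial>M) - enn2ereal (\<integral>\<^sup>+ x. e2ennreal (- f x) \<partial>M)"

lemma neg_part_finite: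
  assumes "prob_space M" and "\<And>x. ereal c \<le> f x"
  shows "(\<integral>\<^sup>+ x. e2ennreal (- f x) \<partial>M) < \<infinity>"
proof -
  interpret prob_space M by fact
  have "e2ennreal (- f x) \<le> ennreal (- c)" for x
  proof -
    have "- f x \<le> ereal (- c)"
      using assms(2)[of x] by (cases "f x") auto
    then show ?thesis
      using e2ennreal_mono[of "- f x" "ereal (- c)"] by (simp)
  qed
  then have "(\<integral>\<^sup>+ x. e2ennreal (- f x) \<partial>M) \<le> (\<integral>\<^sup>+ x. ennreal (- c) \<partial>M)"
    by (intro nn_integral_mono) auto
  also have "\<dots> = ennreal (- c)"
    by (simp add: emeasure_space_1)
  finally show ?thesis
    by (simp add: order_le_less_trans)
qed

definition energy :: "real \<Rightarrow> ('a::euclidean_space \<Rightarrow> real) \<Rightarrow> 'a measure \<Rightarrow> ereal" where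
  "energy s V \<mu> =
     ereal_integral (\<mu> \<Otimes>\<^sub>M \<mu>) (\<lambda>(x, y). riesz_kernel s (x - y) + ereal (V x) + ereal (V y))"

definition is_minimizer :: "real \<Rightarrow> ('a::euclidean_space \<Rightarrow> real) \<Rightarrow> 'a measure \<Rightarrow> bool" where
  "is_minimizer s V \<mu> \<longleftrightarrow>
     \<mu> \<in> borel_prob_measures \<and> (\<forall>\<nu>\<in>borel_prob_measures. energy s V \<mu> \<le> energy s V \<nu>)"

definition is_equilibrium_measure ::
    "real \<Rightarrow> ('a::euclidean_space \<Rightarrow> real) \<Rightarrow> 'a measure \<Rightarrow> bool" where
  "is_equilibrium_measure s V \<mu> \<longleftrightarrow>
     is_minimizer s V \<mu> \<and> (\<forall>\<nu>. is_minimizer s V \<nu> \<longrightarrow> \<nu> = \<mu>)"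

text \<open>
  The uniform probability measure on the sphere of radius \<open>R > 0\<close>, as the normalized cone
  measure: radial projection of the uniform distribution on the unit ball. (The origin, which
  the projection map leaves in place, is a null set.) It is a rotation invariant probability measure
  carried by the sphere, which determines it uniquely; see \<open>prob_space_sphere_uniform\<close>,
  \<open>AE_sphere_uniform\<close> and \<open>sphere_uniform_orthogonal\<close>.
\<close>

definition sphere_uniform :: "real \<Rightarrow> 'a::euclidean_space measure" where
  "sphere_uniform R = distr (uniform_measure lborel (ball 0 1)) borel (\<lambda>x. (R / norm x) *\<^sub>R x)"

lemma sets_sphere_uniform [simp]: "sets (sphere_uniform R) = sets borel"
  by (simp add: sphere_uniform_def)

lemma emeasure_unit_ball:
  "emeasure lborel (ball (0::'a::euclidean_space) 1) \<noteq> 0"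
  "emeasure lborel (ball (0::'a::euclidean_space) 1) \<noteq> \<infinity>"
  using emeasure_lborel_ball_finite[of "0::'a" 1] content_ball_pos[of 1 "0::'a"]
  by (auto simp: measure_def)

lemma prob_space_sphere_uniform: "prob_space (sphere_uniform R :: 'a::euclidean_space measure)"
  unfolding sphere_uniform_def
  by (intro prob_space.prob_space_distr prob_space_uniform_measure emeasure_unit_ball) auto

lemma AE_sphere_uniform:
  assumes "R > 0"
  shows "AE x in (sphere_uniform R :: 'a::euclidean_space measure). norm x = R"
  unfolding sphere_uniform_def
proof (subst AE_distr_iff)
  have "AE x in lborel. x \<noteq> (0::'a)"
    by (rule AE_lborel_singleton)
  then show "AE x in uniform_measure lborel (ball (0::'a) 1). norm ((R / norm x) *\<^sub>R x) = R"
    using assms by (intro AE_uniform_measureI) auto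
qed auto

lemma emeasure_orthogonal_image_open:
  fixes T :: "'a::euclidean_space \<Rightarrow> 'a"
  assumes T: "orthogonal_transformation T" and S: "open S"
  shows "emeasure lborel S \<le> emeasure lborel (T ` S)"
proof -
  define K where "K = {p :: 'a \<times> real. ball (fst p) (snd p) \<subseteq> S}"
  have bij: "bij T"
    using T by (rule orthogonal_transformation_bij)
  have TS: "open (T ` S)"
    using S bij T
    by (metis open_surjective_linear_image orthogonal_transformation_linear orthogonal_transformation_surj)
  have cover: "\<exists>i. i \<in> K \<and> x \<in> ball (fst i) (snd i) \<and> snd i < d" if "x \<in> S" "0 < d" for x d
  proof -
    obtain e where "e > 0" "ball x e \<subseteq> S"
      using S \<open>x \<in> S\<close> open_contains_ball by blast
    then show ?thesis
      using \<open>0 < d\<close> by (intro exI[of _ "(x, min e (d / 2))"]) (auto simp: K_def)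
  qed
  obtain C where C: "countable C" "C \<subseteq> K"
    "pairwise (\<lambda>i j. disjnt (ball (fst i) (snd i)) (ball (fst j) (snd j))) C"
    "negligible (S - (\<Union>i\<in>C. ball (fst i) (snd i)))"
    using Vitali_covering_theorem_balls[of S K fst snd, OF cover] by auto
  define U where "U = (\<Union>i\<in>C. ball (fst i) (snd i))"
  have US: "U \<subseteq> S"
    using C(2) by (auto simp: U_def K_def)
  have U: "open U" by (auto simp: U_def)
  have disj: "disjoint_family_on (\<lambda>i. ball (fst i) (snd i)) C"
    using C(3) by (auto simp: disjoint_family_on_def pairwise_def disjnt_def)
  then have disjT: "disjoint_family_on (\<lambda>i. ball (T (fst i)) (snd i)) C"
    unfolding disjoint_family_on_def image_orthogonal_transformation_ball[OF T, symmetric]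
    by (metis bij bij_is_inj image_Int image_empty)
  have ball: "emeasure lborel (ball a r) = emeasure lborel (ball (T a) r)" for a r
    by (cases "r \<ge> 0") (auto simp: emeasure_ball ball_empty)
  have "S - U \<in> null_sets lborel"
    using C(4) S U by (simp add: U_def negligible_iff_null_sets null_sets_completion_iff)
  then have "emeasure lborel S = emeasure lborel U"
    using emeasure_Un_null_set[of U lborel "S - U"] U US by (simp add: Un_absorb1)
  also have "\<dots> = (\<integral>\<^sup>+i. emeasure lborel (ball (fst i) (snd i)) \<partial>count_space C)"
    unfolding U_def by (intro emeasure_UN_countable C(1) disj) auto
  also have "\<dots> = (\<integral>\<^sup>+i. emeasure lborel (ball (T (fst i)) (snd i)) \<partial>count_space C)"
    by (intro nn_integral_cong ball)
  also have "\<dots> = emeasure lborel (\<Union>i\<in>C. ball (T (fst i)) (snd i))"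
    by (intro emeasure_UN_countable[symmetric] C(1) disjT) auto
  also have "(\<Union>i\<in>C. ball (T (fst i)) (snd i)) = T ` U"
    by (simp add: U_def image_UN image_orthogonal_transformation_ball[OF T])
  also have "emeasure lborel (T ` U) \<le> emeasure lborel (T ` S)"
    using US TS by (intro emeasure_mono) auto
  finally show ?thesis .
qed

lemma lborel_distr_orthogonal:
  fixes T :: "'a::euclidean_space \<Rightarrow> 'a"
  assumes T: "orthogonal_transformation T"
  shows "distr lborel borel T = lborel"
proof (rule lborel_eqI[symmetric])
  have inv: "orthogonal_transformation (inv T)" and bij: "bij T"
    using T orthogonal_transformation_inv orthogonal_transformation_bij by auto
  have meas: "T \<in> borel_measurable borel"
    by (intro borel_measurable_continuous_onI linear_continuous_on)
       (simp add: linear_linear orthogonal_transformation_linear[OF T])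
  fix l u :: 'a
  assume lu: "\<And>b. b \<in> Basis \<Longrightarrow> l \<bullet> b \<le> u \<bullet> b"
  have op: "open (inv T ` box l u)"
    using inv by (metis open_box open_surjective_linear_image orthogonal_transformation_linear
        orthogonal_transformation_surj)
  have "T ` inv T ` box l u = box l u"
    using bij by (simp add: image_f_inv_f bij_is_surj)
  then have "emeasure lborel (inv T ` box l u) = emeasure lborel (box l u)"
    using emeasure_orthogonal_image_open[OF inv open_box, of l u]
      emeasure_orthogonal_image_open[OF T op] by simp
  moreover have "emeasure (distr lborel borel T) (box l u) = emeasure lborel (inv T ` box l u)"
    using meas bij by (simp add: emeasure_distr bij_vimage_eq_inv_image)
  ultimately show "emeasure (distr lborel borel T) (box l u) = (\<Prod>b\<in>Basis. (u - l) \<bullet> b)"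
    using lu by simp
qed simp

lemma sphere_uniform_orthogonal:
  fixes T :: "'a::euclidean_space \<Rightarrow> 'a"
  assumes T: "orthogonal_transformation T"
  shows "distr (sphere_uniform R) borel T = sphere_uniform R"
proof -
  define P where "P = (\<lambda>x :: 'a. (R / norm x) *\<^sub>R x)"
  let ?B = "ball 0 1 :: 'a set"
  let ?U = "uniform_measure lborel ?B"
  have [measurable]: "P \<in> borel_measurable borel"
    unfolding P_def by measurable
  have lin: "linear T"
    using T by (simp add: orthogonal_transformation_linear)
  then have [measurable]: "T \<in> borel_measurable borel"
    by (intro borel_measurable_continuous_onI linear_continuous_on) (simp add: linear_linear)
  have comm: "T \<circ> P = P \<circ> T"
    using T by (auto simp: P_def fun_eq_iff linear_scale[OF lin] orthogonal_transformation_norm)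
  have U: "distr ?U borel T = ?U"
  proof (rule measure_eqI)
    fix A assume "A \<in> sets (distr ?U borel T)"
    then have A [measurable]: "A \<in> sets borel" by simp
    have [measurable]: "T -` A \<in> sets borel"
      using measurable_sets[of T borel borel A] by simp
    have "?B \<inter> T -` A = T -` (?B \<inter> A)"
      using T by (auto simp: orthogonal_transformation_norm)
    then have "emeasure lborel (?B \<inter> T -` A) = emeasure (distr lborel borel T) (?B \<inter> A)"
      by (simp add: emeasure_distr)
    then show "emeasure (distr ?U borel T) A = emeasure ?U A"
      by (simp add: emeasure_distr lborel_distr_orthogonal[OF T])
  qed simp
  have "distr (sphere_uniform R) borel T = distr ?U borel (T \<circ> P)"
    unfolding sphere_uniform_def P_def[symmetric] by (subst distr_distr) auto
  also have "\<dots> = distr (distr ?U borel T) borel P"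
    unfolding comm by (subst distr_distr) auto
  also have "\<dots> = sphere_uniform R"
    unfolding U by (simp add: sphere_uniform_def P_def)
  finally show ?thesis .
qed

definition sphere_area :: "'a::euclidean_space itself \<Rightarrow> real" where
  "sphere_area _ = 2 * pi powr (real DIM('a) / 2) / Gamma (real DIM('a) / 2)"

text \<open>The Borel measure \<open>b \<mu> + (1 - b) \<nu>\<close>, meant for \<open>0 \<le> b \<le> 1\<close>.\<close>

definition mixture :: "real \<Rightarrow> 'a::topological_space measure \<Rightarrow> 'a measure \<Rightarrow> 'a measure" where
  "mixture b \<mu> \<nu> =
     measure_of UNIV (sets borel)
       (\<lambda>A. ennreal b * emeasure \<mu> A + ennreal (1 - b) * emeasure \<nu> A)"

lemma sets_mixture [simp]: "sets (mixture b \<mu> \<nu>) = sets borel"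
  using sets.sigma_sets_eq[of borel] by (simp add: mixture_def sets_measure_of_conv)

lemma emeasure_mixture:
  assumes "sets \<mu> = sets borel" "sets \<nu> = sets borel" "A \<in> sets borel"
  shows "emeasure (mixture b \<mu> \<nu>) A = ennreal b * emeasure \<mu> A + ennreal (1 - b) * emeasure \<nu> A"
proof (rule emeasure_measure_of[OF mixture_def])
  show "countably_additive (sets (mixture b \<mu> \<nu>))
          (\<lambda>A. ennreal b * emeasure \<mu> A + ennreal (1 - b) * emeasure \<nu> A)"
    unfolding countably_additive_def
  proof (intro allI impI)
    fix F :: "nat \<Rightarrow> 'a set"
    assume F: "range F \<subseteq> sets (mixture b \<mu> \<nu>)" "disjoint_family F"
    have "(\<Sum>i. emeasure \<mu> (F i)) = emeasure \<mu> (\<Union> (range F))"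
      "(\<Sum>i. emeasure \<nu> (F i)) = emeasure \<nu> (\<Union> (range F))"
      using F assms by (auto intro!: suminf_emeasure)
    then show "(\<Sum>i. ennreal b * emeasure \<mu> (F i) + ennreal (1 - b) * emeasure \<nu> (F i)) =
        ennreal b * emeasure \<mu> (\<Union> (range F)) + ennreal (1 - b) * emeasure \<nu> (\<Union> (range F))"
      by (simp add: suminf_add[symmetric])
  qed
qed (use assms in \<open>auto simp: positive_def\<close>)

definition mixture_weight :: "real \<Rightarrow> real \<Rightarrow> real" where
  "mixture_weight s \<alpha> = (2 - \<alpha>) / (s + 2)"

definition radial_density :: "real \<Rightarrow> real \<Rightarrow> real \<Rightarrow> 'a::euclidean_space \<Rightarrow> real" where
  "radial_density s \<alpha> R x =
     (\<alpha> + s) / (R powr (\<alpha> + s) * sphere_area TYPE('a)) * norm x powr (\<alpha> - 4)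
       * indicator {x. norm x \<le> R} x"

definition mixture_radius :: "real \<Rightarrow> real \<Rightarrow> real \<Rightarrow> real" where
  "mixture_radius s \<gamma> \<alpha> =
     (if s \<noteq> 0 then (2 * \<bar>s\<bar> / ((\<alpha> + s + 2) * \<gamma> * \<alpha>)) powr (1 / (\<alpha> + s))
      else (2 / ((\<alpha> + 2) * \<gamma> * \<alpha>)) powr (1 / \<alpha>))"

definition sphere_radius :: "real \<Rightarrow> real \<Rightarrow> real \<Rightarrow> real" where
  "sphere_radius s \<gamma> \<alpha> =
     (if s \<noteq> 0 then (2 * \<bar>s\<bar> / ((s + 4) * \<gamma> * \<alpha>)) powr (1 / (\<alpha> + s))
      else (1 / (2 * \<gamma> * \<alpha>)) powr (1 / \<alpha>))"

definition ball_sphere_mixture :: "real \<Rightarrow> real \<Rightarrow> real \<Rightarrow> 'a::euclidean_space measure" where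
  "ball_sphere_mixture s \<gamma> \<alpha> =
     (let R = mixture_radius s \<gamma> \<alpha> in
      mixture (mixture_weight s \<alpha>)
        (density lborel (\<lambda>x. ennreal (radial_density s \<alpha> R x)))
        (sphere_uniform R))"

end

theory Submission
  imports Defs "HOL-Real_Asymp.Real_Asymp"
begin

text \<open>
  Write \<open>k = riesz_profile s\<close>, so that the kernel is \<open>k (norm (x - y))\<close>, and \<open>c = riesz_slope s\<close>, so
  that \<open>k' r = - c * r powr (- s - 1)\<close>.

  \<^bold>\<open>Why the Euler-Lagrange conditions suffice.\<close> For \<open>s > -2\<close> the kernel is, up to an additive
  constant, a positive superposition of the Gaussians \<open>exp (- (t * (norm (x - y))\<^sup>2))\<close>, \<open>t > 0\<close>
  (lemma \<open>laplace_profile\<close>). The Gaussian energy of a difference of two probability measures is the squared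
  \<open>L\<^sup>2\<close> norm of a difference of smoothed measures, so the Riesz energy of such a difference is nonnegative
  and vanishes only if the measures agree (\<open>riesz_energy_positive\<close>); the additive constant does
  not matter because both measures have mass one. Hence the energy is strictly convex, and a measure
  whose potential \<open>U\<close> makes \<open>U + V\<close> constant on its support and nowhere smaller than this constant is the
  unique minimizer (\<open>equilibrium_criterion\<close>). It remains to compute potentials.

  \<^bold>\<open>Potential of a sphere.\<close> For \<open>s = d - 4\<close> the kernel is a fundamental solution of the
  bilaplacian up to a factor, and the potential of the uniform measure on the sphere of radius \<open>R\<close> at \<open>x\<close> is
  \<open>k M - c / (s + 4) * m\<^sup>2 * M powr (- s - 2)\<close> with \<open>M = max R (norm x)\<close> and \<open>m = min R (norm x)\<close>
  (\<open>sphere_potential_biharmonic\<close>). The formula is a consequence of rotation invariance: infinitesimal rotations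
  give an integration by parts formula for the law of one coordinate on the sphere, which turns into
  a recursion between the means of the powers of the distance to an interior point
  (\<open>moment_recursion\<close>). Together with differentiation in the position of that point it
  yields linear differential equations which can be solved explicitly.

  \<^bold>\<open>Spheres, \<open>\<alpha> \<ge> 2\<close>.\<close> Inside the sphere the required inequality becomes
  \<open>t\<^sup>2 \<le> 2 / \<alpha> * t powr \<alpha> + (1 - 2 / \<alpha>)\<close>, which is Young's inequality; outside, \<open>U + V\<close> is
  nondecreasing in the distance to the origin (\<open>outer_potential_monotone\<close>). For the logarithmic kernel in dimension
  \<open>d \<ge> 4\<close> the derivative of the potential is controlled by the mean
  of the inverse square of the distance, which is at most its value at the centre
  (\<open>inverse_square_mean_le\<close>).

  \<^bold>\<open>Mixtures, \<open>\<alpha> < 2\<close>.\<close> In polar coordinates the measure with the radial density is an average of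
  uniform measures on spheres, so its potential is a one-dimensional integral of the formula above. Inside the ball
  it contains the terms \<open>norm x powr \<alpha>\<close> and \<open>(norm x)\<^sup>2\<close>; the radius \<open>R\<close> is such that the first one
  cancels \<open>V\<close>, and the weight \<open>\<beta>\<close> is such that the second one cancels against the sphere
  (\<open>mixture_equilibrium\<close>).

  \<^bold>\<open>The point mass.\<close> For \<open>s = -1\<close> and \<open>\<alpha> = 1 \<le> \<gamma>\<close> the triangle inequality makes the
  integrand of the energy nonnegative, and it vanishes at the origin. Equality for another measure would force almost all pairs of
  nonzero points to lie in opposite directions, which contradicts the nonnegativity of the quadratic form with kernel
  \<open>sgn x \<bullet> sgn y\<close> (\<open>point_mass_equilibrium\<close>).
\<close>

section \<open>The Riesz kernel as a superposition of Gaussians\<close>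

definition riesz_profile :: "real \<Rightarrow> real \<Rightarrow> real" where
  "riesz_profile s r = (if s = 0 then - ln r else sgn s * r powr (- s))"

text \<open>
  The constant in the derivative of the profile, which is \<open>- riesz_slope s * r powr (- s - 1)\<close> for every \<open>s\<close>.
\<close>

definition riesz_slope :: "real \<Rightarrow> real" where
  "riesz_slope s = (if s = 0 then 1 else \<bar>s\<bar>)"

lemma riesz_slope_pos: "riesz_slope s > 0"
  by (simp add: riesz_slope_def)

lemma riesz_kernel_eq_profile:
  "x \<noteq> 0 \<or> s < 0 \<Longrightarrow> riesz_kernel s x = ereal (riesz_profile s (norm x))"
  by (auto simp: riesz_kernel_def riesz_profile_def)

lemma borel_measurable_riesz_profile [measurable]: "riesz_profile s \<in> borel_measurable borel"
  unfolding riesz_profile_def by measurable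

lemma riesz_profile_sqrt_deriv:
  assumes "q > 0"
  shows "((\<lambda>q. riesz_profile s (sqrt q)) has_real_derivative - (riesz_slope s / 2) * q powr (- s / 2 - 1)) (at q)"
proof (cases "s = 0")
  case True
  have "((\<lambda>q. - ln (sqrt q)) has_real_derivative - (1 / 2) * q powr (- 1)) (at q)"
    using assms by (auto intro!: derivative_eq_intros simp: powr_minus field_simps)
  then show ?thesis
    using True by (simp add: riesz_profile_def riesz_slope_def)
next
  case False
  have "((\<lambda>q. sgn s * q powr (- s / 2)) has_real_derivative - (riesz_slope s / 2) * q powr (- s / 2 - 1)) (at q)"
    using assms False
    by (auto intro!: derivative_eq_intros simp: riesz_slope_def abs_sgn)
  moreover have "\<forall>\<^sub>F x in nhds q. riesz_profile s (sqrt x) = sgn s * x powr (- s / 2)"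
    using eventually_nhds_in_open[of "{0<..}" q] assms
    by (simp, elim eventually_mono) (auto simp: riesz_profile_def False powr_half_sqrt[symmetric] powr_powr)
  ultimately show ?thesis
    by (rule DERIV_cong_ev[THEN iffD2, OF refl _ refl, rotated])
qed

lemma riesz_profile_antimono:
  assumes "0 < a" "a \<le> b"
  shows "riesz_profile s b \<le> riesz_profile s a"
proof (cases s "0::real" rule: linorder_cases)
  case greater
  then show ?thesis using assms powr_mono2'[of s a b]
    by (simp add: riesz_profile_def powr_mono2')
next
  case less
  then show ?thesis using assms by (simp add: riesz_profile_def powr_mono2)
qed (use assms in \<open>simp add: riesz_profile_def\<close>)

lemma riesz_profile_antimono_neg:
  assumes "s < 0" "0 \<le> a" "a \<le> b"
  shows "riesz_profile s b \<le> riesz_profile s a"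
  using assms by (simp add: riesz_profile_def powr_mono2)

lemma Gamma_laplace_scaled:
  assumes "p > 0" "u > 0"
  shows "(\<integral>\<^sup>+t. ennreal (indicator {0<..} t * t powr (p - 1) * exp (- (t * u))) \<partial>lborel)
         = ennreal (Gamma p * u powr (- p))"
proof -
  have "ennreal (Gamma p) = (\<integral>\<^sup>+t. ennreal (indicator {0..} t * t powr (p - 1) / exp t) \<partial>lborel)"
    using Gamma_conv_nn_integral_real[OF assms(1)] .
  also have "\<dots> = ennreal u * (\<integral>\<^sup>+t. ennreal (indicator {0..} (0 + u * t) * (0 + u * t) powr (p - 1) / exp (0 + u * t)) \<partial>lborel)"
    using assms by (subst nn_integral_real_affine[where c = u and t = 0]) auto
  also have "(\<integral>\<^sup>+t. ennreal (indicator {0..} (0 + u * t) * (0 + u * t) powr (p - 1) / exp (0 + u * t)) \<partial>lborel)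
     = (\<integral>\<^sup>+t. ennreal (u powr (p - 1)) * ennreal (indicator {0<..} t * t powr (p - 1) * exp (- (t * u))) \<partial>lborel)"
  proof (rule nn_integral_cong_AE, use AE_lborel_singleton[of "0::real"] in eventually_elim)
    case (elim t)
    then have "indicator {0..} (u * t) = (indicator {0<..} t :: real)"
      using assms by (auto simp: indicator_def zero_le_mult_iff)
    then show ?case
      using assms by (auto simp: ennreal_mult[symmetric] powr_mult exp_minus field_simps indicator_def)
  qed
  also have "\<dots> = ennreal (u powr (p - 1)) * (\<integral>\<^sup>+t. ennreal (indicator {0<..} t * t powr (p - 1) * exp (- (t * u))) \<partial>lborel)"
    by (rule nn_integral_cmult) auto
  finally have *: "ennreal (Gamma p) = ennreal (u powr p) * (\<integral>\<^sup>+t. ennreal (indicator {0<..} t * t powr (p - 1) * exp (- (t * u))) \<partial>lborel)"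
    using assms by (simp add: mult.assoc[symmetric] ennreal_mult[symmetric] powr_mult_base)
  have "ennreal (Gamma p * u powr (- p)) = ennreal (u powr (- p)) * ennreal (Gamma p)"
    using assms Gamma_real_pos[of p] by (simp add: ennreal_mult[symmetric] mult.commute)
  also have "\<dots> = (\<integral>\<^sup>+t. ennreal (indicator {0<..} t * t powr (p - 1) * exp (- (t * u))) \<partial>lborel)"
    unfolding * using assms
    by (simp add: mult.assoc[symmetric] ennreal_mult[symmetric] powr_add[symmetric])
  finally show ?thesis by simp
qed

text \<open>
  The difference of the exponentials is the integral of \<open>t * exp (- (t * u))\<close> over \<open>u \<in> {a..b}\<close>. After
  exchanging the integrals, the inner one is a Gamma integral, and the additional factor \<open>t\<close> makes it converge
  at \<open>0\<close> for all \<open>s > -2\<close> rather than for \<open>s > 0\<close> only.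
\<close>

lemma nn_integral_laplace_difference:
  fixes a b s :: real
  assumes s: "s > -2" and ab: "0 \<le> a" "a \<le> b"
  shows "(\<integral>\<^sup>+t. ennreal (indicator {0<..} t * t powr (s / 2 - 1) * (exp (- (t * a)) - exp (- (t * b)))) \<partial>lborel)
       = (\<integral>\<^sup>+u. ennreal (Gamma (s / 2 + 1) * (indicator {a..b} u * u powr (- s / 2 - 1))) \<partial>lborel)"
proof -
  have "(\<integral>\<^sup>+t. ennreal (indicator {0<..} t * t powr (s / 2 - 1) * (exp (- (t * a)) - exp (- (t * b)))) \<partial>lborel)
      = (\<integral>\<^sup>+t. (\<integral>\<^sup>+u. ennreal (indicator {0<..} t * t powr (s / 2) * exp (- (t * u)) * indicator {a..b} u) \<partial>lborel) \<partial>lborel)"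
  proof (rule nn_integral_cong)
    fix t :: real
    show "ennreal (indicator {0<..} t * t powr (s / 2 - 1) * (exp (- (t * a)) - exp (- (t * b))))
      = (\<integral>\<^sup>+u. ennreal (indicator {0<..} t * t powr (s / 2) * exp (- (t * u)) * indicator {a..b} u) \<partial>lborel)"
    proof (cases "t > 0")
      case True
      have "(\<integral>\<^sup>+u. ennreal (t powr (s / 2) * exp (- (t * u))) * indicator {a..b} u \<partial>lborel)
          = ennreal (- (t powr (s / 2 - 1)) * exp (- (t * b)) - - (t powr (s / 2 - 1)) * exp (- (t * a)))"
      proof (rule nn_integral_FTC_Icc)
        fix u
        have "t powr (s / 2 - 1) * t = t powr (s / 2)"
          using True powr_mult_base[of t "s / 2 - 1"] by (simp add: mult.commute)
        then show "((\<lambda>u. - (t powr (s / 2 - 1)) * exp (- (t * u))) has_real_derivative t powr (s / 2) * exp (- (t * u))) (at u)"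
          by (auto intro!: derivative_eq_intros simp: mult.commute)
      qed (use ab in auto)
      also have "(\<integral>\<^sup>+u. ennreal (t powr (s / 2) * exp (- (t * u))) * indicator {a..b} u \<partial>lborel)
         = (\<integral>\<^sup>+u. ennreal (indicator {0<..} t * t powr (s / 2) * exp (- (t * u)) * indicator {a..b} u) \<partial>lborel)"
        using True by (intro nn_integral_cong) (auto simp: indicator_def)
      finally show ?thesis
        using True by (simp add: algebra_simps)
    qed simp
  qed
  also have "\<dots> = (\<integral>\<^sup>+u. (\<integral>\<^sup>+t. ennreal (indicator {0<..} t * t powr (s / 2) * exp (- (t * u)) * indicator {a..b} u) \<partial>lborel) \<partial>lborel)"
    by (intro lborel_pair.Fubini') measurable
  also have "\<dots> = (\<integral>\<^sup>+u. ennreal (Gamma (s / 2 + 1) * (indicator {a..b} u * u powr (- s / 2 - 1))) \<partial>lborel)"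
  proof (rule nn_integral_cong_AE, use AE_lborel_singleton[of "0::real"] in eventually_elim)
    case (elim u)
    show ?case
    proof (cases "u \<in> {a..b}")
      case True
      then show ?thesis
        using elim ab s Gamma_laplace_scaled[of "s / 2 + 1" u] by (simp add: mult.assoc minus_diff_commute)
    qed simp
  qed
  finally show ?thesis .
qed

text \<open>
  As a function of the squared distance the profile is, up to a constant factor, an antiderivative of the power of \<open>u\<close> in
  \<open>nn_integral_laplace_difference\<close>.
\<close>

lemma nn_integral_profile_difference:
  assumes "s > -2" and ab: "0 \<le> a" "a \<le> b" and "a > 0 \<or> s < 0"
  shows "(\<integral>\<^sup>+u. ennreal (indicator {a..b} u * u powr (- s / 2 - 1)) \<partial>lborel)
       = ennreal (2 / riesz_slope s * (riesz_profile s (sqrt a) - riesz_profile s (sqrt b)))"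
proof (cases "a > 0")
  case True
  define F where "F q = - (2 / riesz_slope s) * riesz_profile s (sqrt q)" for q
  have "(\<integral>\<^sup>+u. ennreal (u powr (- s / 2 - 1)) * indicator {a..b} u \<partial>lborel) = ennreal (F b - F a)"
  proof (rule nn_integral_FTC_Icc)
    fix u assume "u \<in> {a..b}"
    then have "((\<lambda>q. - (2 / riesz_slope s) * riesz_profile s (sqrt q)) has_real_derivative
        - (2 / riesz_slope s) * (- (riesz_slope s / 2) * u powr (- s / 2 - 1))) (at u)"
      using True by (intro DERIV_cmult riesz_profile_sqrt_deriv) auto
    then show "(F has_real_derivative u powr (- s / 2 - 1)) (at u)"
      unfolding F_def using riesz_slope_pos[of s] by simp
  qed (use ab in auto)
  also have "(\<integral>\<^sup>+u. ennreal (u powr (- s / 2 - 1)) * indicator {a..b} u \<partial>lborel)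
     = (\<integral>\<^sup>+u. ennreal (indicator {a..b} u * u powr (- s / 2 - 1)) \<partial>lborel)"
    by (intro nn_integral_cong) (auto simp: indicator_def)
  finally show ?thesis
    by (simp add: F_def algebra_simps)
next
  case False
  \<comment> \<open>The integrand is unbounded at the left end point, where the antiderivative is only continuous.\<close>
  then have a: "a = 0" "s < 0" using assms by auto
  have "((\<lambda>x. x powr (- s / 2 - 1)) has_integral (b powr (- s / 2 - 1 + 1) / (- s / 2 - 1 + 1))) {0..b}"
    by (rule has_integral_powr_from_0) (use a ab in auto)
  from nn_integral_has_integral_lebesgue[OF _ this]
  have "(\<integral>\<^sup>+u. ennreal (indicator {0..b} u * u powr (- s / 2 - 1)) \<partial>lborel) = ennreal (b powr (- s / 2) / (- s / 2))"
    by simp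
  moreover have "b powr (- s / 2) / (- s / 2) = 2 / riesz_slope s * (riesz_profile s (sqrt 0) - riesz_profile s (sqrt b))"
    using a ab by (simp add: riesz_slope_def riesz_profile_def powr_half_sqrt[symmetric] powr_powr)
  ultimately show ?thesis using a by simp
qed

definition laplace_const :: "real \<Rightarrow> real" where
  "laplace_const s = Gamma (s / 2 + 1) * (2 / riesz_slope s)"

lemma laplace_const_pos: "s > -2 \<Longrightarrow> laplace_const s > 0"
  by (simp add: laplace_const_def riesz_slope_pos Gamma_real_pos)

definition laplace_weight :: "real \<Rightarrow> real \<Rightarrow> real" where
  "laplace_weight s t = indicator {0<..} t * t powr (s / 2 - 1)"

lemma laplace_weight_measurable [measurable]: "laplace_weight s \<in> borel_measurable borel"
  unfolding laplace_weight_def by measurable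

lemma laplace_weight_nonneg: "laplace_weight s t \<ge> 0"
  by (simp add: laplace_weight_def)

lemma laplace_weight_pos: "t > 0 \<Longrightarrow> laplace_weight s t > 0"
  by (simp add: laplace_weight_def)

lemma laplace_diff_has_integral:
  assumes "s > -2" and ab: "0 \<le> a" "a \<le> b" and "a > 0 \<or> s < 0"
  shows "has_bochner_integral lborel (\<lambda>t. laplace_weight s t * (exp (- (t * a)) - exp (- (t * b))))
           (laplace_const s * (riesz_profile s (sqrt a) - riesz_profile s (sqrt b)))"
proof (rule has_bochner_integral_nn_integral)
  have mono: "riesz_profile s (sqrt b) \<le> riesz_profile s (sqrt a)"
    using assms riesz_profile_antimono[of "sqrt a" "sqrt b" s]
      riesz_profile_antimono_neg[of s "sqrt a" "sqrt b"] by auto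
  then show "0 \<le> laplace_const s * (riesz_profile s (sqrt a) - riesz_profile s (sqrt b))"
    using laplace_const_pos[OF assms(1)] by simp
  show "AE t in lborel. 0 \<le> laplace_weight s t * (exp (- (t * a)) - exp (- (t * b)))"
    using ab by (intro AE_I2) (auto simp: laplace_weight_def indicator_def intro!: mult_nonneg_nonneg)
  have G: "Gamma (s / 2 + 1) \<ge> 0" using assms Gamma_real_pos[of "s / 2 + 1"] by simp
  have "(\<integral>\<^sup>+t. ennreal (laplace_weight s t * (exp (- (t * a)) - exp (- (t * b)))) \<partial>lborel)
     = (\<integral>\<^sup>+u. ennreal (Gamma (s / 2 + 1) * (indicator {a..b} u * u powr (- s / 2 - 1))) \<partial>lborel)"
    unfolding laplace_weight_def using assms by (intro nn_integral_laplace_difference) auto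
  also have "\<dots> = ennreal (Gamma (s / 2 + 1)) * (\<integral>\<^sup>+u. ennreal (indicator {a..b} u * u powr (- s / 2 - 1)) \<partial>lborel)"
    using G by (subst nn_integral_cmult[symmetric]) (auto simp: ennreal_mult)
  also have "\<dots> = ennreal (Gamma (s / 2 + 1)) * ennreal (2 / riesz_slope s * (riesz_profile s (sqrt a) - riesz_profile s (sqrt b)))"
    by (subst nn_integral_profile_difference) (use assms in auto)
  also have "\<dots> = ennreal (laplace_const s * (riesz_profile s (sqrt a) - riesz_profile s (sqrt b)))"
    using G mono riesz_slope_pos[of s]
    by (subst ennreal_mult[symmetric]) (auto simp: laplace_const_def mult.assoc)
  finally show "(\<integral>\<^sup>+t. ennreal (laplace_weight s t * (exp (- (t * a)) - exp (- (t * b)))) \<partial>lborel)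
     = ennreal (laplace_const s * (riesz_profile s (sqrt a) - riesz_profile s (sqrt b)))" .
qed measurable

text \<open>
  The kernel as a superposition of Gaussians, normalized at distance \<open>1\<close>. The normalization is necessary: for
  \<open>s \<le> 0\<close> only differences of Gaussians are integrable against the weight near \<open>t = 0\<close>. The integral of the
  absolute value, needed to apply Fubini's theorem, has the absolute value of the same formula as its value because the
  integrand does not change sign.
\<close>

lemma
  fixes r s :: real
  assumes "s > -2" "r \<ge> 0" "r > 0 \<or> s < 0"
  shows laplace_profile: "has_bochner_integral lborel (\<lambda>t. laplace_weight s t * (exp (- (t * r\<^sup>2)) - exp (- t)))
           (laplace_const s * (riesz_profile s r - riesz_profile s 1))"
    and laplace_profile_abs: "has_bochner_integral lborel (\<lambda>t. \<bar>laplace_weight s t * (exp (- (t * r\<^sup>2)) - exp (- t))\<bar>)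
           (laplace_const s * \<bar>riesz_profile s r - riesz_profile s 1\<bar>)"
proof -
  have sq: "sqrt (r\<^sup>2) = r" using assms by simp
  let ?f = "\<lambda>t. laplace_weight s t * (exp (- (t * r\<^sup>2)) - exp (- t))"
  let ?I = "laplace_const s * (riesz_profile s r - riesz_profile s 1)"
  have "has_bochner_integral lborel ?f ?I \<and> has_bochner_integral lborel (\<lambda>t. \<bar>?f t\<bar>) \<bar>?I\<bar>"
  proof (cases "r \<le> 1")
    case True
    then have r2: "r\<^sup>2 \<le> 1" using assms by (simp add: power_le_one)
    have 1: "has_bochner_integral lborel ?f ?I"
      using laplace_diff_has_integral[of s "r\<^sup>2" 1] assms sq r2 by auto
    have pos: "?f t \<ge> 0" for t
      using r2 by (auto simp: laplace_weight_def indicator_def intro!: mult_nonneg_nonneg)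
    then have e: "(\<lambda>t. \<bar>?f t\<bar>) = ?f" using pos by (intro ext abs_of_nonneg)
    have "?I \<ge> 0"
      unfolding has_bochner_integral_integral_eq[OF 1, symmetric]
      by (rule Bochner_Integration.integral_nonneg) (rule pos)
    then show ?thesis
      unfolding e using 1 by (simp only: abs_of_nonneg)
  next
    case False
    then have r2: "1 \<le> r\<^sup>2" using assms by (simp add: one_le_power)
    have "has_bochner_integral lborel (\<lambda>t. laplace_weight s t * (exp (- (t * 1)) - exp (- (t * r\<^sup>2))))
        (laplace_const s * (riesz_profile s (sqrt 1) - riesz_profile s (sqrt (r\<^sup>2))))"
      by (rule laplace_diff_has_integral) (use assms r2 in auto)
    then have 2: "has_bochner_integral lborel (\<lambda>t. - ?f t) (- ?I)"
      unfolding sq by (simp only: minus_mult_right minus_diff_eq mult_1_right real_sqrt_one)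
    have pos: "- ?f t \<ge> 0" for t
      using r2 by (auto simp: laplace_weight_def indicator_def mult_le_0_iff)
    then have e: "(\<lambda>t. \<bar>?f t\<bar>) = (\<lambda>t. - ?f t)" using pos by (intro ext abs_of_nonpos) (simp only: neg_0_le_iff_le)
    have "- ?I \<ge> 0"
      unfolding has_bochner_integral_integral_eq[OF 2, symmetric]
      by (rule Bochner_Integration.integral_nonneg) (rule pos)
    then have "\<bar>?I\<bar> = - ?I" by (simp only: abs_of_nonpos neg_0_le_iff_le)
    then show ?thesis
      unfolding e using has_bochner_integral_minus[OF 2] 2 by (simp only: minus_minus)
  qed
  then show "has_bochner_integral lborel ?f ?I"
    "has_bochner_integral lborel (\<lambda>t. \<bar>?f t\<bar>) (laplace_const s * \<bar>riesz_profile s r - riesz_profile s 1\<bar>)"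
    unfolding abs_mult[of "laplace_const s"] abs_of_pos[OF laplace_const_pos[OF assms(1)]] by blast+
qed

section \<open>Gaussian energies determine a measure\<close>

definition heat_const :: "'a::euclidean_space itself \<Rightarrow> real" where
  "heat_const _ = (\<integral>z. exp (- (norm (z::'a))\<^sup>2) \<partial>lborel)"

lemma gaussian_real_nn_integral: "(\<integral>\<^sup>+x. ennreal (exp (- (x::real)\<^sup>2)) \<partial>lborel) = ennreal (sqrt pi)"
proof -
  have "has_bochner_integral lborel (\<lambda>x::real. exp (- x\<^sup>2) * x ^ (2 * 0)) (sqrt pi * (fact (2 * 0) / (2 ^ (2 * 0) * fact 0)))"
    using has_bochner_integral_even_function[OF gaussian_moment_even_pos[where k = 0]] by simp
  then have "has_bochner_integral lborel (\<lambda>x::real. exp (- x\<^sup>2)) (sqrt pi)"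
    by simp
  then show ?thesis
    by (subst nn_integral_eq_integral) (auto simp: has_bochner_integral_iff)
qed

lemma has_bochner_integral_gaussian:
  "has_bochner_integral lborel (\<lambda>z::'a::euclidean_space. exp (- (norm z)\<^sup>2)) (heat_const TYPE('a))"
  and heat_const_pos: "heat_const TYPE('a) > 0"
proof -
  have "(\<integral>\<^sup>+z. ennreal (exp (- (norm (z::'a))\<^sup>2)) \<partial>lborel)
     = (\<integral>\<^sup>+z. (\<Prod>b\<in>Basis. ennreal (exp (- ((z::'a) \<bullet> b)\<^sup>2))) \<partial>lborel)"
  proof (rule nn_integral_cong)
    fix z :: 'a
    have "(norm z)\<^sup>2 = (\<Sum>b\<in>Basis. (z \<bullet> b)\<^sup>2)"
      unfolding power2_norm_eq_inner euclidean_inner[of z z] by (simp add: power2_eq_square)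
    then show "ennreal (exp (- (norm z)\<^sup>2)) = (\<Prod>b\<in>Basis. ennreal (exp (- (z \<bullet> b)\<^sup>2)))"
      by (simp add: prod_ennreal exp_sum[symmetric] sum_negf)
  qed
  also have "\<dots> = ennreal (sqrt pi ^ DIM('a))"
    by (subst nn_integral_lborel_prod) (auto simp: gaussian_real_nn_integral ennreal_power)
  finally have *: "has_bochner_integral lborel (\<lambda>z::'a. exp (- (norm z)\<^sup>2)) (sqrt pi ^ DIM('a))"
    by (intro has_bochner_integral_nn_integral) auto
  then have "heat_const TYPE('a) = sqrt pi ^ DIM('a)"
    unfolding heat_const_def by (rule has_bochner_integral_integral_eq)
  with * show "has_bochner_integral lborel (\<lambda>z::'a. exp (- (norm z)\<^sup>2)) (heat_const TYPE('a))"
    "heat_const TYPE('a) > 0"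
    by auto
qed

lemma nn_integral_lborel_affine:
  fixes f :: "'a::euclidean_space \<Rightarrow> ennreal"
  assumes "c > 0" and [measurable]: "f \<in> borel_measurable borel"
  shows "(\<integral>\<^sup>+z. f z \<partial>lborel) = ennreal (c ^ DIM('a)) * (\<integral>\<^sup>+z. f (m + c *\<^sub>R z) \<partial>lborel)"
proof -
  have "(\<integral>\<^sup>+z. f z \<partial>lborel) = (\<integral>\<^sup>+z. f z \<partial>density (distr lborel borel (\<lambda>x. m + c *\<^sub>R x)) (\<lambda>_. ennreal (\<bar>c\<bar> ^ DIM('a))))"
    using lborel_affine[of c m] assms by simp
  also have "\<dots> = ennreal (c ^ DIM('a)) * (\<integral>\<^sup>+z. f (m + c *\<^sub>R z) \<partial>lborel)"
    using assms by (simp add: nn_integral_density nn_integral_distr nn_integral_cmult)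
  finally show ?thesis .
qed

lemma parallelogram:
  fixes a b :: "'a::real_inner"
  shows "(norm (a - b))\<^sup>2 + (norm (a + b))\<^sup>2 = 2 * (norm a)\<^sup>2 + 2 * (norm b)\<^sup>2"
  by (simp add: power2_norm_eq_inner inner_add inner_diff inner_commute)

text \<open>
  By the parallelogram law, \<open>(norm (x - z))\<^sup>2 + (norm (y - z))\<^sup>2\<close> is the sum of \<open>(norm (x - y))\<^sup>2 / 2\<close> and
  twice the squared distance of \<open>z\<close> to the midpoint. Hence a Gaussian is the convolution of two narrower
  ones.
\<close>

lemma nn_integral_gaussian_product:
  fixes x y :: "'a::euclidean_space"
  assumes "t > 0"
  shows "(\<integral>\<^sup>+z. ennreal (exp (- (2 * t * (norm (x - z))\<^sup>2)) * exp (- (2 * t * (norm (y - z))\<^sup>2))) \<partial>lborel)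
    = ennreal ((1 / (2 * sqrt t)) ^ DIM('a) * heat_const TYPE('a) * exp (- (t * (norm (x - y))\<^sup>2)))"
proof -
  let ?c = "1 / (2 * sqrt t)"
  let ?m = "(1 / 2) *\<^sub>R (x + y)"
  have "(\<integral>\<^sup>+z. ennreal (exp (- (2 * t * (norm (x - z))\<^sup>2)) * exp (- (2 * t * (norm (y - z))\<^sup>2))) \<partial>lborel)
    = ennreal (?c ^ DIM('a)) * (\<integral>\<^sup>+z. ennreal (exp (- (2 * t * (norm (x - (?m + ?c *\<^sub>R z)))\<^sup>2)) * exp (- (2 * t * (norm (y - (?m + ?c *\<^sub>R z)))\<^sup>2))) \<partial>lborel)"
    by (rule nn_integral_lborel_affine) (use assms in auto)
  also have "(\<integral>\<^sup>+z. ennreal (exp (- (2 * t * (norm (x - (?m + ?c *\<^sub>R z)))\<^sup>2)) * exp (- (2 * t * (norm (y - (?m + ?c *\<^sub>R z)))\<^sup>2))) \<partial>lborel)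
     = (\<integral>\<^sup>+z. ennreal (exp (- (t * (norm (x - y))\<^sup>2))) * ennreal (exp (- (norm (z::'a))\<^sup>2)) \<partial>lborel)"
  proof (rule nn_integral_cong)
    fix z :: 'a
    let ?w = "(1 / 2) *\<^sub>R (x - y)" and ?z = "?c *\<^sub>R z"
    have e: "x - (?m + ?z) = ?w - ?z" "y - (?m + ?z) = - (?w + ?z)"
      by (simp_all add: algebra_simps scaleR_half_double[symmetric] flip: scaleR_add_left)
    then have "2 * t * (norm (x - (?m + ?z)))\<^sup>2 + 2 * t * (norm (y - (?m + ?z)))\<^sup>2
      = 2 * t * ((norm (?w - ?z))\<^sup>2 + (norm (?w + ?z))\<^sup>2)"
      unfolding e norm_minus_cancel by (simp only: distrib_left)
    also have "(norm (?w - ?z))\<^sup>2 + (norm (?w + ?z))\<^sup>2 = 2 * (norm ?w)\<^sup>2 + 2 * (norm ?z)\<^sup>2"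
      by (rule parallelogram)
    also have "norm ?w = norm (x - y) / 2"
      unfolding norm_scaleR by simp
    also have "norm ?z = norm z / (2 * sqrt t)"
      using assms unfolding norm_scaleR by simp
    also have "2 * t * (2 * (norm (x - y) / 2)\<^sup>2 + 2 * (norm z / (2 * sqrt t))\<^sup>2) = t * (norm (x - y))\<^sup>2 + (norm z)\<^sup>2"
      using assms by (simp add: power_mult_distrib power_divide field_simps)
    finally show "ennreal (exp (- (2 * t * (norm (x - (?m + ?z)))\<^sup>2)) * exp (- (2 * t * (norm (y - (?m + ?z)))\<^sup>2)))
      = ennreal (exp (- (t * (norm (x - y))\<^sup>2))) * ennreal (exp (- (norm z)\<^sup>2))"
      by (simp add: ennreal_mult[symmetric] exp_add[symmetric] algebra_simps)
  qed
  also have "\<dots> = ennreal (exp (- (t * (norm (x - y))\<^sup>2))) * ennreal (heat_const TYPE('a))"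
    using has_bochner_integral_gaussian[where 'a = 'a]
    by (subst nn_integral_cmult) (auto simp: has_bochner_integral_iff nn_integral_eq_integral)
  finally show ?thesis
    using heat_const_pos[where 'a = 'a] assms
    by (simp add: ennreal_mult[symmetric] mult.assoc mult.left_commute mult.commute)
qed

definition heat_energy :: "real \<Rightarrow> 'a::euclidean_space measure \<Rightarrow> 'a measure \<Rightarrow> real" where
  "heat_energy t \<mu> \<nu> = (\<integral>x. (\<integral>y. exp (- (t * (norm (x - y))\<^sup>2)) \<partial>\<nu>) \<partial>\<mu>)"

text \<open>
  The exponent contains \<open>2 * t\<close>, not \<open>t\<close>: the product of two such potentials integrates to a multiple of
  \<^const>\<open>heat_energy\<close> at time \<open>t\<close>.
\<close>

definition heat_potential :: "real \<Rightarrow> 'a::euclidean_space measure \<Rightarrow> 'a \<Rightarrow> real" where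
  "heat_potential t \<mu> z = (\<integral>x. exp (- (2 * t * (norm (x - z))\<^sup>2)) \<partial>\<mu>)"

lemma borel_prob_measuresD:
  assumes "\<mu> \<in> borel_prob_measures"
  shows "prob_space \<mu>" "sets \<mu> = sets borel" "space \<mu> = UNIV"
  using assms sets_eq_imp_space_eq[of \<mu> borel] by (auto simp: borel_prob_measures_def)

lemma heat_potential_measurable [measurable]:
  assumes "\<mu> \<in> borel_prob_measures"
  shows "heat_potential t \<mu> \<in> borel_measurable borel"
proof -
  interpret prob_space \<mu> by (rule borel_prob_measuresD(1)[OF assms])
  note [measurable_cong] = borel_prob_measuresD(2)[OF assms]
  show ?thesis unfolding heat_potential_def by measurable
qed

lemma integrable_exp_bounded:
  assumes "finite_measure M" "f \<in> borel_measurable M" "\<And>x. f x \<ge> 0"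
  shows "integrable M (\<lambda>x. exp (- f x) :: real)"
proof -
  interpret finite_measure M by fact
  show ?thesis
    using assms by (intro integrable_const_bound[where B = 1]) auto
qed

lemma heat_convolution:
  fixes \<mu> \<nu> :: "'a::euclidean_space measure"
  assumes \<mu>: "\<mu> \<in> borel_prob_measures" and \<nu>: "\<nu> \<in> borel_prob_measures" and t: "t > 0"
  shows "has_bochner_integral lborel (\<lambda>z. heat_potential t \<mu> z * heat_potential t \<nu> z)
     ((1 / (2 * sqrt t)) ^ DIM('a) * heat_const TYPE('a) * heat_energy t \<mu> \<nu>)"
proof (rule has_bochner_integral_nn_integral)
  interpret M: prob_space \<mu> by (rule borel_prob_measuresD(1)[OF \<mu>])
  interpret N: prob_space \<nu> by (rule borel_prob_measuresD(1)[OF \<nu>])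
  interpret MB: pair_sigma_finite \<mu> lborel ..
  interpret NB: pair_sigma_finite \<nu> lborel ..
  note [measurable_cong] = borel_prob_measuresD(2)[OF \<mu>] borel_prob_measuresD(2)[OF \<nu>]
  show "(\<lambda>z. heat_potential t \<mu> z * heat_potential t \<nu> z) \<in> borel_measurable lborel"
    using \<mu> \<nu> by measurable
  let ?C = "(1 / (2 * sqrt t)) ^ DIM('a) * heat_const TYPE('a)"
  have C: "?C \<ge> 0"
    using t heat_const_pos[where 'a = 'a] by simp
  have J: "heat_energy t \<mu> \<nu> \<ge> 0"
    unfolding heat_energy_def by (intro Bochner_Integration.integral_nonneg) auto
  show "0 \<le> ?C * heat_energy t \<mu> \<nu>"
    using C J by simp
  have pot: "ennreal (heat_potential t \<rho> z) = (\<integral>\<^sup>+x. ennreal (exp (- (2 * t * (norm (x - z))\<^sup>2))) \<partial>\<rho>)"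
    if "\<rho> \<in> borel_prob_measures" for \<rho> and z :: 'a
  proof -
    interpret prob_space \<rho> by (rule borel_prob_measuresD(1)[OF that])
    note [measurable_cong] = borel_prob_measuresD(2)[OF that]
    show ?thesis
      unfolding heat_potential_def using t
      by (intro nn_integral_eq_integral[symmetric] integrable_exp_bounded) (auto intro: finite_measure_axioms)
  qed
  show "AE z in lborel. 0 \<le> heat_potential t \<mu> z * heat_potential t \<nu> z"
    unfolding heat_potential_def by (intro AE_I2 mult_nonneg_nonneg Bochner_Integration.integral_nonneg) auto
  have "(\<integral>\<^sup>+z. ennreal (heat_potential t \<mu> z * heat_potential t \<nu> z) \<partial>lborel)
    = (\<integral>\<^sup>+z. (\<integral>\<^sup>+x. (\<integral>\<^sup>+y. ennreal (exp (- (2 * t * (norm (x - z))\<^sup>2)) * exp (- (2 * t * (norm (y - z))\<^sup>2))) \<partial>\<nu>) \<partial>\<mu>) \<partial>lborel)"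
    by (intro nn_integral_cong, subst ennreal_mult')
      (auto simp: heat_potential_def[of t \<mu>] ennreal_mult' pot[OF \<mu>, unfolded heat_potential_def]
        pot[OF \<nu>] nn_integral_cmult nn_integral_multc)
  also have "\<dots> = (\<integral>\<^sup>+x. (\<integral>\<^sup>+z. (\<integral>\<^sup>+y. ennreal (exp (- (2 * t * (norm (x - z))\<^sup>2)) * exp (- (2 * t * (norm (y - z))\<^sup>2))) \<partial>\<nu>) \<partial>lborel) \<partial>\<mu>)"
    by (intro MB.Fubini') measurable
  also have "\<dots> = (\<integral>\<^sup>+x. (\<integral>\<^sup>+y. (\<integral>\<^sup>+z. ennreal (exp (- (2 * t * (norm (x - z))\<^sup>2)) * exp (- (2 * t * (norm (y - z))\<^sup>2))) \<partial>lborel) \<partial>\<nu>) \<partial>\<mu>)"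
    by (intro nn_integral_cong NB.Fubini') measurable
  also have "\<dots> = (\<integral>\<^sup>+x. (\<integral>\<^sup>+y. ennreal (?C * exp (- (t * (norm (x - y))\<^sup>2))) \<partial>\<nu>) \<partial>\<mu>)"
    by (subst nn_integral_gaussian_product[OF t]) simp
  also have "\<dots> = (\<integral>\<^sup>+x. ennreal ?C * ennreal (\<integral>y. exp (- (t * (norm (x - y))\<^sup>2)) \<partial>\<nu>) \<partial>\<mu>)"
  proof (rule nn_integral_cong)
    fix x
    have "integrable \<nu> (\<lambda>y. exp (- (t * (norm (x - y))\<^sup>2)))"
      using t by (intro integrable_exp_bounded) (auto intro: N.finite_measure_axioms)
    then show "(\<integral>\<^sup>+y. ennreal (?C * exp (- (t * (norm (x - y))\<^sup>2))) \<partial>\<nu>) = ennreal ?C * ennreal (\<integral>y. exp (- (t * (norm (x - y))\<^sup>2)) \<partial>\<nu>)"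
      using C by (subst ennreal_mult) (auto simp: nn_integral_cmult nn_integral_eq_integral)
  qed
  also have "\<dots> = ennreal ?C * (\<integral>\<^sup>+x. ennreal (\<integral>y. exp (- (t * (norm (x - y))\<^sup>2)) \<partial>\<nu>) \<partial>\<mu>)"
    by (rule nn_integral_cmult) measurable
  also have "(\<integral>\<^sup>+x. ennreal (\<integral>y. exp (- (t * (norm (x - y))\<^sup>2)) \<partial>\<nu>) \<partial>\<mu>) = ennreal (heat_energy t \<mu> \<nu>)"
    unfolding heat_energy_def
  proof (rule nn_integral_eq_integral)
    have "(\<integral>y. exp (- (t * (norm (x - y))\<^sup>2)) \<partial>\<nu>) \<le> 1" for x
      using t by (intro N.integral_le_const integrable_exp_bounded) (auto intro: N.finite_measure_axioms)
    moreover have "0 \<le> (\<integral>y. exp (- (t * (norm (x - y))\<^sup>2)) \<partial>\<nu>)" for x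
      by (intro Bochner_Integration.integral_nonneg) auto
    ultimately show "integrable \<mu> (\<lambda>x. \<integral>y. exp (- (t * (norm (x - y))\<^sup>2)) \<partial>\<nu>)"
      by (intro M.integrable_const_bound[where B = 1]) auto
  qed (auto intro!: Bochner_Integration.integral_nonneg)
  finally show "(\<integral>\<^sup>+z. ennreal (heat_potential t \<mu> z * heat_potential t \<nu> z) \<partial>lborel) = ennreal (?C * heat_energy t \<mu> \<nu>)"
    using C J by (simp add: ennreal_mult)
qed

text \<open>
  This is the positive definiteness of the Gaussian: the energy of \<open>\<nu> - \<mu>\<close> is a squared \<open>L\<^sup>2\<close> norm.
\<close>

lemma heat_energy_square:
  fixes \<mu> \<nu> :: "'a::euclidean_space measure"
  assumes \<mu>: "\<mu> \<in> borel_prob_measures" and \<nu>: "\<nu> \<in> borel_prob_measures" and t: "t > 0"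
  shows "has_bochner_integral lborel (\<lambda>z. (heat_potential t \<nu> z - heat_potential t \<mu> z)\<^sup>2)
     ((1 / (2 * sqrt t)) ^ DIM('a) * heat_const TYPE('a)
        * (heat_energy t \<nu> \<nu> + heat_energy t \<mu> \<mu> - 2 * heat_energy t \<mu> \<nu>))"
proof -
  let ?C = "(1 / (2 * sqrt t)) ^ DIM('a) * heat_const TYPE('a)"
  have "has_bochner_integral lborel
     (\<lambda>z. heat_potential t \<nu> z * heat_potential t \<nu> z + heat_potential t \<mu> z * heat_potential t \<mu> z
        - 2 * (heat_potential t \<mu> z * heat_potential t \<nu> z))
     (?C * heat_energy t \<nu> \<nu> + ?C * heat_energy t \<mu> \<mu> - 2 * (?C * heat_energy t \<mu> \<nu>))"
    by (intro has_bochner_integral_add has_bochner_integral_diff has_bochner_integral_mult_right heat_convolution assms)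
  then show ?thesis
    by (simp add: algebra_simps power2_eq_square)
qed

lemma heat_energy_pos_def:
  fixes \<mu> \<nu> :: "'a::euclidean_space measure"
  assumes \<mu>: "\<mu> \<in> borel_prob_measures" and \<nu>: "\<nu> \<in> borel_prob_measures" and t: "t > 0"
  shows "0 \<le> heat_energy t \<nu> \<nu> + heat_energy t \<mu> \<mu> - 2 * heat_energy t \<mu> \<nu>"
    and "heat_energy t \<nu> \<nu> + heat_energy t \<mu> \<mu> - 2 * heat_energy t \<mu> \<nu> = 0
       \<Longrightarrow> AE z in lborel. heat_potential t \<nu> z = heat_potential t \<mu> z"
proof -
  let ?C = "(1 / (2 * sqrt t)) ^ DIM('a) * heat_const TYPE('a)"
  let ?E = "heat_energy t \<nu> \<nu> + heat_energy t \<mu> \<mu> - 2 * heat_energy t \<mu> \<nu>"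
  have C: "?C > 0"
    using t heat_const_pos[where 'a = 'a] by simp
  note sq = heat_energy_square[OF assms]
  have "0 \<le> ?C * ?E"
    unfolding has_bochner_integral_integral_eq[OF sq, symmetric]
    by (rule Bochner_Integration.integral_nonneg) simp
  then show "0 \<le> ?E"
    using C by (simp only: zero_le_mult_iff) linarith
  assume "?E = 0"
  then have "(\<integral>z. (heat_potential t \<nu> z - heat_potential t \<mu> z)\<^sup>2 \<partial>lborel) = 0"
    using has_bochner_integral_integral_eq[OF sq] by simp
  moreover have "integrable lborel (\<lambda>z. (heat_potential t \<nu> z - heat_potential t \<mu> z)\<^sup>2)"
    using sq by (auto simp: has_bochner_integral_iff)
  ultimately have "AE z in lborel. (heat_potential t \<nu> z - heat_potential t \<mu> z)\<^sup>2 = 0"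
    by (subst (asm) integral_nonneg_eq_0_iff_AE) auto
  then show "AE z in lborel. heat_potential t \<nu> z = heat_potential t \<mu> z"
    by (rule AE_mp) simp
qed

text \<open>
  Gaussian smoothing is symmetric, so testing a smoothed measure against \<open>f\<close> amounts to testing the
  measure against a smoothed \<open>f\<close>.
\<close>

lemma integral_heat_potential:
  fixes f :: "'a::euclidean_space \<Rightarrow> real"
  assumes \<mu>: "\<mu> \<in> borel_prob_measures" and t: "t > 0"
    and f [measurable]: "f \<in> borel_measurable borel" and f0: "\<And>x. f x \<ge> 0"
  shows "(\<integral>\<^sup>+z. ennreal (f z * heat_potential t \<mu> z) \<partial>lborel)
    = ennreal ((1 / sqrt (2 * t)) ^ DIM('a)) *
       (\<integral>\<^sup>+x. (\<integral>\<^sup>+w. ennreal (f (x + (1 / sqrt (2 * t)) *\<^sub>R w) * exp (- (norm w)\<^sup>2)) \<partial>lborel) \<partial>\<mu>)"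
proof -
  interpret M: prob_space \<mu> by (rule borel_prob_measuresD(1)[OF \<mu>])
  interpret MB: pair_sigma_finite \<mu> lborel ..
  note [measurable_cong] = borel_prob_measuresD(2)[OF \<mu>]
  let ?c = "1 / sqrt (2 * t)"
  have "ennreal (f z * heat_potential t \<mu> z) = (\<integral>\<^sup>+x. ennreal (f z * exp (- (2 * t * (norm (x - z))\<^sup>2))) \<partial>\<mu>)" for z
  proof -
    have "integrable \<mu> (\<lambda>x. f z * exp (- (2 * t * (norm (x - z))\<^sup>2)))"
      using t by (intro integrable_mult_right integrable_exp_bounded) (auto intro: M.finite_measure_axioms)
    then show ?thesis
      unfolding heat_potential_def
      by (subst nn_integral_eq_integral) (auto simp: f0)
  qed
  then have "(\<integral>\<^sup>+z. ennreal (f z * heat_potential t \<mu> z) \<partial>lborel)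
    = (\<integral>\<^sup>+z. (\<integral>\<^sup>+x. ennreal (f z * exp (- (2 * t * (norm (x - z))\<^sup>2))) \<partial>\<mu>) \<partial>lborel)"
    by simp
  also have "\<dots> = (\<integral>\<^sup>+x. (\<integral>\<^sup>+z. ennreal (f z * exp (- (2 * t * (norm (x - z))\<^sup>2))) \<partial>lborel) \<partial>\<mu>)"
    by (intro MB.Fubini') measurable
  also have "\<dots> = (\<integral>\<^sup>+x. ennreal (?c ^ DIM('a)) * (\<integral>\<^sup>+w. ennreal (f (x + ?c *\<^sub>R w) * exp (- (norm w)\<^sup>2)) \<partial>lborel) \<partial>\<mu>)"
  proof (rule nn_integral_cong)
    fix x
    have "(\<integral>\<^sup>+z. ennreal (f z * exp (- (2 * t * (norm (x - z))\<^sup>2))) \<partial>lborel)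
      = ennreal (?c ^ DIM('a)) * (\<integral>\<^sup>+w. ennreal (f (x + ?c *\<^sub>R w) * exp (- (2 * t * (norm (x - (x + ?c *\<^sub>R w)))\<^sup>2))) \<partial>lborel)"
      by (rule nn_integral_lborel_affine) (use t in auto)
    also have "\<dots> = ennreal (?c ^ DIM('a)) * (\<integral>\<^sup>+w. ennreal (f (x + ?c *\<^sub>R w) * exp (- (norm w)\<^sup>2)) \<partial>lborel)"
      using t by (simp add: power_divide)
    finally show "(\<integral>\<^sup>+z. ennreal (f z * exp (- (2 * t * (norm (x - z))\<^sup>2))) \<partial>lborel)
      = ennreal (?c ^ DIM('a)) * (\<integral>\<^sup>+w. ennreal (f (x + ?c *\<^sub>R w) * exp (- (norm w)\<^sup>2)) \<partial>lborel)" .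
  qed
  also have "\<dots> = ennreal (?c ^ DIM('a)) * (\<integral>\<^sup>+x. (\<integral>\<^sup>+w. ennreal (f (x + ?c *\<^sub>R w) * exp (- (norm w)\<^sup>2)) \<partial>lborel) \<partial>\<mu>)"
    by (rule nn_integral_cmult) measurable
  finally show ?thesis .
qed

lemma gaussian_smoothing_tendsto:
  fixes f :: "'a::euclidean_space \<Rightarrow> real" and c :: "nat \<Rightarrow> real"
  assumes \<mu>: "\<mu> \<in> borel_prob_measures" and c: "c \<longlonglongrightarrow> 0"
    and cont: "continuous_on UNIV f" and f: "\<And>x. 0 \<le> f x" "\<And>x. f x \<le> 1"
  shows "(\<lambda>n. \<integral>\<^sup>+x. (\<integral>\<^sup>+w. ennreal (f (x + c n *\<^sub>R w) * exp (- (norm w)\<^sup>2)) \<partial>lborel) \<partial>\<mu>)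
     \<longlonglongrightarrow> (\<integral>\<^sup>+x. ennreal (f x) \<partial>\<mu>) * ennreal (heat_const TYPE('a))"
proof -
  interpret M: prob_space \<mu> by (rule borel_prob_measuresD(1)[OF \<mu>])
  interpret MB: pair_sigma_finite \<mu> lborel ..
  note [measurable_cong] = borel_prob_measuresD(2)[OF \<mu>]
  have [measurable]: "f \<in> borel_measurable borel"
    using cont by (rule borel_measurable_continuous_onI)
  let ?g = "\<lambda>n (x, w). ennreal (f (x + c n *\<^sub>R w) * exp (- (norm w)\<^sup>2))"
  have gauss: "(\<integral>\<^sup>+w. ennreal (exp (- (norm (w::'a))\<^sup>2)) \<partial>lborel) = ennreal (heat_const TYPE('a))"
    using has_bochner_integral_gaussian[where 'a = 'a]
    by (simp add: has_bochner_integral_iff nn_integral_eq_integral)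
  have "(\<lambda>n. \<integral>\<^sup>+p. ?g n p \<partial>(\<mu> \<Otimes>\<^sub>M lborel)) \<longlonglongrightarrow> (\<integral>\<^sup>+p. (\<lambda>(x, w :: 'a). ennreal (f x * exp (- (norm w)\<^sup>2))) p \<partial>(\<mu> \<Otimes>\<^sub>M lborel))"
  proof (rule nn_integral_dominated_convergence[where w = "\<lambda>(x :: 'a, w :: 'a). ennreal (exp (- (norm w)\<^sup>2))"])
    show "?g n \<in> borel_measurable (\<mu> \<Otimes>\<^sub>M lborel)" for n
      by measurable
    show "(\<lambda>(x, w :: 'a). ennreal (f x * exp (- (norm w)\<^sup>2))) \<in> borel_measurable (\<mu> \<Otimes>\<^sub>M lborel)"
      by measurable
    show "(\<lambda>(x :: 'a, w :: 'a). ennreal (exp (- (norm w)\<^sup>2))) \<in> borel_measurable (\<mu> \<Otimes>\<^sub>M lborel)"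
      by measurable
    show "AE p in \<mu> \<Otimes>\<^sub>M lborel. ?g n p \<le> (\<lambda>(x, w :: 'a). ennreal (exp (- (norm w)\<^sup>2))) p" for n
      using f by (intro AE_I2) (auto simp: split_beta intro!: ennreal_leI mult_left_le_one_le)
    show "(\<integral>\<^sup>+p. (\<lambda>(x, w :: 'a). ennreal (exp (- (norm w)\<^sup>2))) p \<partial>(\<mu> \<Otimes>\<^sub>M lborel)) < \<infinity>"
      by (subst lborel.nn_integral_fst[symmetric]) (auto simp: gauss M.emeasure_space_1)
    show "AE p in \<mu> \<Otimes>\<^sub>M lborel. (\<lambda>n. ?g n p) \<longlonglongrightarrow> (\<lambda>(x, w :: 'a). ennreal (f x * exp (- (norm w)\<^sup>2))) p"
    proof (intro AE_I2, clarify)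
      fix x w :: 'a
      have "(\<lambda>n. x + c n *\<^sub>R w) \<longlonglongrightarrow> x + 0 *\<^sub>R w"
        by (intro tendsto_add tendsto_const tendsto_scaleR c)
      then have "(\<lambda>n. f (x + c n *\<^sub>R w)) \<longlonglongrightarrow> f x"
        using cont by (auto intro!: continuous_on_tendsto_compose[of UNIV f])
      then show "(\<lambda>n. ennreal (f (x + c n *\<^sub>R w) * exp (- (norm w)\<^sup>2))) \<longlonglongrightarrow> ennreal (f x * exp (- (norm w)\<^sup>2))"
        by (intro tendsto_intros)
    qed
  qed
  moreover have "(\<integral>\<^sup>+p. ?g n p \<partial>(\<mu> \<Otimes>\<^sub>M lborel)) = (\<integral>\<^sup>+x. (\<integral>\<^sup>+w. ennreal (f (x + c n *\<^sub>R w) * exp (- (norm w)\<^sup>2)) \<partial>lborel) \<partial>\<mu>)" for n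
  proof -
    have "?g n \<in> borel_measurable (\<mu> \<Otimes>\<^sub>M lborel)"
      by measurable
    from lborel.nn_integral_fst[OF this] show ?thesis by simp
  qed
  moreover have "(\<integral>\<^sup>+p. (\<lambda>(x, w :: 'a). ennreal (f x * exp (- (norm w)\<^sup>2))) p \<partial>(\<mu> \<Otimes>\<^sub>M lborel)) = (\<integral>\<^sup>+x. ennreal (f x) \<partial>\<mu>) * ennreal (heat_const TYPE('a))"
  proof -
    have "(\<lambda>(x, w :: 'a). ennreal (f x * exp (- (norm w)\<^sup>2))) \<in> borel_measurable (\<mu> \<Otimes>\<^sub>M lborel)"
      by measurable
    from lborel.nn_integral_fst[OF this] show ?thesis
      using f(1) by (simp add: ennreal_mult nn_integral_cmult nn_integral_multc gauss)
  qed
  ultimately show ?thesis by simp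
qed

text \<open>
  Closed sets generate the Borel sets, and the indicator of a closed set is the limit of the
  functions \<open>max 0 (1 - n * infdist x C)\<close>.
\<close>

lemma measure_eq_if_continuous_integrals_eq:
  fixes \<mu> \<nu> :: "'a::euclidean_space measure"
  assumes \<mu>: "\<mu> \<in> borel_prob_measures" and \<nu>: "\<nu> \<in> borel_prob_measures"
    and eq: "\<And>f :: 'a \<Rightarrow> real. continuous_on UNIV f \<Longrightarrow> (\<And>x. 0 \<le> f x) \<Longrightarrow> (\<And>x. f x \<le> 1) \<Longrightarrow>
       (\<integral>\<^sup>+x. ennreal (f x) \<partial>\<mu>) = (\<integral>\<^sup>+x. ennreal (f x) \<partial>\<nu>)"
  shows "\<mu> = \<nu>"
proof (rule measure_eqI_generator_eq[where E = "Collect closed" and \<Omega> = UNIV and A = "\<lambda>_. UNIV"])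
  interpret M: prob_space \<mu> by (rule borel_prob_measuresD(1)[OF \<mu>])
  interpret N: prob_space \<nu> by (rule borel_prob_measuresD(1)[OF \<nu>])
  show "Int_stable (Collect closed :: 'a set set)"
    by (auto simp: Int_stable_def)
  show "sets \<mu> = sigma_sets UNIV (Collect closed)" "sets \<nu> = sigma_sets UNIV (Collect closed)"
    using borel_prob_measuresD(2)[OF \<mu>] borel_prob_measuresD(2)[OF \<nu>]
    by (simp_all add: borel_eq_closed sets_measure_of)
  show "emeasure \<mu> ((\<lambda>_. UNIV) (i::nat)) \<noteq> \<infinity>" for i
    by simp
  fix C :: "'a set" assume "C \<in> Collect closed"
  then have C: "closed C" by simp
  show "emeasure \<mu> C = emeasure \<nu> C"
  proof (cases "C = {}")
    case False
    define f where "f n x = max 0 (1 - real n * infdist x C)" for n x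
    have lim: "(\<lambda>n. \<integral>\<^sup>+x. ennreal (f n x) \<partial>\<rho>) \<longlonglongrightarrow> emeasure \<rho> C" if \<rho>: "\<rho> \<in> borel_prob_measures" for \<rho>
    proof -
      interpret prob_space \<rho> by (rule borel_prob_measuresD(1)[OF \<rho>])
      note [measurable_cong] = borel_prob_measuresD(2)[OF \<rho>]
      have [measurable]: "C \<in> sets borel" using C by simp
      have "(\<lambda>n. \<integral>\<^sup>+x. ennreal (f n x) \<partial>\<rho>) \<longlonglongrightarrow> (\<integral>\<^sup>+x. indicator C x \<partial>\<rho>)"
      proof (rule nn_integral_dominated_convergence[where w = "\<lambda>_. 1"])
        show "(\<lambda>x. ennreal (f n x)) \<in> borel_measurable \<rho>" for n
        proof -
          have "continuous_on UNIV (f n)"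
            unfolding f_def by (intro continuous_intros)
          then have [measurable]: "f n \<in> borel_measurable borel"
            by (rule borel_measurable_continuous_onI)
          show ?thesis by measurable
        qed
        show "AE x in \<rho>. (\<lambda>n. ennreal (f n x)) \<longlonglongrightarrow> indicator C x"
        proof (rule AE_I2)
          fix x
          show "(\<lambda>n. ennreal (f n x)) \<longlonglongrightarrow> indicator C x"
          proof (cases "x \<in> C")
            case True
            then show ?thesis by (simp add: f_def)
          next
            case False
            then have d: "infdist x C > 0"
              using C \<open>C \<noteq> {}\<close> in_closed_iff_infdist_zero[of C x] infdist_nonneg[of x C] by force
            obtain N :: nat where N: "real N * infdist x C > 1"
              using reals_Archimedean3[OF d] by blast
            have "f n x = 0" if "n \<ge> N" for n
            proof -
              have "real N * infdist x C \<le> real n * infdist x C"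
                using that d by (intro mult_right_mono) auto
              then show ?thesis using N by (simp add: f_def)
            qed
            then have "\<forall>\<^sub>F n in sequentially. ennreal (f n x) = indicator C x"
              using False by (auto simp: eventually_sequentially intro!: exI[of _ N])
            then show ?thesis by (rule tendsto_eventually)
          qed
        qed
        show "AE x in \<rho>. ennreal (f n x) \<le> 1" for n
          by (intro AE_I2) (auto simp: f_def ennreal_le_1 infdist_nonneg)
      qed (use C in \<open>auto simp: emeasure_space_1\<close>)
      then show ?thesis using C borel_prob_measuresD(2)[OF \<rho>] by simp
    qed
    have "(\<integral>\<^sup>+x. ennreal (f n x) \<partial>\<mu>) = (\<integral>\<^sup>+x. ennreal (f n x) \<partial>\<nu>)" for n
    proof (rule eq)
      show "continuous_on UNIV (f n)"
        unfolding f_def by (intro continuous_intros)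
    qed (auto simp: f_def infdist_nonneg)
    then show ?thesis
      using LIMSEQ_unique[OF lim[OF \<mu>]] lim[OF \<nu>] by simp
  qed simp
qed auto

text \<open>
  Narrow Gaussians approximate the identity, so it is enough to know the smoothed measures for arbitrarily
  large \<open>t\<close>. The hypothesis has this form because the energy identity provides equality only for almost every
  \<open>t\<close>.
\<close>

lemma measure_eq_if_heat_potentials_eq:
  fixes \<mu> \<nu> :: "'a::euclidean_space measure"
  assumes \<mu>: "\<mu> \<in> borel_prob_measures" and \<nu>: "\<nu> \<in> borel_prob_measures"
    and eq: "\<And>T. \<exists>t>T. AE z in lborel. heat_potential t \<nu> z = heat_potential t \<mu> z"
  shows "\<mu> = \<nu>"
proof (rule measure_eq_if_continuous_integrals_eq[OF \<mu> \<nu>])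
  fix f :: "'a \<Rightarrow> real"
  assume cont: "continuous_on UNIV f" and f: "\<And>x. 0 \<le> f x" "\<And>x. f x \<le> 1"
  have [measurable]: "f \<in> borel_measurable borel"
    using cont by (rule borel_measurable_continuous_onI)
  have "\<exists>t. \<forall>n::nat. t n > real n \<and> (AE z in lborel. heat_potential (t n) \<nu> z = heat_potential (t n) \<mu> z)"
    by (rule choice, rule allI, rule eq)
  then obtain t where t: "\<And>n::nat. t n > real n" "\<And>n. AE z in lborel. heat_potential (t n) \<nu> z = heat_potential (t n) \<mu> z"
    by blast
  have t0: "t n > 0" for n using t(1)[of n] by linarith
  \<comment> \<open>The width of the Gaussian with exponent \<open>2 * t n\<close>.\<close>
  define c where "c n = 1 / sqrt (2 * t n)" for n
  have "filterlim t at_top sequentially"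
    by (rule filterlim_at_top_mono[OF filterlim_real_sequentially]) (use t(1) in \<open>auto intro!: always_eventually less_imp_le\<close>)
  then have "filterlim (\<lambda>n. sqrt (2 * t n)) at_top sequentially"
    by (intro filterlim_compose[OF sqrt_at_top] filterlim_tendsto_pos_mult_at_top[OF tendsto_const]) auto
  then have c: "c \<longlonglongrightarrow> 0"
    unfolding c_def by (intro real_tendsto_divide_at_top[OF tendsto_const])
  have smooth: "(\<integral>\<^sup>+x. (\<integral>\<^sup>+w. ennreal (f (x + c n *\<^sub>R w) * exp (- (norm w)\<^sup>2)) \<partial>lborel) \<partial>\<mu>)
      = (\<integral>\<^sup>+x. (\<integral>\<^sup>+w. ennreal (f (x + c n *\<^sub>R w) * exp (- (norm w)\<^sup>2)) \<partial>lborel) \<partial>\<nu>)" for n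
  proof -
    have "(\<integral>\<^sup>+z. ennreal (f z * heat_potential (t n) \<mu> z) \<partial>lborel) = (\<integral>\<^sup>+z. ennreal (f z * heat_potential (t n) \<nu> z) \<partial>lborel)"
      by (rule nn_integral_cong_AE, use t(2)[of n] in eventually_elim) simp
    then show ?thesis
      unfolding integral_heat_potential[OF \<mu> t0 \<open>f \<in> borel_measurable borel\<close> f(1)]
        integral_heat_potential[OF \<nu> t0 \<open>f \<in> borel_measurable borel\<close> f(1)] c_def[symmetric]
      using t0[of n] by (subst (asm) ennreal_mult_cancel_left) (auto simp: c_def)
  qed
  have "(\<integral>\<^sup>+x. ennreal (f x) \<partial>\<mu>) * ennreal (heat_const TYPE('a)) = (\<integral>\<^sup>+x. ennreal (f x) \<partial>\<nu>) * ennreal (heat_const TYPE('a))"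
    by (rule LIMSEQ_unique[OF gaussian_smoothing_tendsto[OF \<mu> c cont f, unfolded smooth]
          gaussian_smoothing_tendsto[OF \<nu> c cont f]])
  then show "(\<integral>\<^sup>+x. ennreal (f x) \<partial>\<mu>) = (\<integral>\<^sup>+x. ennreal (f x) \<partial>\<nu>)"
    using heat_const_pos[where 'a = 'a] by (simp add: mult.commute[of _ "ennreal (heat_const TYPE('a))"] ennreal_mult_cancel_left)
qed

section \<open>Positivity of the Riesz energy and the equilibrium criterion\<close>

text \<open>
  For \<open>s \<ge> 0\<close> the kernel is infinite on the diagonal while \<^const>\<open>riesz_profile\<close> has a finite default
  value at \<open>0\<close>. The first conjunct therefore requires the diagonal to be a null set in this case.
\<close>

definition pair_integrable :: "real \<Rightarrow> 'a::euclidean_space measure \<Rightarrow> 'a measure \<Rightarrow> bool" where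
  "pair_integrable s \<mu> \<nu> \<longleftrightarrow>
     (AE p in \<mu> \<Otimes>\<^sub>M \<nu>. fst p \<noteq> snd p \<or> s < 0) \<and>
     integrable (\<mu> \<Otimes>\<^sub>M \<nu>) (\<lambda>p. riesz_profile s (norm (fst p - snd p)))"

definition mutual_energy :: "real \<Rightarrow> 'a::euclidean_space measure \<Rightarrow> 'a measure \<Rightarrow> real" where
  "mutual_energy s \<mu> \<nu> = (\<integral>p. riesz_profile s (norm (fst p - snd p)) \<partial>(\<mu> \<Otimes>\<^sub>M \<nu>))"

lemma mutual_energy_laplace:
  fixes \<mu> \<nu> :: "'a::euclidean_space measure"
  assumes s: "s > -2" and \<mu>: "\<mu> \<in> borel_prob_measures" and \<nu>: "\<nu> \<in> borel_prob_measures"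
    and pi: "pair_integrable s \<mu> \<nu>"
  shows "has_bochner_integral lborel (\<lambda>t. laplace_weight s t * (heat_energy t \<mu> \<nu> - exp (- t)))
           (laplace_const s * (mutual_energy s \<mu> \<nu> - riesz_profile s 1))"
proof -
  interpret M: prob_space \<mu> by (rule borel_prob_measuresD(1)[OF \<mu>])
  interpret N: prob_space \<nu> by (rule borel_prob_measuresD(1)[OF \<nu>])
  interpret MN: pair_prob_space \<mu> \<nu> ..
  interpret P: pair_sigma_finite "\<mu> \<Otimes>\<^sub>M \<nu>" lborel ..
  note [measurable_cong] = borel_prob_measuresD(2)[OF \<mu>] borel_prob_measuresD(2)[OF \<nu>]
  define r where "r p = norm (fst p - snd p :: 'a)" for p
  have [measurable]: "r \<in> borel_measurable (\<mu> \<Otimes>\<^sub>M \<nu>)"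
    unfolding r_def by measurable
  define f where "f = (\<lambda>(p, t). laplace_weight s t * (exp (- (t * (r p)\<^sup>2)) - exp (- t)))"
  have [measurable]: "f \<in> borel_measurable ((\<mu> \<Otimes>\<^sub>M \<nu>) \<Otimes>\<^sub>M lborel)"
    unfolding f_def by measurable
  have AE: "AE p in \<mu> \<Otimes>\<^sub>M \<nu>. r p > 0 \<or> s < 0"
    using pi unfolding pair_integrable_def r_def by (auto elim!: AE_mp)
  have int: "integrable (\<mu> \<Otimes>\<^sub>M \<nu>) (\<lambda>p. riesz_profile s (r p))"
    using pi unfolding pair_integrable_def r_def by auto
  have r0: "r p \<ge> 0" for p by (simp add: r_def)
  have f_int: "integrable ((\<mu> \<Otimes>\<^sub>M \<nu>) \<Otimes>\<^sub>M lborel) f"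
  proof (rule P.Fubini_integrable)
    show "f \<in> borel_measurable ((\<mu> \<Otimes>\<^sub>M \<nu>) \<Otimes>\<^sub>M lborel)"
      by measurable
    show "AE p in \<mu> \<Otimes>\<^sub>M \<nu>. integrable lborel (\<lambda>t. f (p, t))"
      using AE
    proof eventually_elim
      case (elim p)
      show ?case
        using laplace_profile[OF s r0 elim] by (simp only: f_def prod.case has_bochner_integral_iff)
    qed
    have "integrable (\<mu> \<Otimes>\<^sub>M \<nu>) (\<lambda>p. laplace_const s * \<bar>riesz_profile s (r p) - riesz_profile s 1\<bar>)"
      using int by (intro integrable_mult_right integrable_abs Bochner_Integration.integrable_diff) auto
    then show "integrable (\<mu> \<Otimes>\<^sub>M \<nu>) (\<lambda>p. \<integral>t. norm (f (p, t)) \<partial>lborel)"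
    proof (rule integrable_cong_AE_imp)
      show "(\<lambda>p. \<integral>t. norm (f (p, t)) \<partial>lborel) \<in> borel_measurable (\<mu> \<Otimes>\<^sub>M \<nu>)"
        by measurable
      show "AE p in \<mu> \<Otimes>\<^sub>M \<nu>. laplace_const s * \<bar>riesz_profile s (r p) - riesz_profile s 1\<bar> = (\<integral>t. norm (f (p, t)) \<partial>lborel)"
        using AE
      proof eventually_elim
        case (elim p)
        show ?case
          using has_bochner_integral_integral_eq[OF laplace_profile_abs[OF s r0 elim]] by (simp only: f_def prod.case real_norm_def)
      qed
    qed
  qed
  have inner: "(\<integral>p. f (p, t) \<partial>(\<mu> \<Otimes>\<^sub>M \<nu>)) = laplace_weight s t * (heat_energy t \<mu> \<nu> - exp (- t))" for t
  proof (cases "t > 0")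
    case True
    have i: "integrable (\<mu> \<Otimes>\<^sub>M \<nu>) (\<lambda>p. exp (- (t * (r p)\<^sup>2)))"
      using True by (intro integrable_exp_bounded) (auto intro: MN.finite_measure_axioms)
    then have "(\<integral>p. exp (- (t * (r p)\<^sup>2)) \<partial>(\<mu> \<Otimes>\<^sub>M \<nu>)) = heat_energy t \<mu> \<nu>"
      unfolding heat_energy_def r_def using MN.integral_fst'[OF i] by (simp add: r_def)
    then show ?thesis
      using i by (simp add: f_def MN.prob_space)
  qed (simp add: f_def laplace_weight_def)
  have "(\<integral>t. (\<integral>p. f (p, t) \<partial>(\<mu> \<Otimes>\<^sub>M \<nu>)) \<partial>lborel) = (\<integral>p. (\<integral>t. f (p, t) \<partial>lborel) \<partial>(\<mu> \<Otimes>\<^sub>M \<nu>))"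
    using P.Fubini_integral[of "\<lambda>p t. f (p, t)"] f_int by simp
  also have "\<dots> = (\<integral>p. laplace_const s * (riesz_profile s (r p) - riesz_profile s 1) \<partial>(\<mu> \<Otimes>\<^sub>M \<nu>))"
  proof (rule integral_cong_AE)
    show "(\<lambda>p. \<integral>t. f (p, t) \<partial>lborel) \<in> borel_measurable (\<mu> \<Otimes>\<^sub>M \<nu>)"
      by measurable
    show "(\<lambda>p. laplace_const s * (riesz_profile s (r p) - riesz_profile s 1)) \<in> borel_measurable (\<mu> \<Otimes>\<^sub>M \<nu>)"
      by measurable
    show "AE p in \<mu> \<Otimes>\<^sub>M \<nu>. (\<integral>t. f (p, t) \<partial>lborel) = laplace_const s * (riesz_profile s (r p) - riesz_profile s 1)"
      using AE
    proof eventually_elim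
      case (elim p)
      show ?case
        using has_bochner_integral_integral_eq[OF laplace_profile[OF s r0 elim]] by (simp only: f_def prod.case)
    qed
  qed
  also have "\<dots> = laplace_const s * (mutual_energy s \<mu> \<nu> - riesz_profile s 1)"
    using int by (simp add: mutual_energy_def r_def MN.prob_space)
  finally have "(\<integral>t. laplace_weight s t * (heat_energy t \<mu> \<nu> - exp (- t)) \<partial>lborel) = laplace_const s * (mutual_energy s \<mu> \<nu> - riesz_profile s 1)"
    unfolding inner .
  moreover have "integrable lborel (\<lambda>t. \<integral>p. f (p, t) \<partial>(\<mu> \<Otimes>\<^sub>M \<nu>))"
    using P.integrable_snd[of "\<lambda>p t. f (p, t)"] f_int by simp
  ultimately show ?thesis
    unfolding inner by (simp add: has_bochner_integral_iff)
qed

text \<open>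
  Integrate the positive definiteness of the Gaussians over \<open>t\<close>. The normalizations \<open>riesz_profile s 1\<close> cancel
  because all measures have mass one. In the case of equality the Gaussian energies of the difference vanish for almost
  every \<open>t\<close>, hence for arbitrarily large \<open>t\<close>.
\<close>

lemma riesz_energy_positive:
  fixes \<mu> \<nu> :: "'a::euclidean_space measure"
  assumes s: "s > -2" and \<mu>: "\<mu> \<in> borel_prob_measures" and \<nu>: "\<nu> \<in> borel_prob_measures"
    and pi: "pair_integrable s \<mu> \<mu>" "pair_integrable s \<nu> \<mu>" "pair_integrable s \<nu> \<nu>"
  shows "2 * mutual_energy s \<nu> \<mu> \<le> mutual_energy s \<nu> \<nu> + mutual_energy s \<mu> \<mu>"
    and "2 * mutual_energy s \<nu> \<mu> = mutual_energy s \<nu> \<nu> + mutual_energy s \<mu> \<mu> \<Longrightarrow> \<nu> = \<mu>"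
proof -
  let ?E = "\<lambda>t. heat_energy t \<mu> \<mu> + heat_energy t \<nu> \<nu> - 2 * heat_energy t \<nu> \<mu>"
  let ?I = "mutual_energy s \<mu> \<mu> + mutual_energy s \<nu> \<nu> - 2 * mutual_energy s \<nu> \<mu>"
  have "has_bochner_integral lborel
     (\<lambda>t. laplace_weight s t * (heat_energy t \<mu> \<mu> - exp (- t)) + laplace_weight s t * (heat_energy t \<nu> \<nu> - exp (- t))
        - 2 * (laplace_weight s t * (heat_energy t \<nu> \<mu> - exp (- t))))
     (laplace_const s * (mutual_energy s \<mu> \<mu> - riesz_profile s 1) + laplace_const s * (mutual_energy s \<nu> \<nu> - riesz_profile s 1)
        - 2 * (laplace_const s * (mutual_energy s \<nu> \<mu> - riesz_profile s 1)))"
    by (intro has_bochner_integral_add has_bochner_integral_diff has_bochner_integral_mult_right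
        mutual_energy_laplace s \<mu> \<nu> pi)
  then have main: "has_bochner_integral lborel (\<lambda>t. laplace_weight s t * ?E t) (laplace_const s * ?I)"
    by (simp add: algebra_simps)
  have nonneg: "0 \<le> laplace_weight s t * ?E t" for t
  proof (cases "t > 0")
    case True
    then show ?thesis
      using heat_energy_pos_def(1)[OF \<nu> \<mu> True] laplace_weight_nonneg[of s t] by simp
  qed (simp add: laplace_weight_def)
  have "0 \<le> laplace_const s * ?I"
    unfolding has_bochner_integral_integral_eq[OF main, symmetric]
    by (rule Bochner_Integration.integral_nonneg) (rule nonneg)
  then have "0 \<le> ?I"
    using laplace_const_pos[OF s] by (simp only: zero_le_mult_iff) linarith
  then show "2 * mutual_energy s \<nu> \<mu> \<le> mutual_energy s \<nu> \<nu> + mutual_energy s \<mu> \<mu>"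
    by linarith
  assume "2 * mutual_energy s \<nu> \<mu> = mutual_energy s \<nu> \<nu> + mutual_energy s \<mu> \<mu>"
  then have "(\<integral>t. laplace_weight s t * ?E t \<partial>lborel) = 0"
    using has_bochner_integral_integral_eq[OF main] by simp
  moreover have "integrable lborel (\<lambda>t. laplace_weight s t * ?E t)"
    using main by (simp add: has_bochner_integral_iff)
  ultimately have "AE t in lborel. laplace_weight s t * ?E t = 0"
    using integral_nonneg_eq_0_iff_AE[of lborel "\<lambda>t. laplace_weight s t * ?E t"] nonneg by blast
  then have AE: "AE t in lborel. t > 0 \<longrightarrow> ?E t = 0"
  proof eventually_elim
    case (elim t)
    then show ?case using laplace_weight_pos[of t s] by (simp only: mult_eq_0_iff) linarith
  qed
  show "\<nu> = \<mu>"
  proof (rule measure_eq_if_heat_potentials_eq[OF \<nu> \<mu>])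
    fix T :: real
    \<comment> \<open>A set of full measure meets every interval of positive length.\<close>
    have "\<exists>t\<in>{max T 0<..<max T 0 + 1}. t > 0 \<longrightarrow> ?E t = 0"
    proof (rule ccontr)
      assume no: "\<not> ?thesis"
      have "AE t in lborel. t \<notin> {max T 0<..<max T 0 + 1}"
        using AE
      proof eventually_elim
        case (elim t)
        then show ?case using no by blast
      qed
      then have "emeasure lborel {max T 0<..<max T 0 + 1} = 0"
        by (subst (asm) AE_iff_measurable[where N = "{max T 0<..<max T 0 + 1}"]) auto
      moreover have "emeasure lborel {max T 0<..<max T 0 + 1} = ennreal (max T 0 + 1 - max T 0)"
        by (rule emeasure_lborel_Ioo) simp
      ultimately show False by simp
    qed
    then obtain t where t: "t > T" "t > 0" "?E t = 0" by auto
    then show "\<exists>t>T. AE z in lborel. heat_potential t \<mu> z = heat_potential t \<nu> z"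
      using heat_energy_pos_def(2)[OF \<nu> \<mu> t(2,3)] by auto
  qed
qed

lemma ereal_integral_eq_integral:
  assumes g: "integrable M g" and f: "AE x in M. f x = ereal (g x)"
  shows "ereal_integral M f = ereal (\<integral>x. g x \<partial>M)"
proof -
  have "(\<integral>\<^sup>+x. e2ennreal (f x) \<partial>M) = (\<integral>\<^sup>+x. ennreal (g x) \<partial>M)"
    by (rule nn_integral_cong_AE, use f in eventually_elim) simp
  moreover have "(\<integral>\<^sup>+x. e2ennreal (- f x) \<partial>M) = (\<integral>\<^sup>+x. ennreal (- g x) \<partial>M)"
    by (rule nn_integral_cong_AE, use f in eventually_elim) simp
  moreover have "(\<integral>\<^sup>+x. ennreal (g x) \<partial>M) \<noteq> \<infinity>" "(\<integral>\<^sup>+x. ennreal (- g x) \<partial>M) \<noteq> \<infinity>"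
    using g by (auto simp: real_integrable_def)
  ultimately show ?thesis
    unfolding ereal_integral_def real_lebesgue_integral_def[OF g]
    by (cases "\<integral>\<^sup>+x. ennreal (g x) \<partial>M"; cases "\<integral>\<^sup>+x. ennreal (- g x) \<partial>M") (auto simp: enn2ereal_ennreal)
qed

lemma ereal_integral_finite:
  assumes "prob_space M" and f [measurable]: "f \<in> borel_measurable M"
    and lower: "\<And>x. ereal c \<le> f x" and fin: "ereal_integral M f < \<infinity>"
  shows "AE x in M. f x = ereal (real_of_ereal (f x))" and "integrable M (\<lambda>x. real_of_ereal (f x))"
proof -
  have neg: "(\<integral>\<^sup>+x. e2ennreal (- f x) \<partial>M) < \<infinity>"
    by (rule neg_part_finite[OF assms(1) lower])
  then have pos: "(\<integral>\<^sup>+x. e2ennreal (f x) \<partial>M) < \<infinity>"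
    using fin unfolding ereal_integral_def
    by (cases "\<integral>\<^sup>+x. e2ennreal (f x) \<partial>M"; cases "\<integral>\<^sup>+x. e2ennreal (- f x) \<partial>M")
      (auto simp: enn2ereal_ennreal)
  then have "AE x in M. e2ennreal (f x) \<noteq> \<infinity>"
    by (intro nn_integral_PInf_AE) auto
  then show AE: "AE x in M. f x = ereal (real_of_ereal (f x))"
  proof eventually_elim
    case (elim x)
    then show ?case using lower[of x] by (cases "f x") auto
  qed
  have "(\<integral>\<^sup>+x. ennreal (real_of_ereal (f x)) \<partial>M) = (\<integral>\<^sup>+x. e2ennreal (f x) \<partial>M)"
  proof (rule nn_integral_cong_AE, use AE in eventually_elim)
    case (elim x)
    then show ?case by (cases "f x") auto
  qed
  moreover have "(\<integral>\<^sup>+x. ennreal (- real_of_ereal (f x)) \<partial>M) = (\<integral>\<^sup>+x. e2ennreal (- f x) \<partial>M)"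
  proof (rule nn_integral_cong_AE, use AE in eventually_elim)
    case (elim x)
    then show ?case by (cases "f x") auto
  qed
  ultimately show "integrable M (\<lambda>x. real_of_ereal (f x))"
    using pos neg by (simp add: real_integrable_def less_top)
qed

lemma riesz_kernel_measurable [measurable]:
  "riesz_kernel s \<in> borel_measurable (borel :: 'a::euclidean_space measure)"
  unfolding riesz_kernel_def by measurable

text \<open>
  Let \<open>\<langle>\<nu>, \<mu>\<rangle>\<close> denote the mutual energy and \<open>\<nu>(V)\<close> the integral of \<open>V\<close>. Integrating the Euler-Lagrange
  conditions against \<open>\<mu>\<close> and \<open>\<nu>\<close> gives \<open>\<langle>\<mu>, \<mu>\<rangle> + \<mu>(V) = c \<le> \<langle>\<nu>, \<mu>\<rangle> + \<nu>(V)\<close>. Adding the inequality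
  \<open>2 * \<langle>\<nu>, \<mu>\<rangle> \<le> \<langle>\<nu>, \<nu>\<rangle> + \<langle>\<mu>, \<mu>\<rangle>\<close> shows that the energy of \<open>\<mu>\<close> is at most that of \<open>\<nu>\<close>, and equality of the
  energies forces equality in the last step, hence \<open>\<nu> = \<mu>\<close>.
  
  The remaining hypotheses make these integrals meaningful. In \<open>growth\<close> the kernel is multiplied by \<open>2\<close> so that
  only half of the field is spent on bounding the kernel from below; the other half shows that \<open>V\<close> is integrable for every
  \<open>\<nu>\<close> of finite energy.
\<close>

lemma equilibrium_criterion:
  fixes V :: "'a::euclidean_space \<Rightarrow> real" and \<mu> :: "'a measure"
  assumes s: "s > -2" and V [measurable]: "V \<in> borel_measurable borel" and V0: "\<And>x. V x \<ge> 0"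
    and C0: "C \<ge> 0"
    and growth: "\<And>x y. x \<noteq> y \<or> s < 0 \<Longrightarrow> - C \<le> 2 * riesz_profile s (norm (x - y)) + V x + V y"
    and \<mu>: "\<mu> \<in> borel_prob_measures" and noatom: "\<And>x. AE y in \<mu>. x \<noteq> y" and V\<mu>: "integrable \<mu> V"
    and int: "\<And>x. integrable \<mu> (\<lambda>y. riesz_profile s (norm (x - y)))"
    and bound: "\<And>x. (\<integral>y. riesz_profile s (norm (x - y)) \<partial>\<mu>) \<le> B"
    and EL: "\<And>x. c \<le> (\<integral>y. riesz_profile s (norm (x - y)) \<partial>\<mu>) + V x"
    and EL_eq: "AE x in \<mu>. (\<integral>y. riesz_profile s (norm (x - y)) \<partial>\<mu>) + V x = c"
  shows "is_equilibrium_measure s V \<mu>"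
proof -
  interpret M: prob_space \<mu> by (rule borel_prob_measuresD(1)[OF \<mu>])
  note M_cong [measurable_cong] = borel_prob_measuresD(2)[OF \<mu>]
  define U where "U x = (\<integral>y. riesz_profile s (norm (x - y)) \<partial>\<mu>)" for x
  have U [measurable]: "U \<in> borel_measurable borel"
    unfolding U_def by measurable
  have pi: "pair_integrable s \<nu> \<mu>" and mut: "mutual_energy s \<nu> \<mu> = (\<integral>x. U x \<partial>\<nu>)" and Uint: "integrable \<nu> U"
    if \<nu>: "\<nu> \<in> borel_prob_measures" and V\<nu>: "integrable \<nu> V" for \<nu>
  proof -
    interpret N: prob_space \<nu> by (rule borel_prob_measuresD(1)[OF \<nu>])
    interpret NM: pair_prob_space \<nu> \<mu> ..
    note [measurable_cong] = borel_prob_measuresD(2)[OF \<nu>]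
    let ?f = "\<lambda>p. riesz_profile s (norm (fst p - snd p))"
    have AE: "AE p in \<nu> \<Otimes>\<^sub>M \<mu>. fst p \<noteq> snd p"
      using noatom by (intro NM.AE_pair_measure) auto
    have f_int: "integrable (\<nu> \<Otimes>\<^sub>M \<mu>) ?f"
    proof (rule NM.Fubini_integrable)
      show "?f \<in> borel_measurable (\<nu> \<Otimes>\<^sub>M \<mu>)"
        by measurable
      show "AE x in \<nu>. integrable \<mu> (\<lambda>y. ?f (x, y))"
        using int by simp
      show "integrable \<nu> (\<lambda>x. \<integral>y. norm (?f (x, y)) \<partial>\<mu>)"
      proof (rule Bochner_Integration.integrable_bound)
        show "integrable \<nu> (\<lambda>x. B + V x + (\<integral>y. V y \<partial>\<mu>) + 2 * C)"
          using V\<nu> by auto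
        show "(\<lambda>x. \<integral>y. norm (?f (x, y)) \<partial>\<mu>) \<in> borel_measurable \<nu>"
          by measurable
        show "AE x in \<nu>. norm (\<integral>y. norm (?f (x, y)) \<partial>\<mu>) \<le> norm (B + V x + (\<integral>y. V y \<partial>\<mu>) + 2 * C)"
        proof (rule AE_I2)
          fix x
          have "(\<integral>y. norm (?f (x, y)) \<partial>\<mu>) \<le> (\<integral>y. riesz_profile s (norm (x - y)) + V x + V y + 2 * C \<partial>\<mu>)"
          proof (rule integral_mono_AE)
            show "AE y in \<mu>. norm (?f (x, y)) \<le> riesz_profile s (norm (x - y)) + V x + V y + 2 * C"
              using noatom[of x]
            proof eventually_elim
              case (elim y)
              then have "- C \<le> 2 * riesz_profile s (norm (x - y)) + V x + V y"
                by (intro growth) simp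
              with V0[of x] V0[of y] C0 show ?case
                unfolding real_norm_def fst_conv snd_conv by (intro abs_leI) simp_all
            qed
          qed (use int V\<mu> in auto)
          also have "\<dots> = U x + V x + (\<integral>y. V y \<partial>\<mu>) + 2 * C"
            using int V\<mu> by (simp add: U_def M.prob_space)
          also have "\<dots> \<le> B + V x + (\<integral>y. V y \<partial>\<mu>) + 2 * C"
            using bound by (simp add: U_def)
          finally show "norm (\<integral>y. norm (?f (x, y)) \<partial>\<mu>) \<le> norm (B + V x + (\<integral>y. V y \<partial>\<mu>) + 2 * C)"
            using Bochner_Integration.integral_nonneg[of \<mu> "\<lambda>y. norm (?f (x, y))"] by simp
        qed
      qed
    qed
    show "pair_integrable s \<nu> \<mu>"
      unfolding pair_integrable_def
    proof
      show "AE p in \<nu> \<Otimes>\<^sub>M \<mu>. fst p \<noteq> snd p \<or> s < 0"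
        using AE by eventually_elim simp
    qed (rule f_int)
    show "mutual_energy s \<nu> \<mu> = (\<integral>x. U x \<partial>\<nu>)"
      unfolding mutual_energy_def U_def using NM.integral_fst'[OF f_int] by simp
    show "integrable \<nu> U"
      using NM.integrable_fst'[OF f_int] by (simp add: U_def[abs_def])
  qed
  have V_pair: "integrable (\<nu> \<Otimes>\<^sub>M \<nu>) (\<lambda>p. V (fst p))" "(\<integral>p. V (fst p) \<partial>(\<nu> \<Otimes>\<^sub>M \<nu>)) = (\<integral>x. V x \<partial>\<nu>)"
    "integrable (\<nu> \<Otimes>\<^sub>M \<nu>) (\<lambda>p. V (snd p))" "(\<integral>p. V (snd p) \<partial>(\<nu> \<Otimes>\<^sub>M \<nu>)) = (\<integral>x. V x \<partial>\<nu>)"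
    if \<nu>: "\<nu> \<in> borel_prob_measures" and V\<nu>: "integrable \<nu> V" for \<nu>
  proof -
    interpret N: prob_space \<nu> by (rule borel_prob_measuresD(1)[OF \<nu>])
    interpret NN: pair_prob_space \<nu> \<nu> ..
    note [measurable_cong] = borel_prob_measuresD(2)[OF \<nu>]
    show i1: "integrable (\<nu> \<Otimes>\<^sub>M \<nu>) (\<lambda>p. V (fst p))"
    proof (rule NN.Fubini_integrable)
      show "(\<lambda>p. V (fst p)) \<in> borel_measurable (\<nu> \<Otimes>\<^sub>M \<nu>)" by measurable
    qed (use V\<nu> in \<open>auto simp: N.prob_space\<close>)
    show "(\<integral>p. V (fst p) \<partial>(\<nu> \<Otimes>\<^sub>M \<nu>)) = (\<integral>x. V x \<partial>\<nu>)"
      using NN.integral_fst'[OF i1] by (simp add: N.prob_space)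
    show i2: "integrable (\<nu> \<Otimes>\<^sub>M \<nu>) (\<lambda>p. V (snd p))"
    proof (rule NN.Fubini_integrable)
      show "(\<lambda>p. V (snd p)) \<in> borel_measurable (\<nu> \<Otimes>\<^sub>M \<nu>)" by measurable
    qed (use V\<nu> in auto)
    show "(\<integral>p. V (snd p) \<partial>(\<nu> \<Otimes>\<^sub>M \<nu>)) = (\<integral>x. V x \<partial>\<nu>)"
      using NN.integral_fst'[OF i2] by (simp add: N.prob_space)
  qed
  have energy_eq: "energy s V \<nu> = ereal (mutual_energy s \<nu> \<nu> + 2 * (\<integral>x. V x \<partial>\<nu>))"
    if \<nu>: "\<nu> \<in> borel_prob_measures" and V\<nu>: "integrable \<nu> V" and pi: "pair_integrable s \<nu> \<nu>" for \<nu>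
  proof -
    note Vp = V_pair[OF \<nu> V\<nu>]
    let ?k = "\<lambda>p. riesz_profile s (norm (fst p - snd p))"
    have k: "integrable (\<nu> \<Otimes>\<^sub>M \<nu>) ?k" and AE: "AE p in \<nu> \<Otimes>\<^sub>M \<nu>. fst p \<noteq> snd p \<or> s < 0"
      using pi by (auto simp: pair_integrable_def)
    have "energy s V \<nu> = ereal (\<integral>p. ?k p + V (fst p) + V (snd p) \<partial>(\<nu> \<Otimes>\<^sub>M \<nu>))"
      unfolding energy_def
    proof (rule ereal_integral_eq_integral)
      show "AE p in \<nu> \<Otimes>\<^sub>M \<nu>. (case p of (x, y) \<Rightarrow> riesz_kernel s (x - y) + ereal (V x) + ereal (V y))
         = ereal (?k p + V (fst p) + V (snd p))"
        using AE
      proof eventually_elim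
        case (elim p)
        then show ?case
          by (cases p) (simp add: riesz_kernel_eq_profile)
      qed
    qed (use k Vp in auto)
    also have "\<dots> = ereal (mutual_energy s \<nu> \<nu> + 2 * (\<integral>x. V x \<partial>\<nu>))"
      using k Vp by (simp add: mutual_energy_def)
    finally show ?thesis .
  qed
  have finite: "integrable \<nu> V" "pair_integrable s \<nu> \<nu>"
    if \<nu>: "\<nu> \<in> borel_prob_measures" and fin: "energy s V \<nu> < \<infinity>" for \<nu>
  proof -
    interpret N: prob_space \<nu> by (rule borel_prob_measuresD(1)[OF \<nu>])
    interpret NN: pair_prob_space \<nu> \<nu> ..
    note [measurable_cong] = borel_prob_measuresD(2)[OF \<nu>]
    let ?k = "\<lambda>p. riesz_profile s (norm (fst p - snd p))"
    let ?F = "\<lambda>(x, y). riesz_kernel s (x - y) + ereal (V x) + ereal (V y)"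
    let ?g = "\<lambda>p. ?k p + V (fst p) + V (snd p)"
    have lower: "ereal (- C) \<le> ?F p" for p
    proof (cases "fst p \<noteq> snd p \<or> s < 0")
      case True
      have "- C \<le> riesz_profile s (norm (fst p - snd p)) + V (fst p) + V (snd p)"
        using growth[OF True] V0[of "fst p"] V0[of "snd p"] C0 by linarith
      with True show ?thesis
        by (cases p) (auto simp: riesz_kernel_eq_profile)
    next
      case False
      then show ?thesis by (cases p) (auto simp: riesz_kernel_def)
    qed
    have F_meas: "?F \<in> borel_measurable (\<nu> \<Otimes>\<^sub>M \<nu>)"
      by measurable
    note fin' = ereal_integral_finite[OF NN.prob_space_axioms F_meas lower fin[unfolded energy_def]]
    have AE: "AE p in \<nu> \<Otimes>\<^sub>M \<nu>. fst p \<noteq> snd p \<or> s < 0"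
      using fin'(1)
    proof eventually_elim
      case (elim p)
      then show ?case
        by (cases p) (auto simp: riesz_kernel_def split: if_splits)
    qed
    have g: "integrable (\<nu> \<Otimes>\<^sub>M \<nu>) ?g"
    proof (rule integrable_cong_AE_imp[OF fin'(2)])
      show "?g \<in> borel_measurable (\<nu> \<Otimes>\<^sub>M \<nu>)"
        by measurable
      show "AE p in \<nu> \<Otimes>\<^sub>M \<nu>. real_of_ereal (?F p) = ?g p"
        using AE
      proof eventually_elim
        case (elim p)
        then show ?case
          by (cases p) (simp add: riesz_kernel_eq_profile)
      qed
    qed
    have g_lower: "AE p in \<nu> \<Otimes>\<^sub>M \<nu>. V (fst p) + V (snd p) \<le> 2 * ?g p + 2 * C"
      using AE
    proof eventually_elim
      case (elim p)
      from growth[OF this] V0[of "fst p"] V0[of "snd p"] C0 show ?case by argo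
    qed
    have b: "integrable (\<nu> \<Otimes>\<^sub>M \<nu>) (\<lambda>p. 2 * ?g p + 2 * C)"
      by (intro Bochner_Integration.integrable_add integrable_mult_right g) auto
    have V1: "integrable (\<nu> \<Otimes>\<^sub>M \<nu>) (\<lambda>p. V (fst p))"
    proof (rule Bochner_Integration.integrable_bound[OF b])
      show "(\<lambda>p. V (fst p)) \<in> borel_measurable (\<nu> \<Otimes>\<^sub>M \<nu>)"
        by measurable
      show "AE p in \<nu> \<Otimes>\<^sub>M \<nu>. norm (V (fst p)) \<le> norm (2 * ?g p + 2 * C)"
        using g_lower
      proof eventually_elim
        case (elim p)
        with V0[of "fst p"] V0[of "snd p"] show ?case by (simp del: distrib_left_numeral)
      qed
    qed
    have V2: "integrable (\<nu> \<Otimes>\<^sub>M \<nu>) (\<lambda>p. V (snd p))"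
    proof (rule Bochner_Integration.integrable_bound[OF b])
      show "(\<lambda>p. V (snd p)) \<in> borel_measurable (\<nu> \<Otimes>\<^sub>M \<nu>)"
        by measurable
      show "AE p in \<nu> \<Otimes>\<^sub>M \<nu>. norm (V (snd p)) \<le> norm (2 * ?g p + 2 * C)"
        using g_lower
      proof eventually_elim
        case (elim p)
        with V0[of "fst p"] V0[of "snd p"] show ?case by (simp del: distrib_left_numeral)
      qed
    qed
    have "integrable (\<nu> \<Otimes>\<^sub>M \<nu>) (\<lambda>p. ?g p - V (fst p) - V (snd p))"
      using g V1 V2 by (intro Bochner_Integration.integrable_diff)
    then have "integrable (\<nu> \<Otimes>\<^sub>M \<nu>) ?k"
      by simp
    then show "pair_integrable s \<nu> \<nu>"
      using AE by (simp add: pair_integrable_def)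
    show "integrable \<nu> V"
      using NN.integrable_fst'[OF V1] by (simp add: N.prob_space)
  qed
  have pi\<mu>: "pair_integrable s \<mu> \<mu>"
    by (rule pi[OF \<mu> V\<mu>])
  have "(\<integral>x. U x + V x \<partial>\<mu>) = (\<integral>x. c \<partial>\<mu>)"
    by (rule integral_cong_AE) (use EL_eq in \<open>auto simp: U_def[symmetric]\<close>)
  then have UV: "mutual_energy s \<mu> \<mu> + (\<integral>x. V x \<partial>\<mu>) = c"
    using Uint[OF \<mu> V\<mu>] V\<mu> by (simp add: mut[OF \<mu> V\<mu>] M.prob_space)
  have key: "energy s V \<mu> \<le> energy s V \<nu>" "energy s V \<nu> \<le> energy s V \<mu> \<Longrightarrow> \<nu> = \<mu>"
    if \<nu>: "\<nu> \<in> borel_prob_measures" and fin: "energy s V \<nu> < \<infinity>" for \<nu>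
  proof -
    interpret N: prob_space \<nu> by (rule borel_prob_measuresD(1)[OF \<nu>])
    note [measurable_cong] = borel_prob_measuresD(2)[OF \<nu>]
    note V\<nu> = finite(1)[OF \<nu> fin] and pi\<nu> = finite(2)[OF \<nu> fin]
    have "c \<le> U x + V x" for x
      using EL by (simp add: U_def)
    then have "AE x in \<nu>. c \<le> U x + V x"
      by (intro AE_I2)
    then have "c \<le> (\<integral>x. U x + V x \<partial>\<nu>)"
      by (rule N.integral_ge_const[OF Bochner_Integration.integrable_add[OF Uint[OF \<nu> V\<nu>] V\<nu>]])
    then have c: "c \<le> mutual_energy s \<nu> \<mu> + (\<integral>x. V x \<partial>\<nu>)"
      using Uint[OF \<nu> V\<nu>] V\<nu> by (simp add: mut[OF \<nu> V\<nu>])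
    note pos = riesz_energy_positive[OF s \<mu> \<nu> pi\<mu> pi[OF \<nu> V\<nu>] pi\<nu>]
    show "energy s V \<mu> \<le> energy s V \<nu>"
      unfolding energy_eq[OF \<mu> V\<mu> pi\<mu>] energy_eq[OF \<nu> V\<nu> pi\<nu>] ereal_less_eq
      using UV c pos(1) by argo
    assume "energy s V \<nu> \<le> energy s V \<mu>"
    then have "2 * mutual_energy s \<nu> \<mu> = mutual_energy s \<nu> \<nu> + mutual_energy s \<mu> \<mu>"
      unfolding energy_eq[OF \<mu> V\<mu> pi\<mu>] energy_eq[OF \<nu> V\<nu> pi\<nu>] ereal_less_eq
      using UV c pos(1) by argo
    then show "\<nu> = \<mu>" by (rule pos(2))
  qed
  have "energy s V \<mu> \<le> energy s V \<nu>" if "\<nu> \<in> borel_prob_measures" for \<nu>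
  proof (cases "energy s V \<nu> < \<infinity>")
    case True
    then show ?thesis by (rule key(1)[OF that])
  qed simp
  then have min: "is_minimizer s V \<mu>"
    using \<mu> by (simp add: is_minimizer_def)
  have "\<nu> = \<mu>" if "is_minimizer s V \<nu>" for \<nu>
  proof -
    have \<nu>: "\<nu> \<in> borel_prob_measures" and le: "energy s V \<nu> \<le> energy s V \<mu>"
      using that \<mu> by (auto simp: is_minimizer_def)
    have "energy s V \<mu> < \<infinity>"
      by (simp add: energy_eq[OF \<mu> V\<mu> pi\<mu>])
    with le have "energy s V \<nu> < \<infinity>"
      by (rule le_less_trans)
    then show ?thesis
      by (rule key(2)[OF \<nu> _ le])
  qed
  with min show ?thesis
    unfolding is_equilibrium_measure_def by blast
qed

section \<open>Means over the unit sphere seen from an interior point\<close>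

text \<open>
  By the mean value theorem the difference quotients are bounded by \<open>B\<close>, so dominated convergence applies.
\<close>

lemma has_real_derivative_integral:
  fixes f f' :: "real \<Rightarrow> 'b \<Rightarrow> real"
  assumes M: "finite_measure M" and t0: "t0 \<in> {a<..<b}"
    and int: "\<And>t. t \<in> {a<..<b} \<Longrightarrow> integrable M (f t)"
    and meas: "f' t0 \<in> borel_measurable M"
    and deriv: "AE x in M. \<forall>t\<in>{a<..<b}. ((\<lambda>t. f t x) has_real_derivative f' t x) (at t) \<and> \<bar>f' t x\<bar> \<le> B"
  shows "((\<lambda>t. \<integral>x. f t x \<partial>M) has_real_derivative (\<integral>x. f' t0 x \<partial>M)) (at t0)"
proof -
  interpret finite_measure M by fact
  let ?q = "\<lambda>t x. (f t x - f t0 x) / (t - t0)"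
  have "((\<lambda>t. ((\<integral>x. f t x \<partial>M) - (\<integral>x. f t0 x \<partial>M)) / (t - t0)) \<longlongrightarrow> (\<integral>x. f' t0 x \<partial>M)) (at t0 within {a<..<b})"
    unfolding tendsto_at_iff_sequentially comp_def
  proof (intro allI impI)
    fix X :: "nat \<Rightarrow> real"
    assume X: "\<forall>i. X i \<in> {a<..<b} - {t0}" and lim: "X \<longlonglongrightarrow> t0"
    have "(\<lambda>i. \<integral>x. ?q (X i) x \<partial>M) \<longlonglongrightarrow> (\<integral>x. f' t0 x \<partial>M)"
    proof (rule integral_dominated_convergence[where w = "\<lambda>_. B"])
      show "f' t0 \<in> borel_measurable M" by fact
      show "(\<lambda>x. ?q (X i) x) \<in> borel_measurable M" for i
        using int[of "X i"] int[OF t0] X by auto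
      show "AE x in M. (\<lambda>i. ?q (X i) x) \<longlonglongrightarrow> f' t0 x"
        using deriv
      proof eventually_elim
        case (elim x)
        then have "((\<lambda>t. ?q t x) \<longlongrightarrow> f' t0 x) (at t0)"
          using t0 by (auto simp: has_field_derivative_iff)
        then show ?case
          using X lim unfolding tendsto_at_iff_sequentially comp_def by auto
      qed
      show "AE x in M. norm (?q (X i) x) \<le> B" for i
        using deriv
      proof eventually_elim
        case (elim x)
        have Xi: "X i \<in> {a<..<b}" "X i \<noteq> t0" using X by auto
        have "norm (f (X i) x - f t0 x) \<le> B * norm (X i - t0)"
          by (rule field_differentiable_bound[of "{a<..<b}" _ "\<lambda>t. f' t x"])
            (use elim Xi t0 in \<open>auto intro: has_field_derivative_at_within\<close>)
        then show ?case
          using Xi by (simp add: field_simps)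
      qed
    qed auto
    moreover have eq: "(\<integral>x. ?q (X i) x \<partial>M) = ((\<integral>x. f (X i) x \<partial>M) - (\<integral>x. f t0 x \<partial>M)) / (X i - t0)" for i
    proof -
      have "X i \<in> {a<..<b}" using X by blast
      from int[OF this] int[OF t0] show ?thesis by simp
    qed
    ultimately show "(\<lambda>i. ((\<integral>x. f (X i) x \<partial>M) - (\<integral>x. f t0 x \<partial>M)) / (X i - t0)) \<longlonglongrightarrow> (\<integral>x. f' t0 x \<partial>M)"
      by (simp only: eq)
  qed
  moreover have "at t0 within {a<..<b} = at t0"
    using t0 by (intro at_within_open) auto
  ultimately show ?thesis
    by (simp add: has_field_derivative_iff)
qed

text \<open>
  The squared distance between \<open>\<rho> *\<^sub>R e\<close> and a unit vector \<open>y\<close> with \<open>y \<bullet> e = x\<close>, for a unit vector \<open>e\<close>.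
\<close>

definition dist_sq :: "real \<Rightarrow> real \<Rightarrow> real" where
  "dist_sq \<rho> x = 1 + \<rho>\<^sup>2 - 2 * \<rho> * x"

lemma dist_sq_measurable [measurable]: "dist_sq \<rho> \<in> borel_measurable borel"
  unfolding dist_sq_def by measurable

lemma dist_sq_bounds:
  assumes "-1 \<le> x" "x \<le> 1" "\<bar>\<rho>\<bar> \<le> r" "r < 1"
  shows "(1 - r)\<^sup>2 \<le> dist_sq \<rho> x" "dist_sq \<rho> x \<le> 4" "dist_sq \<rho> x > 0"
proof -
  have *: "\<bar>\<rho> * x\<bar> \<le> \<bar>\<rho>\<bar>"
    using assms by (simp add: abs_mult mult_left_le)
  have "(1 - r)\<^sup>2 \<le> (1 - \<bar>\<rho>\<bar>)\<^sup>2"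
    using assms by (intro power_mono) auto
  also have "\<dots> = 1 + \<rho>\<^sup>2 - 2 * \<bar>\<rho>\<bar>"
    by (simp add: power2_eq_square algebra_simps)
  also have "\<dots> \<le> dist_sq \<rho> x"
    using abs_le_D1[OF *] by (simp add: dist_sq_def)
  finally show 1: "(1 - r)\<^sup>2 \<le> dist_sq \<rho> x" .
  show "dist_sq \<rho> x > 0"
    using 1 assms by (intro less_le_trans[OF _ 1]) auto
  have "\<rho>\<^sup>2 \<le> 1"
    using assms by (simp add: abs_square_le_1)
  then show "dist_sq \<rho> x \<le> 4"
    using abs_le_D2[OF *] assms by (simp add: dist_sq_def)
qed

text \<open>
  What the computation of potentials uses about the law \<open>L\<close> of the coordinate \<open>y \<bullet> e\<close> of a uniformly
  distributed point \<open>y\<close> of the unit sphere in dimension \<open>d\<close>. The essential property is \<open>stein\<close>, an integration by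
  parts formula; it determines the moments of \<open>L\<close> and replaces the explicit density of \<open>L\<close>.
\<close>

locale latitude_law = prob_space L for L :: "real measure" +
  fixes d :: nat
  assumes sets_L [measurable_cong]: "sets L = sets borel"
    and range: "AE x in L. -1 \<le> x \<and> x \<le> 1"
    and no_pole: "AE x in L. x \<noteq> 1"
    and dim: "d \<ge> 3"
    and stein: "\<And>g g'. g \<in> borel_measurable borel \<Longrightarrow> g' \<in> borel_measurable borel \<Longrightarrow>
      (\<And>x. x \<in> {-1..1} \<Longrightarrow> (g has_real_derivative g' x) (at x)) \<Longrightarrow> continuous_on {-1..1} g' \<Longrightarrow>
      (real d - 1) * (\<integral>x. x * g x \<partial>L) = (\<integral>x. (1 - x\<^sup>2) * g' x \<partial>L)"
begin

lemma mean_integrable: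
  fixes \<phi> :: "real \<Rightarrow> real"
  assumes \<rho>: "\<bar>\<rho>\<bar> < 1" and [measurable]: "\<phi> \<in> borel_measurable borel" and c: "continuous_on {0<..} \<phi>"
  shows "integrable L (\<lambda>x. \<phi> (dist_sq \<rho> x))"
proof -
  have "compact (\<phi> ` {(1 - \<bar>\<rho>\<bar>)\<^sup>2..4})"
    using \<rho> by (intro compact_continuous_image continuous_on_subset[OF c]) (auto intro: less_le_trans[rotated])
  then obtain B where B: "\<And>q. q \<in> {(1 - \<bar>\<rho>\<bar>)\<^sup>2..4} \<Longrightarrow> norm (\<phi> q) \<le> B"
    using compact_imp_bounded bounded_iff by (metis (no_types, lifting) imageI)
  show ?thesis
  proof (rule integrable_const_bound)
    show "AE x in L. norm (\<phi> (dist_sq \<rho> x)) \<le> B"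
      using range
    proof eventually_elim
      case (elim x)
      then show ?case using dist_sq_bounds(1,2)[of x \<rho> "\<bar>\<rho>\<bar>"] \<rho> by (intro B) auto
    qed
  qed measurable
qed

lemma mean_has_derivative:
  fixes \<phi> \<phi>' :: "real \<Rightarrow> real"
  assumes \<rho>: "\<bar>\<rho>\<bar> < 1" and [measurable]: "\<phi> \<in> borel_measurable borel" "\<phi>' \<in> borel_measurable borel"
    and deriv: "\<And>q. q > 0 \<Longrightarrow> (\<phi> has_real_derivative \<phi>' q) (at q)"
    and c: "continuous_on {0<..} \<phi>'"
  shows "((\<lambda>\<rho>. \<integral>x. \<phi> (dist_sq \<rho> x) \<partial>L) has_real_derivative (\<integral>x. (2 * \<rho> - 2 * x) * \<phi>' (dist_sq \<rho> x) \<partial>L)) (at \<rho>)"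
proof -
  define r where "r = (1 + \<bar>\<rho>\<bar>) / 2"
  have r: "\<bar>\<rho>\<bar> < r" "0 < r" "r < 1" using \<rho> by (auto simp: r_def)
  have "compact (\<phi>' ` {(1 - r)\<^sup>2..4})"
    using r by (intro compact_continuous_image continuous_on_subset[OF c]) (auto intro: less_le_trans[rotated])
  then obtain B where B: "\<And>q. q \<in> {(1 - r)\<^sup>2..4} \<Longrightarrow> norm (\<phi>' q) \<le> B"
    using compact_imp_bounded bounded_iff by (metis (no_types, lifting) imageI)
  have \<phi>: "continuous_on {0<..} \<phi>"
    using deriv by (intro DERIV_continuous_on) (auto intro: has_field_derivative_at_within)
  show ?thesis
  proof (rule has_real_derivative_integral[where a = "- r" and b = r and B = "4 * B" and f = "\<lambda>\<rho> x. \<phi> (dist_sq \<rho> x)" and f' = "\<lambda>\<rho> x. (2 * \<rho> - 2 * x) * \<phi>' (dist_sq \<rho> x)"])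
    show "finite_measure L" by unfold_locales
    show "\<rho> \<in> {- r<..<r}" using r by auto
    show "integrable L (\<lambda>x. \<phi> (dist_sq t x))" if "t \<in> {- r<..<r}" for t
      using that r \<phi> by (intro mean_integrable) auto
    show "(\<lambda>x. (2 * \<rho> - 2 * x) * \<phi>' (dist_sq \<rho> x)) \<in> borel_measurable L"
      by measurable
    show "AE x in L. \<forall>t\<in>{- r<..<r}. ((\<lambda>t. \<phi> (dist_sq t x)) has_real_derivative (2 * t - 2 * x) * \<phi>' (dist_sq t x)) (at t)
        \<and> \<bar>(2 * t - 2 * x) * \<phi>' (dist_sq t x)\<bar> \<le> 4 * B"
      using range
    proof (eventually_elim, intro ballI conjI)
      fix x t :: real assume x: "- 1 \<le> x \<and> x \<le> 1" and t: "t \<in> {- r<..<r}"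
      have b: "(1 - r)\<^sup>2 \<le> dist_sq t x" "dist_sq t x \<le> 4" "dist_sq t x > 0"
        using dist_sq_bounds[of x t r] x t r by auto
      have "((\<lambda>t. dist_sq t x) has_real_derivative (2 * t - 2 * x)) (at t)"
        unfolding dist_sq_def by (auto intro!: derivative_eq_intros)
      from DERIV_chain2[OF deriv[OF b(3)] this]
      show "((\<lambda>t. \<phi> (dist_sq t x)) has_real_derivative (2 * t - 2 * x) * \<phi>' (dist_sq t x)) (at t)"
        by (simp add: mult.commute)
      have "\<bar>2 * t - 2 * x\<bar> \<le> 4" using x t r by auto
      moreover have "\<bar>\<phi>' (dist_sq t x)\<bar> \<le> B" using B b by auto
      ultimately show "\<bar>(2 * t - 2 * x) * \<phi>' (dist_sq t x)\<bar> \<le> 4 * B"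
        unfolding abs_mult by (intro mult_mono) auto
    qed
  qed
qed

text \<open>
  The mean over the unit sphere of the power \<open>- 2 * j\<close> of the distance to a point at distance \<open>\<rho>\<close> from the
  centre.
\<close>

definition moment :: "real \<Rightarrow> real \<Rightarrow> real" where
  "moment j \<rho> = (\<integral>x. dist_sq \<rho> x powr (- j) \<partial>L)"

lemma powr_integrable: "\<bar>\<rho>\<bar> < 1 \<Longrightarrow> integrable L (\<lambda>x. dist_sq \<rho> x powr j)"
  by (intro mean_integrable[of \<rho> "\<lambda>q. q powr j"]) (auto intro!: continuous_intros)

lemma moment_0 [simp]: "\<bar>\<rho>\<bar> < 1 \<Longrightarrow> moment 0 \<rho> = 1"
proof -
  assume \<rho>: "\<bar>\<rho>\<bar> < 1"
  have "moment 0 \<rho> = (\<integral>x. 1 \<partial>L)"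
    unfolding moment_def
  proof (rule integral_cong_AE)
    show "AE x in L. dist_sq \<rho> x powr - 0 = 1"
      using range
    proof eventually_elim
      case (elim x)
      then show ?case using dist_sq_bounds(3)[of x \<rho> "\<bar>\<rho>\<bar>"] \<rho> by auto
    qed
  qed measurable
  then show ?thesis by (simp add: prob_space)
qed

lemma moment_at_0 [simp]: "moment j 0 = 1"
  by (simp add: moment_def dist_sq_def prob_space)

text \<open>
  The derivative of \<^const>\<open>dist_sq\<close> in \<open>\<rho>\<close> is itself affine in \<^const>\<open>dist_sq\<close>, because
  \<open>\<rho> * (2 * \<rho> - 2 * x) = \<rho>\<^sup>2 - 1 + dist_sq \<rho> x\<close>. So the derivative of a moment is a combination of moments.
\<close>

lemma mean_deriv_expand:
  assumes \<rho>: "0 < \<rho>" "\<rho> < 1"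
  shows "(\<integral>x. (2 * \<rho> - 2 * x) * (c * dist_sq \<rho> x powr (- j - 1)) \<partial>L)
    = c / \<rho> * ((\<rho>\<^sup>2 - 1) * moment (j + 1) \<rho> + moment j \<rho>)"
proof -
  have "(\<integral>x. (2 * \<rho> - 2 * x) * (c * dist_sq \<rho> x powr (- j - 1)) \<partial>L)
     = (\<integral>x. c / \<rho> * ((\<rho>\<^sup>2 - 1) * dist_sq \<rho> x powr (- (j + 1)) + dist_sq \<rho> x powr (- j)) \<partial>L)"
  proof (rule integral_cong_AE)
    show "AE x in L. (2 * \<rho> - 2 * x) * (c * dist_sq \<rho> x powr (- j - 1))
       = c / \<rho> * ((\<rho>\<^sup>2 - 1) * dist_sq \<rho> x powr (- (j + 1)) + dist_sq \<rho> x powr (- j))"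
      using range
    proof eventually_elim
      case (elim x)
      then have pos: "dist_sq \<rho> x > 0" using dist_sq_bounds(3)[of x \<rho> \<rho>] \<rho> by auto
      have "dist_sq \<rho> x powr (- j) = dist_sq \<rho> x * dist_sq \<rho> x powr (- j - 1)"
        using pos powr_mult_base[of "dist_sq \<rho> x" "- j - 1"] by simp
      moreover have "\<rho> * (2 * \<rho> - 2 * x) = (\<rho>\<^sup>2 - 1) + dist_sq \<rho> x"
        by (simp add: dist_sq_def power2_eq_square algebra_simps)
      then have "2 * \<rho> - 2 * x = ((\<rho>\<^sup>2 - 1) + dist_sq \<rho> x) / \<rho>"
        using \<rho> by (simp add: field_simps)
      moreover have "- (j + 1) = - j - 1" by simp
      ultimately show ?case by (simp only: distrib_right times_divide_eq_left) (simp add: algebra_simps)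
    qed
  qed measurable
  also have "\<dots> = c / \<rho> * ((\<rho>\<^sup>2 - 1) * moment (j + 1) \<rho> + moment j \<rho>)"
    unfolding moment_def using powr_integrable[of \<rho>] \<rho> by simp
  finally show ?thesis .
qed

lemma moment_has_derivative:
  assumes "0 < \<rho>" "\<rho> < 1"
  shows "(moment j has_real_derivative - (j / \<rho>) * ((\<rho>\<^sup>2 - 1) * moment (j + 1) \<rho> + moment j \<rho>)) (at \<rho>)"
proof -
  have "((\<lambda>\<rho>. \<integral>x. dist_sq \<rho> x powr (- j) \<partial>L) has_real_derivative
     (\<integral>x. (2 * \<rho> - 2 * x) * (- j * dist_sq \<rho> x powr (- j - 1)) \<partial>L)) (at \<rho>)"
    by (rule mean_has_derivative[where \<phi> = "\<lambda>q. q powr (- j)" and \<phi>' = "\<lambda>q. - j * q powr (- j - 1)"])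
      (use assms in \<open>auto intro!: derivative_eq_intros continuous_intros\<close>)
  then show ?thesis
    unfolding mean_deriv_expand[OF assms] by (simp add: moment_def[abs_def])
qed

lemma moment_continuous: "continuous_on {-1<..<1} (moment j)"
proof (rule continuous_at_imp_continuous_on, rule ballI)
  fix \<rho> :: real assume "\<rho> \<in> {-1<..<1}"
  then have "\<bar>\<rho>\<bar> < 1" by auto
  then have "((\<lambda>\<rho>. \<integral>x. dist_sq \<rho> x powr (- j) \<partial>L) has_real_derivative
     (\<integral>x. (2 * \<rho> - 2 * x) * (- j * dist_sq \<rho> x powr (- j - 1)) \<partial>L)) (at \<rho>)"
    by (rule mean_has_derivative[where \<phi> = "\<lambda>q. q powr (- j)" and \<phi>' = "\<lambda>q. - j * q powr (- j - 1)"])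
      (auto intro!: derivative_eq_intros continuous_intros)
  then show "isCont (moment j) \<rho>"
    unfolding moment_def[abs_def] by (rule DERIV_isCont)
qed

text \<open>
  Apply \<open>stein\<close> to \<open>g x = dist_sq \<rho> x powr (- k)\<close>. With \<open>D = dist_sq \<rho> x\<close> the factors on both sides are
  polynomials in \<open>D\<close>, namely \<open>2 * \<rho> * x = 1 + \<rho>\<^sup>2 - D\<close> and
  \<open>4 * \<rho>\<^sup>2 * (1 - x\<^sup>2) = - (1 - \<rho>\<^sup>2)\<^sup>2 + 2 * (1 + \<rho>\<^sup>2) * D - D\<^sup>2\<close>.
\<close>

lemma moment_recursion:
  assumes \<rho>: "0 < \<rho>" "\<rho> < 1"
  shows "(real d - 1) * ((1 + \<rho>\<^sup>2) * moment k \<rho> - moment (k - 1) \<rho>)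
    = k * (- ((1 - \<rho>\<^sup>2)\<^sup>2 * moment (k + 1) \<rho>) + 2 * (1 + \<rho>\<^sup>2) * moment k \<rho> - moment (k - 1) \<rho>)"
proof -
  note int = powr_integrable[of \<rho>]
  have pos: "dist_sq \<rho> x > 0" if "x \<in> {-1..1}" for x
    using dist_sq_bounds(3)[of x \<rho> \<rho>] \<rho> that by auto
  have "(real d - 1) * (\<integral>x. x * dist_sq \<rho> x powr (- k) \<partial>L)
      = (\<integral>x. (1 - x\<^sup>2) * (2 * k * \<rho> * dist_sq \<rho> x powr (- k - 1)) \<partial>L)"
  proof (rule stein)
    show "(\<lambda>x. dist_sq \<rho> x powr (- k)) \<in> borel_measurable borel" by measurable
    show "(\<lambda>x. 2 * k * \<rho> * dist_sq \<rho> x powr (- k - 1)) \<in> borel_measurable borel" by measurable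
    show "((\<lambda>x. dist_sq \<rho> x powr (- k)) has_real_derivative 2 * k * \<rho> * dist_sq \<rho> x powr (- k - 1)) (at x)"
      if "x \<in> {-1..1}" for x
    proof -
      have "((\<lambda>x. dist_sq \<rho> x) has_real_derivative (- 2 * \<rho>)) (at x)"
        unfolding dist_sq_def by (auto intro!: derivative_eq_intros)
      then show ?thesis
        using pos[OF that] by (auto intro!: derivative_eq_intros)
    qed
    show "continuous_on {-1..1} (\<lambda>x. 2 * k * \<rho> * dist_sq \<rho> x powr (- k - 1))"
      unfolding dist_sq_def using pos by (force intro!: continuous_intros simp: dist_sq_def)
  qed
  moreover have "(\<integral>x. x * dist_sq \<rho> x powr (- k) \<partial>L)
    = (\<integral>x. 1 / (2 * \<rho>) * ((1 + \<rho>\<^sup>2) * dist_sq \<rho> x powr (- k) - dist_sq \<rho> x powr (- (k - 1))) \<partial>L)"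
  proof (rule integral_cong_AE)
    show "AE x in L. x * dist_sq \<rho> x powr (- k) = 1 / (2 * \<rho>) * ((1 + \<rho>\<^sup>2) * dist_sq \<rho> x powr (- k) - dist_sq \<rho> x powr (- (k - 1)))"
      using range
    proof eventually_elim
      case (elim x)
      define D P where "D = dist_sq \<rho> x" and "P = D powr (- k)"
      have "D powr (- (k - 1)) = D * P"
        using pos[of x] elim powr_mult_base[of D "- k"] by (simp add: D_def P_def)
      moreover have "2 * \<rho> * (x * P) = (1 + \<rho>\<^sup>2) * P - D * P"
        by (simp add: D_def dist_sq_def algebra_simps)
      ultimately show ?case
        unfolding D_def[symmetric] P_def[symmetric] using \<rho> by (simp add: field_simps)
    qed
  qed measurable
  moreover have "(\<integral>x. (1 - x\<^sup>2) * (2 * k * \<rho> * dist_sq \<rho> x powr (- k - 1)) \<partial>L)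
    = (\<integral>x. k / (2 * \<rho>) * (- ((1 - \<rho>\<^sup>2)\<^sup>2 * dist_sq \<rho> x powr (- (k + 1))) + 2 * (1 + \<rho>\<^sup>2) * dist_sq \<rho> x powr (- k)
         - dist_sq \<rho> x powr (- (k - 1))) \<partial>L)"
  proof (rule integral_cong_AE)
    show "AE x in L. (1 - x\<^sup>2) * (2 * k * \<rho> * dist_sq \<rho> x powr (- k - 1))
      = k / (2 * \<rho>) * (- ((1 - \<rho>\<^sup>2)\<^sup>2 * dist_sq \<rho> x powr (- (k + 1))) + 2 * (1 + \<rho>\<^sup>2) * dist_sq \<rho> x powr (- k)
         - dist_sq \<rho> x powr (- (k - 1)))"
      using range
    proof eventually_elim
      case (elim x)
      define D P where "D = dist_sq \<rho> x" and "P = D powr (- k - 1)"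
      have D: "D > 0" using pos[of x] elim by (simp add: D_def)
      have 1: "D powr (- k) = D * P"
        using D powr_mult_base[of D "- k - 1"] by (simp add: P_def)
      have 2: "D powr (- (k - 1)) = D * (D * P)"
        using D powr_mult_base[of D "- k"] 1 by simp
      have 3: "D powr (- (k + 1)) = P" by (simp add: P_def)
      have "4 * \<rho>\<^sup>2 * (1 - x\<^sup>2) = - ((1 - \<rho>\<^sup>2)\<^sup>2) + 2 * (1 + \<rho>\<^sup>2) * D - D * D"
        by (simp add: D_def dist_sq_def power2_eq_square algebra_simps)
      from this[symmetric] have "(1 - x\<^sup>2) * (2 * k * \<rho> * P) = k / (2 * \<rho>) * (- ((1 - \<rho>\<^sup>2)\<^sup>2) + 2 * (1 + \<rho>\<^sup>2) * D - D * D) * P"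
        using \<rho> by (simp add: power2_eq_square)
      then show ?case
        unfolding D_def[symmetric] P_def[symmetric] 1 2 3 by (simp add: algebra_simps)
    qed
  qed measurable
  ultimately have "(real d - 1) * (1 / (2 * \<rho>) * ((1 + \<rho>\<^sup>2) * moment k \<rho> - moment (k - 1) \<rho>))
    = k / (2 * \<rho>) * (- ((1 - \<rho>\<^sup>2)\<^sup>2 * moment (k + 1) \<rho>) + 2 * (1 + \<rho>\<^sup>2) * moment k \<rho> - moment (k - 1) \<rho>)"
    unfolding moment_def using int \<rho> by simp
  then show ?thesis using \<rho> by (simp add: field_simps)
qed

text \<open>
  The mean value property of the harmonic function \<open>norm y powr (2 - d)\<close>, and the fact that the Poisson kernel has
  mean one. Let \<open>\<phi>\<close> and \<open>\<psi>\<close> be the two quantities as functions of \<open>\<rho>\<close>. The derivative formula and the recursion for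
  \<open>k = p + 1\<close> give \<open>\<phi>' = - (p / \<rho>) * (\<phi> - \<psi>)\<close> and \<open>\<psi>' = (p / \<rho>) * (\<phi> - \<psi>)\<close>. So \<open>\<phi> + \<psi>\<close> and
  \<open>\<rho> ^ (d - 2) * (\<phi> - \<psi>)\<close> are constant, with the values \<open>2\<close> and \<open>0\<close> that they have at \<open>\<rho> = 0\<close>.
\<close>

lemma mean_value_and_poisson:
  assumes \<rho>: "0 < \<rho>" "\<rho> < 1"
  defines "p \<equiv> (real d - 2) / 2"
  shows "moment p \<rho> = 1" and "(1 - \<rho>\<^sup>2) * moment (p + 1) \<rho> = 1"
proof -
  define \<psi> where "\<psi> r = (1 - r\<^sup>2) * moment (p + 1) r" for r
  have m_deriv: "(moment p has_real_derivative - (p / r) * (moment p r - \<psi> r)) (at r)" if r: "0 < r" "r < 1" for r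
  proof -
    have "- (p / r) * ((r\<^sup>2 - 1) * moment (p + 1) r + moment p r) = - (p / r) * (moment p r - \<psi> r)"
      by (simp add: \<psi>_def algebra_simps)
    with moment_has_derivative[OF r, of p] show ?thesis by (simp only:)
  qed
  have \<psi>_deriv: "(\<psi> has_real_derivative p / r * (moment p r - \<psi> r)) (at r)" if r: "0 < r" "r < 1" for r
  proof -
    let ?k = "p + 1"
    let ?m = "moment ?k r" and ?m' = "moment (?k + 1) r"
    have "((\<lambda>r. 1 - r\<^sup>2) has_real_derivative - 2 * r) (at r)"
      by (auto intro!: derivative_eq_intros)
    from DERIV_mult[OF this moment_has_derivative[OF r, of ?k]]
    have "(\<psi> has_real_derivative - 2 * r * ?m + (- (?k / r) * ((r\<^sup>2 - 1) * ?m' + ?m)) * (1 - r\<^sup>2)) (at r)"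
      by (simp only: \<psi>_def[abs_def])
    moreover have "- 2 * r * ?m + (- (?k / r) * ((r\<^sup>2 - 1) * ?m' + ?m)) * (1 - r\<^sup>2) = p / r * (moment p r - \<psi> r)"
    proof -
      have rec: "(real d - 1) * ((1 + r\<^sup>2) * ?m - moment p r)
        = ?k * (- ((1 - r\<^sup>2)\<^sup>2 * ?m') + 2 * (1 + r\<^sup>2) * ?m - moment p r)"
        using moment_recursion[OF r, of ?k] by (simp add: add.commute)
      have dp: "real d - 1 = 2 * p + 1" by (simp add: p_def field_simps)
      have "?k * ((1 - r\<^sup>2)\<^sup>2 * ?m') = (1 + r\<^sup>2) * ?m + p * moment p r"
        using rec unfolding dp by (simp add: algebra_simps)
      then have "r * (- 2 * r * ?m + (- (?k / r) * ((r\<^sup>2 - 1) * ?m' + ?m)) * (1 - r\<^sup>2))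
         = - 2 * r\<^sup>2 * ?m + ((1 + r\<^sup>2) * ?m + p * moment p r) - ?k * (1 - r\<^sup>2) * ?m"
        using r by (simp add: field_simps power2_eq_square)
      also have "\<dots> = p * (moment p r - \<psi> r)"
        by (simp add: \<psi>_def algebra_simps)
      finally show ?thesis
        unfolding times_divide_eq_left using r by (intro eq_divide_imp) (simp_all only: mult.commute)
    qed
    ultimately show ?thesis by simp
  qed
  have cont: "continuous_on {0..\<rho>} (moment j)" for j
    using \<rho> by (intro continuous_on_subset[OF moment_continuous]) auto
  then have cont\<psi>: "continuous_on {0..\<rho>} \<psi>"
    unfolding \<psi>_def by (intro continuous_intros)
  have sum: "moment p \<rho> + \<psi> \<rho> = moment p 0 + \<psi> 0"
  proof (rule DERIV_isconst2[of 0 \<rho>, symmetric, THEN sym])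
    show "continuous_on {0..\<rho>} (\<lambda>r. moment p r + \<psi> r)"
      by (intro continuous_intros cont cont\<psi>)
    show "((\<lambda>r. moment p r + \<psi> r) has_real_derivative 0) (at r)" if "0 < r" "r < \<rho>" for r
      using DERIV_add[OF m_deriv[of r] \<psi>_deriv[of r]] that \<rho> by simp
  qed (use \<rho> in auto)
  have d: "d - 2 \<noteq> 0" using dim by simp
  have diff: "\<rho> ^ (d - 2) * (moment p \<rho> - \<psi> \<rho>) = 0 ^ (d - 2) * (moment p 0 - \<psi> 0)"
  proof (rule DERIV_isconst2[of 0 \<rho>, symmetric, THEN sym])
    show "continuous_on {0..\<rho>} (\<lambda>r. r ^ (d - 2) * (moment p r - \<psi> r))"
      by (intro continuous_intros cont cont\<psi>)
    show "((\<lambda>r. r ^ (d - 2) * (moment p r - \<psi> r)) has_real_derivative 0) (at r)" if "0 < r" "r < \<rho>" for r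
    proof -
      have r: "0 < r" "r < 1" using that \<rho> by auto
      let ?\<delta> = "moment p r - \<psi> r"
      have "((\<lambda>r. r ^ (d - 2) * (moment p r - \<psi> r)) has_real_derivative
        r ^ (d - 2) * (- (p / r) * ?\<delta> - p / r * ?\<delta>) + (real (d - 2) * r ^ (d - 2 - 1)) * ?\<delta>) (at r)"
        by (auto intro!: derivative_eq_intros m_deriv \<psi>_deriv r)
      moreover have "r ^ (d - 2) * (- (p / r) * ?\<delta> - p / r * ?\<delta>) + (real (d - 2) * r ^ (d - 2 - 1)) * ?\<delta> = 0"
      proof -
        have "r ^ (d - 2) = r * r ^ (d - 2 - 1)"
          using d by (cases "d - 2") auto
        moreover have "real (d - 2) = 2 * p"
          using dim by (simp add: p_def)
        ultimately show ?thesis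
          using r by (simp add: field_simps)
      qed
      ultimately show ?thesis by simp
    qed
  qed (use \<rho> in auto)
  have "moment p \<rho> - \<psi> \<rho> = 0"
    using diff \<rho> by (simp add: zero_power[OF d[THEN neq0_conv[THEN iffD1]]])
  moreover have "moment p \<rho> + \<psi> \<rho> = 2"
    using sum by (simp add: \<psi>_def)
  ultimately have "moment p \<rho> = 1" "\<psi> \<rho> = 1"
    by simp_all
  then show "moment p \<rho> = 1" "(1 - \<rho>\<^sup>2) * moment (p + 1) \<rho> = 1"
    by (simp_all only: \<psi>_def)
qed

definition profile_mean :: "real \<Rightarrow> real \<Rightarrow> real" where
  "profile_mean s \<rho> = (\<integral>x. riesz_profile s (sqrt (dist_sq \<rho> x)) \<partial>L)"

lemma profile_mean_0: "profile_mean s 0 = riesz_profile s 1"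
  by (simp add: profile_mean_def dist_sq_def prob_space)

lemma profile_mean_deriv:
  assumes "\<bar>\<rho>\<bar> < 1"
  shows "(profile_mean s has_real_derivative (\<integral>x. (2 * \<rho> - 2 * x) * (- (riesz_slope s / 2) * dist_sq \<rho> x powr (- (s / 2) - 1)) \<partial>L)) (at \<rho>)"
  unfolding profile_mean_def[abs_def]
  by (rule mean_has_derivative[where \<phi> = "\<lambda>q. riesz_profile s (sqrt q)" and \<phi>' = "\<lambda>q. - (riesz_slope s / 2) * q powr (- (s / 2) - 1)", OF assms])
    (use riesz_profile_sqrt_deriv[of _ s] in \<open>auto intro!: continuous_intros\<close>)

lemma profile_mean_has_derivative:
  assumes "0 < \<rho>" "\<rho> < 1"
  shows "(profile_mean s has_real_derivative
     - (riesz_slope s / (2 * \<rho>)) * ((\<rho>\<^sup>2 - 1) * moment (s / 2 + 1) \<rho> + moment (s / 2) \<rho>)) (at \<rho>)"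
  using profile_mean_deriv[of \<rho> s] assms unfolding mean_deriv_expand[OF assms] by simp

lemma profile_mean_continuous: "continuous_on {-1<..<1} (profile_mean s)"
proof (rule continuous_at_imp_continuous_on, rule ballI)
  fix \<rho> :: real assume "\<rho> \<in> {-1<..<1}"
  then show "isCont (profile_mean s) \<rho>"
    by (intro DERIV_isCont[OF profile_mean_deriv]) auto
qed

lemma profile_mean_integrable:
  assumes "\<bar>\<rho>\<bar> < 1"
  shows "integrable L (\<lambda>x. riesz_profile s (sqrt (dist_sq \<rho> x)))"
proof (rule mean_integrable[OF assms, where \<phi> = "\<lambda>q. riesz_profile s (sqrt q)"])
  show "continuous_on {0<..} (\<lambda>q. riesz_profile s (sqrt q))"
    using riesz_profile_sqrt_deriv[of _ s] by (intro DERIV_continuous_on) (auto intro: has_field_derivative_at_within)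
qed measurable

text \<open>
  For \<open>s = d - 4\<close> the derivative involves the moments \<open>p\<close> and \<open>p - 1\<close> with \<open>p = (d - 2) / 2\<close>. The first is \<open>1\<close>;
  the recursion for \<open>k = p\<close> expresses the second by the two means that are already known and shows that it is affine
  in \<open>\<rho>\<^sup>2\<close>.
\<close>

lemma profile_mean_biharmonic:
  assumes \<rho>: "0 \<le> \<rho>" "\<rho> < 1" and s: "s = real d - 4"
  shows "profile_mean s \<rho> = riesz_profile s 1 - riesz_slope s / real d * \<rho>\<^sup>2"
proof (cases "\<rho> = 0")
  case False
  then have \<rho>0: "\<rho> > 0" using \<rho> by simp
  have "profile_mean s \<rho> + riesz_slope s / real d * \<rho>\<^sup>2 = profile_mean s 0 + riesz_slope s / real d * 0\<^sup>2"
  proof (rule DERIV_isconst2[of 0 \<rho>, symmetric, THEN sym])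
    show "continuous_on {0..\<rho>} (\<lambda>r. profile_mean s r + riesz_slope s / real d * r\<^sup>2)"
      using \<rho> by (intro continuous_intros continuous_on_subset[OF profile_mean_continuous]) auto
    show "((\<lambda>r. profile_mean s r + riesz_slope s / real d * r\<^sup>2) has_real_derivative 0) (at r)" if "0 < r" "r < \<rho>" for r
    proof -
      have r: "0 < r" "r < 1" using that \<rho> by auto
      define p where "p = (real d - 2) / 2"
      have sp: "s / 2 + 1 = p" "s / 2 = p - 1" using s by (auto simp: p_def field_simps)
      have m: "moment p r = 1" "(1 - r\<^sup>2) * moment (p + 1) r = 1"
        using mean_value_and_poisson[OF r] by (simp_all add: p_def)
      have dp: "real d - 1 = 2 * p + 1" by (simp add: p_def field_simps)
      have "(2 * p + 1) * ((1 + r\<^sup>2) - moment (p - 1) r)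
        = p * (- ((1 - r\<^sup>2) * ((1 - r\<^sup>2) * moment (p + 1) r)) + 2 * (1 + r\<^sup>2) - moment (p - 1) r)"
        using moment_recursion[OF r, of p] unfolding m(1) dp by (simp add: power2_eq_square mult.assoc)
      then have "(p + 1) * moment (p - 1) r = (1 + r\<^sup>2) + p * (1 - r\<^sup>2)"
        unfolding m by (simp add: algebra_simps)
      then have mp: "moment (p - 1) r = 1 - r\<^sup>2 * (real d - 4) / real d"
        using dim by (simp add: p_def field_simps)
      have "- (riesz_slope s / (2 * r)) * ((r\<^sup>2 - 1) * moment (s / 2 + 1) r + moment (s / 2) r) + riesz_slope s / real d * (2 * r) = 0"
        unfolding sp(1) unfolding sp(2) m mp using r dim by (simp add: field_simps power2_eq_square)
      moreover have "((\<lambda>r. profile_mean s r + riesz_slope s / real d * r\<^sup>2) has_real_derivative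
          - (riesz_slope s / (2 * r)) * ((r\<^sup>2 - 1) * moment (s / 2 + 1) r + moment (s / 2) r) + riesz_slope s / real d * (2 * r)) (at r)"
        using dim by (auto intro!: derivative_eq_intros profile_mean_has_derivative r)
      ultimately show ?thesis by simp
    qed
  qed (use \<rho>0 in auto)
  then show ?thesis by (simp add: profile_mean_0)
qed (simp add: profile_mean_0)

text \<open>
  The function \<open>1 / (norm y)\<^sup>2\<close> is superharmonic in dimension at least \<open>4\<close>, so its spherical mean is at most its
  value at the centre. Here the recursion for \<open>k = 1\<close>, in which \<open>moment 0 = 1\<close>, turns the derivative formula into an
  inhomogeneous linear differential equation for \<open>moment 1 - 1\<close> whose inhomogeneity is not positive.
\<close>

lemma inverse_square_mean_le:
  assumes \<rho>: "0 < \<rho>" "\<rho> < 1" and d: "d \<ge> 4"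
  shows "moment 1 \<rho> \<le> 1"
proof -
  \<comment> \<open>The product with the integrating factor of the linear differential equation for \<open>moment 1 - 1\<close>.\<close>
  define F where "F r = r ^ (d - 2) * (moment 1 r - 1) * inverse (1 - r\<^sup>2) ^ (d - 3)" for r
  have r2: "r\<^sup>2 < 1" if "0 \<le> r" "r < 1" for r :: real
    using that by (simp add: power_less_one_iff)
  have "F \<rho> \<le> F 0"
  proof (rule DERIV_nonpos_imp_decreasing_open[where f = F])
    show "continuous_on {0..\<rho>} F"
      unfolding F_def using \<rho> r2
      by (intro continuous_intros continuous_on_subset[OF moment_continuous]) force+
    fix r assume "0 < r" "r < \<rho>"
    then have r: "0 < r" "r < 1" using \<rho> by auto
    define e where "e = moment 1 r - 1"
    define D where "D = - (1 / r) * ((r\<^sup>2 - 1) * moment 2 r + moment 1 r)"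
    define I where "I = inverse (1 - r\<^sup>2)"
    have I: "(1 - r\<^sup>2) * I = 1" "I > 0" using r2[of r] r by (auto simp: I_def)
    have m': "(moment 1 has_real_derivative D) (at r)"
      using moment_has_derivative[OF r, of 1] by (simp add: D_def)
    have I': "((\<lambda>r. inverse (1 - r\<^sup>2)) has_real_derivative 2 * r * I\<^sup>2) (at r)"
      using r2[of r] r by (auto intro!: derivative_eq_intros simp: I_def power2_eq_square)
    have "(F has_real_derivative
       (real (d - 2) * r ^ (d - 2 - 1)) * e * I ^ (d - 3)
        + r ^ (d - 2) * D * I ^ (d - 3) + r ^ (d - 2) * e * (real (d - 3) * I ^ (d - 3 - 1) * (2 * r * I\<^sup>2))) (at r)"
      unfolding F_def
      by (rule derivative_eq_intros m' I' refl | simp add: I_def e_def)+ (simp add: algebra_simps)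
    moreover have "(real (d - 2) * r ^ (d - 2 - 1)) * e * I ^ (d - 3)
        + r ^ (d - 2) * D * I ^ (d - 3) + r ^ (d - 2) * e * (real (d - 3) * I ^ (d - 3 - 1) * (2 * r * I\<^sup>2)) \<le> 0"
    proof -
      obtain n where n: "d = n + 4" using d by (metis add.commute le_Suc_ex)
      have "(1 - r\<^sup>2)\<^sup>2 * moment 2 r = (real n + 2) - (real n + 1) * (1 + r\<^sup>2) * moment 1 r"
        using moment_recursion[OF r, of 1] r by (simp add: n algebra_simps)
      moreover have "r * (1 - r\<^sup>2) * D = (1 - r\<^sup>2)\<^sup>2 * moment 2 r - (1 - r\<^sup>2) * moment 1 r"
        using r by (simp add: D_def field_simps power2_eq_square)
      ultimately have rD: "r * (1 - r\<^sup>2) * D = - (real n + 2) * e - real n * r\<^sup>2 * (e + 1)"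
        by (simp add: e_def algebra_simps)
      have "(real (d - 2) * r ^ (d - 2 - 1)) * e * I ^ (d - 3)
        + r ^ (d - 2) * D * I ^ (d - 3) + r ^ (d - 2) * e * (real (d - 3) * I ^ (d - 3 - 1) * (2 * r * I\<^sup>2))
        = r ^ (n + 1) * I ^ n * I * ((real n + 2) * e + r * D + 2 * r\<^sup>2 * (real n + 1) * e * I)"
        by (simp add: n algebra_simps power2_eq_square)
      also have "(real n + 2) * e + r * D + 2 * r\<^sup>2 * (real n + 1) * e * I
        = I * ((1 - r\<^sup>2) * (real n + 2) * e + r * (1 - r\<^sup>2) * D + 2 * r\<^sup>2 * (real n + 1) * e)"
      proof -
        have "I * ((1 - r\<^sup>2) * (real n + 2) * e + r * (1 - r\<^sup>2) * D + 2 * r\<^sup>2 * (real n + 1) * e)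
          = ((1 - r\<^sup>2) * I) * ((real n + 2) * e + r * D) + 2 * r\<^sup>2 * (real n + 1) * e * I"
          by (simp add: algebra_simps)
        then show ?thesis unfolding I(1) by simp
      qed
      also have "(1 - r\<^sup>2) * (real n + 2) * e + r * (1 - r\<^sup>2) * D + 2 * r\<^sup>2 * (real n + 1) * e = - real n * r\<^sup>2"
        unfolding rD by (simp add: algebra_simps)
      also have "r ^ (n + 1) * I ^ n * I * (I * (- real n * r\<^sup>2)) \<le> 0"
        using r I(2) by (simp add: mult_nonneg_nonpos)
      finally show ?thesis .
    qed
    ultimately show "\<exists>y. (F has_real_derivative y) (at r) \<and> y \<le> 0" by blast
  qed (use \<rho> in simp)
  moreover have "F 0 = 0" using d by (simp add: F_def)
  moreover define w where "w = \<rho> ^ (d - 2) * inverse (1 - \<rho>\<^sup>2) ^ (d - 3)"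
  ultimately have "w * (moment 1 \<rho> - 1) \<le> 0"
    by (simp add: F_def w_def algebra_simps)
  moreover have "w > 0"
    using \<rho> r2[of \<rho>] by (simp add: w_def)
  ultimately show ?thesis
    by (simp add: mult_le_0_iff)
qed

end

section \<open>Means seen from the sphere itself, and the logarithmic kernel\<close>

lemma riesz_profile_scale:
  assumes "M > 0" "r > 0"
  shows "riesz_profile s (M * r) = (if s = 0 then riesz_profile s r - ln M else M powr (- s) * riesz_profile s r)"
proof (cases "s = 0")
  case True
  then show ?thesis using ln_mult[of M r] assms by (simp add: riesz_profile_def)
next
  case False
  then show ?thesis using powr_mult[of M r "- s"] assms by (simp add: riesz_profile_def)
qed

context latitude_law
begin

text \<open>
  At \<open>\<rho> = 1\<close> the kernel is singular on the sphere. Integrability follows from the uniform bound by Fatou's lemma.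
  For the limit, \<open>dist_sq \<rho> x \<ge> \<rho> * dist_sq 1 x\<close> bounds the kernels for \<open>\<rho> > 1 / 2\<close> by a rescaled kernel
  for \<open>\<rho> = 1\<close>, which is then an integrable majorant.
\<close>

lemma profile_mean_at_1:
  assumes B: "\<And>\<rho>. 0 \<le> \<rho> \<Longrightarrow> \<rho> < 1 \<Longrightarrow> profile_mean s \<rho> \<le> B"
  shows "integrable L (\<lambda>x. riesz_profile s (sqrt (dist_sq 1 x)))"
    and "(profile_mean s \<longlongrightarrow> profile_mean s 1) (at_left 1)"
proof -
  let ?k = "\<lambda>\<rho> x. riesz_profile s (sqrt (dist_sq \<rho> x))"
  let ?l = "riesz_profile s 2"
  have D: "0 < dist_sq \<rho> x" "dist_sq \<rho> x \<le> 4" "sqrt (dist_sq \<rho> x) \<le> 2" "?l \<le> ?k \<rho> x"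
    if "- 1 \<le> x" "x \<le> 1" "x \<noteq> 1" "0 \<le> \<rho>" "\<rho> \<le> 1" for \<rho> x
  proof -
    show pos: "0 < dist_sq \<rho> x"
    proof -
      have "dist_sq \<rho> x = (1 - \<rho>)\<^sup>2 + 2 * \<rho> * (1 - x)"
        by (simp add: dist_sq_def power2_eq_square algebra_simps)
      moreover have "0 < (1 - \<rho>)\<^sup>2 \<or> 0 < 2 * \<rho> * (1 - x)"
        using that by (cases "\<rho> = 1") auto
      moreover have "0 \<le> (1 - \<rho>)\<^sup>2" "0 \<le> 2 * \<rho> * (1 - x)"
        using that by auto
      ultimately show ?thesis by linarith
    qed
    have "dist_sq \<rho> x \<le> (1 + \<rho>)\<^sup>2"
      using that mult_left_mono[of "- x" 1 "2 * \<rho>"] by (simp add: dist_sq_def power2_eq_square algebra_simps)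
    also have "\<dots> \<le> 2\<^sup>2" using that by (intro power_mono) auto
    finally show le: "dist_sq \<rho> x \<le> 4" by simp
    then show "sqrt (dist_sq \<rho> x) \<le> 2"
      using real_sqrt_le_mono[of "dist_sq \<rho> x" 4] by simp
    then show "?l \<le> ?k \<rho> x" using pos by (intro riesz_profile_antimono) auto
  qed
  have good: "AE x in L. - 1 \<le> x \<and> x \<le> 1 \<and> x \<noteq> 1"
    using range no_pole by eventually_elim simp
  have cont: "(\<lambda>n. ?k (S n) x) \<longlonglongrightarrow> ?k 1 x" if "- 1 \<le> x" "x \<le> 1" "x \<noteq> 1" "S \<longlonglongrightarrow> 1" for S :: "nat \<Rightarrow> real" and x
  proof -
    have "(\<lambda>n. dist_sq (S n) x) \<longlonglongrightarrow> dist_sq 1 x"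
      unfolding dist_sq_def by (intro tendsto_intros that)
    moreover have "isCont (\<lambda>q. riesz_profile s (sqrt q)) (dist_sq 1 x)"
      using D(1)[of x 1] that by (intro DERIV_isCont[OF riesz_profile_sqrt_deriv]) auto
    ultimately show ?thesis
      by (rule isCont_tendsto_compose[rotated])
  qed
  define S where "S n = 1 - inverse (real (Suc n))" for n
  have S: "0 \<le> S n" "S n < 1" for n
    by (auto simp: S_def inverse_le_1_iff)
  have S_lim: "S \<longlonglongrightarrow> 1"
    using LIMSEQ_inverse_real_of_nat_add_minus[of 1] by (simp add: S_def[abs_def])
  have "(\<integral>\<^sup>+x. ennreal (?k 1 x - ?l) \<partial>L) = (\<integral>\<^sup>+x. liminf (\<lambda>n. ennreal (?k (S n) x - ?l)) \<partial>L)"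
  proof (rule nn_integral_cong_AE, use good in eventually_elim)
    case (elim x)
    then have "(\<lambda>n. ennreal (?k (S n) x - ?l)) \<longlonglongrightarrow> ennreal (?k 1 x - ?l)"
      by (intro tendsto_intros cont S_lim) auto
    then show ?case
      by (intro lim_imp_Liminf[symmetric]) auto
  qed
  also have "\<dots> \<le> liminf (\<lambda>n. \<integral>\<^sup>+x. ennreal (?k (S n) x - ?l) \<partial>L)"
    by (rule nn_integral_liminf) measurable
  also have "\<dots> \<le> liminf (\<lambda>n. ennreal (B - ?l))"
  proof (rule Liminf_mono, rule always_eventually, rule allI)
    fix n
    have i: "integrable L (?k (S n))"
      using S[of n] by (intro profile_mean_integrable) auto
    have "(\<integral>\<^sup>+x. ennreal (?k (S n) x - ?l) \<partial>L) = ennreal (\<integral>x. ?k (S n) x - ?l \<partial>L)"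
    proof (rule nn_integral_eq_integral)
      show "AE x in L. 0 \<le> ?k (S n) x - ?l"
        using good by eventually_elim (use D(4)[of _ "S n"] S[of n] in auto)
    qed (use i in auto)
    also have "(\<integral>x. ?k (S n) x - ?l \<partial>L) = profile_mean s (S n) - ?l"
      using i by (simp add: profile_mean_def prob_space)
    also have "ennreal \<dots> \<le> ennreal (B - ?l)"
      using B[OF S] by (intro ennreal_leI) simp
    finally show "(\<integral>\<^sup>+x. ennreal (?k (S n) x - ?l) \<partial>L) \<le> ennreal (B - ?l)" .
  qed
  also have "\<dots> = ennreal (B - ?l)"
    by (simp add: Liminf_const)
  finally have "(\<integral>\<^sup>+x. ennreal (?k 1 x - ?l) \<partial>L) < \<infinity>"
    by (simp add: le_less_trans[OF _ ennreal_less_top])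
  moreover have "AE x in L. 0 \<le> ?k 1 x - ?l"
    using good by eventually_elim (use D(4)[of _ 1] in auto)
  ultimately have "integrable L (\<lambda>x. ?k 1 x - ?l)"
    by (intro integrableI_nonneg) auto
  then have "integrable L (\<lambda>x. (?k 1 x - ?l) + ?l)"
    by (intro Bochner_Integration.integrable_add) auto
  then show int1: "integrable L (?k 1)"
    by simp
  \<comment> \<open>The kernel at half the distance, \<open>riesz_profile s (1 / 2 * sqrt (dist_sq 1 x))\<close>.\<close>
  define w where "w x = (if s = 0 then ?k 1 x - ln (1 / 2) else (1 / 2) powr (- s) * ?k 1 x)" for x
  have w: "integrable L w"
    unfolding w_def using int1 by (cases "s = 0") simp_all
  show "(profile_mean s \<longlongrightarrow> profile_mean s 1) (at_left 1)"
  proof (rule tendsto_at_left_sequentially[of "1 / 2"])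
    fix S :: "nat \<Rightarrow> real"
    assume S: "\<And>n. S n < 1" "\<And>n. 1 / 2 < S n" "S \<longlonglongrightarrow> 1"
    show "(\<lambda>n. profile_mean s (S n)) \<longlonglongrightarrow> profile_mean s 1"
      unfolding profile_mean_def
    proof (rule integral_dominated_convergence[where w = "\<lambda>x. \<bar>w x\<bar> + \<bar>?l\<bar>"])
      show "integrable L (\<lambda>x. \<bar>w x\<bar> + \<bar>?l\<bar>)" using w by auto
      show "AE x in L. (\<lambda>n. ?k (S n) x) \<longlonglongrightarrow> ?k 1 x"
        using good by eventually_elim (use cont S(3) in auto)
      show "AE x in L. norm (?k (S n) x) \<le> \<bar>w x\<bar> + \<bar>?l\<bar>" for n
        using good
      proof eventually_elim
        case (elim x)
        have Sn: "1 / 2 < S n" "S n < 1" using S by auto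
        \<comment> \<open>\<open>dist_sq \<rho> x - \<rho> * dist_sq 1 x = (1 - \<rho>)\<^sup>2\<close>\<close>
        have "(1 / 2)\<^sup>2 * dist_sq 1 x \<le> S n * dist_sq 1 x"
          using D(1)[of x 1] elim Sn by (intro mult_right_mono) (auto simp: power2_eq_square)
        also have "\<dots> \<le> S n * dist_sq 1 x + (1 - S n)\<^sup>2" by simp
        also have "\<dots> = dist_sq (S n) x"
          by (simp add: dist_sq_def power2_eq_square algebra_simps)
        finally have "sqrt ((1 / 2)\<^sup>2 * dist_sq 1 x) \<le> sqrt (dist_sq (S n) x)"
          by (rule real_sqrt_le_mono)
        then have "1 / 2 * sqrt (dist_sq 1 x) \<le> sqrt (dist_sq (S n) x)"
          by (simp add: real_sqrt_mult real_sqrt_divide)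
        then have "?k (S n) x \<le> riesz_profile s (1 / 2 * sqrt (dist_sq 1 x))"
          using D(1)[of x 1] elim by (intro riesz_profile_antimono) auto
        also have "\<dots> = w x"
          using D(1)[of x 1] elim by (subst riesz_profile_scale) (auto simp: w_def)
        finally have "?k (S n) x \<le> w x" .
        moreover have "?l \<le> ?k (S n) x"
          using D(4)[of x "S n"] elim Sn by auto
        ultimately show ?case by (auto simp: abs_if)
      qed
    qed measurable
  qed simp
qed

lemma profile_mean_continuous_closed:
  assumes "\<And>\<rho>. 0 \<le> \<rho> \<Longrightarrow> \<rho> < 1 \<Longrightarrow> profile_mean s \<rho> \<le> B"
  shows "continuous_on {0..1} (profile_mean s)"
  unfolding continuous_on_eq_continuous_within
proof
  fix \<rho> :: real assume \<rho>: "\<rho> \<in> {0..1}"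
  show "continuous (at \<rho> within {0..1}) (profile_mean s)"
  proof (cases "\<rho> = 1")
    case True
    have "at (1::real) within {0..1} = at_left 1"
      by (rule at_within_Icc_at_left) simp
    then show ?thesis
      using profile_mean_at_1(2)[OF assms] True by (simp add: continuous_within)
  next
    case False
    then have "\<bar>\<rho>\<bar> < 1" using \<rho> by auto
    from DERIV_isCont[OF profile_mean_deriv[OF this]] show ?thesis
      by (rule continuous_at_imp_continuous_within)
  qed
qed

lemma profile_mean_biharmonic_closed:
  assumes \<rho>: "0 \<le> \<rho>" "\<rho> \<le> 1" and s: "s = real d - 4"
  shows "profile_mean s \<rho> = riesz_profile s 1 - riesz_slope s / real d * \<rho>\<^sup>2"
    and "integrable L (\<lambda>x. riesz_profile s (sqrt (dist_sq \<rho> x)))"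
proof -
  have B: "profile_mean s \<rho> \<le> riesz_profile s 1" if "0 \<le> \<rho>" "\<rho> < 1" for \<rho>
    unfolding profile_mean_biharmonic[OF that s] using riesz_slope_pos[of s] dim by simp
  show "integrable L (\<lambda>x. riesz_profile s (sqrt (dist_sq \<rho> x)))"
  proof (cases "\<rho> = 1")
    case True
    have "integrable L (\<lambda>x. riesz_profile s (sqrt (dist_sq 1 x)))"
      by (rule profile_mean_at_1(1)[OF B])
    with True show ?thesis by simp
  next
    case False
    with \<rho> show ?thesis by (intro profile_mean_integrable) auto
  qed
  show "profile_mean s \<rho> = riesz_profile s 1 - riesz_slope s / real d * \<rho>\<^sup>2"
  proof (cases "\<rho> = 1")
    case True
    have "((\<lambda>r. riesz_profile s 1 - riesz_slope s / real d * r\<^sup>2) \<longlongrightarrow> riesz_profile s 1 - riesz_slope s / real d * 1\<^sup>2) (at_left 1)"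
      by (intro tendsto_intros)
    moreover have "\<forall>\<^sub>F r in at_left 1. riesz_profile s 1 - riesz_slope s / real d * r\<^sup>2 = profile_mean s r"
    proof -
      have "\<forall>\<^sub>F r in at_left (1::real). r \<in> {0<..<1}"
        by (rule eventually_at_left_real) simp
      then show ?thesis
        by eventually_elim (simp add: profile_mean_biharmonic[OF _ _ s])
    qed
    ultimately have "(profile_mean s \<longlongrightarrow> riesz_profile s 1 - riesz_slope s / real d * 1\<^sup>2) (at_left 1)"
      by (rule Lim_transform_eventually)
    from tendsto_unique[OF trivial_limit_at_left_real profile_mean_at_1(2)[OF B] this] True
    show ?thesis by simp
  qed (use profile_mean_biharmonic[OF _ _ s] \<rho> in auto)
qed

lemma log_mean_has_derivative:
  assumes "0 < \<rho>" "\<rho> < 1"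
  shows "(profile_mean 0 has_real_derivative - (1 - (1 - \<rho>\<^sup>2) * moment 1 \<rho>) / (2 * \<rho>)) (at \<rho>)"
proof -
  have "- (riesz_slope 0 / (2 * \<rho>)) * ((\<rho>\<^sup>2 - 1) * moment (0 / 2 + 1) \<rho> + moment (0 / 2) \<rho>)
    = - (1 - (1 - \<rho>\<^sup>2) * moment 1 \<rho>) / (2 * \<rho>)"
    using assms by (simp add: riesz_slope_def field_simps)
  with profile_mean_has_derivative[OF assms, of 0] show ?thesis by simp
qed

lemma poisson_factor_bounds:
  assumes \<rho>: "0 < \<rho>" "\<rho> < 1" and d: "d \<ge> 4"
  shows "(1 - \<rho>\<^sup>2) * moment 1 \<rho> \<le> 1 - \<rho>\<^sup>2"
proof -
  have "\<rho>\<^sup>2 \<le> 1" using \<rho> by (simp add: power_le_one)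
  then show ?thesis
    using inverse_square_mean_le[OF \<rho> d] by (intro mult_left_le) auto
qed

lemma log_mean_le:
  assumes \<rho>: "0 \<le> \<rho>" "\<rho> < 1" and d: "d \<ge> 4"
  shows "profile_mean 0 \<rho> \<le> 0"
proof -
  have "profile_mean 0 \<rho> \<le> profile_mean 0 0"
  proof (rule DERIV_nonpos_imp_decreasing_open[where f = "profile_mean 0"])
    fix r assume "0 < r" "r < \<rho>"
    then have r: "0 < r" "r < 1" using \<rho> by auto
    have "- (1 - (1 - r\<^sup>2) * moment 1 r) / (2 * r) \<le> 0"
      using poisson_factor_bounds[OF r d] r zero_le_power2[of r] by (intro divide_nonpos_pos) linarith+
    then show "\<exists>y. (profile_mean 0 has_real_derivative y) (at r) \<and> y \<le> 0"
      using log_mean_has_derivative[OF r] by blast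
  qed (use \<rho> in \<open>auto intro: continuous_on_subset[OF profile_mean_continuous]\<close>)
  then show ?thesis by (simp add: profile_mean_0 riesz_profile_def)
qed

lemma log_mean_continuous:
  assumes d: "d \<ge> 4"
  shows "continuous_on {0..1} (profile_mean 0)"
proof (rule profile_mean_continuous_closed)
  show "profile_mean 0 \<rho> \<le> 0" if "0 \<le> \<rho>" "\<rho> < 1" for \<rho>
    by (rule log_mean_le[OF that d])
qed

lemma log_mean_integrable:
  assumes \<rho>: "0 \<le> \<rho>" "\<rho> \<le> 1" and d: "d \<ge> 4"
  shows "integrable L (\<lambda>x. riesz_profile 0 (sqrt (dist_sq \<rho> x)))"
proof (cases "\<rho> = 1")
  case True
  have "integrable L (\<lambda>x. riesz_profile 0 (sqrt (dist_sq 1 x)))"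
  proof (rule profile_mean_at_1(1))
    show "profile_mean 0 \<rho> \<le> 0" if "0 \<le> \<rho>" "\<rho> < 1" for \<rho>
      by (rule log_mean_le[OF that d])
  qed
  with True show ?thesis by simp
next
  case False
  with \<rho> show ?thesis by (intro profile_mean_integrable) auto
qed

text \<open>
  The derivative of \<open>profile_mean 0 r + r\<^sup>2 / 4\<close> is \<open>(1 - r\<^sup>2) * (moment 1 r - 1) / (2 * r)\<close>, which is not positive by
  \<open>inverse_square_mean_le\<close>. In dimension \<open>4\<close> it is zero.
\<close>

lemma log_mean_inside:
  assumes \<rho>: "0 \<le> \<rho>" "\<rho> \<le> 1" and d: "d \<ge> 4"
  shows "profile_mean 0 1 + 1 / 4 \<le> profile_mean 0 \<rho> + \<rho>\<^sup>2 / 4"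
proof -
  let ?F = "\<lambda>r. profile_mean 0 r + r\<^sup>2 / 4"
  have "?F 1 \<le> ?F \<rho>"
  proof (rule DERIV_nonpos_imp_decreasing_open[where f = ?F and a = \<rho> and b = 1])
    fix r assume "\<rho> < r" "r < 1"
    then have r: "0 < r" "r < 1" using \<rho> by auto
    have "(?F has_real_derivative - (1 - (1 - r\<^sup>2) * moment 1 r) / (2 * r) + r / 2) (at r)"
      by (auto intro!: derivative_eq_intros log_mean_has_derivative r)
    moreover have "- (1 - (1 - r\<^sup>2) * moment 1 r) / (2 * r) + r / 2 = ((1 - r\<^sup>2) * moment 1 r - (1 - r\<^sup>2)) / (2 * r)"
      using r by (simp add: field_simps power2_eq_square)
    moreover have "\<dots> \<le> 0"
      using poisson_factor_bounds[OF r d] r by (intro divide_nonpos_pos) auto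
    ultimately show "\<exists>y. (?F has_real_derivative y) (at r) \<and> y \<le> 0"
      by (intro exI conjI) (assumption, linarith)
  next
    show "continuous_on {\<rho>..1} ?F"
    proof (rule continuous_on_add)
      show "continuous_on {\<rho>..1} (profile_mean 0)"
        by (rule continuous_on_subset[OF log_mean_continuous[OF d]]) (use \<rho> in auto)
      show "continuous_on {\<rho>..1} (\<lambda>r. r\<^sup>2 / 4)"
        by (intro continuous_intros) auto
    qed
  qed (use \<rho> in auto)
  then show ?thesis by simp
qed

text \<open>
  Here \<open>\<rho>\<close> is the radius of the sphere divided by the distance of the outer point from the centre. The derivative
  of the right-hand side is that of \<open>log_mean_inside\<close> minus the nonnegative term \<open>(r\<^sup>2 - 1)\<^sup>2 / (2 * r ^ 3)\<close>.
\<close>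

lemma log_mean_outside:
  assumes \<rho>: "0 < \<rho>" "\<rho> \<le> 1" and d: "d \<ge> 4"
  shows "profile_mean 0 1 + 1 / 4 \<le> profile_mean 0 \<rho> + ln \<rho> + inverse \<rho> ^ 2 / 4"
proof -
  let ?F = "\<lambda>r. profile_mean 0 r + ln r + inverse r ^ 2 / 4"
  have "?F 1 \<le> ?F \<rho>"
  proof (rule DERIV_nonpos_imp_decreasing_open[where f = ?F and a = \<rho> and b = 1])
    fix r assume "\<rho> < r" "r < 1"
    then have r: "0 < r" "r < 1" using \<rho> by auto
    have "((\<lambda>r. inverse r ^ 2 / 4) has_real_derivative - (inverse r ^ 3 / 2)) (at r)"
    proof -
      have "((\<lambda>r. inverse r ^ 2 / 4) has_real_derivative (real 2 * (- (inverse r * 1 * inverse r) * inverse r ^ (2 - Suc 0))) / 4) (at r)"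
        by (intro DERIV_cdivide DERIV_power DERIV_inverse' DERIV_ident) (use r in simp)
      moreover have "(real 2 * (- (inverse r * 1 * inverse r) * inverse r ^ (2 - Suc 0))) / 4 = - (inverse r ^ 3 / 2)"
        by (simp add: power3_eq_cube)
      ultimately show ?thesis by (simp only:)
    qed
    from DERIV_add[OF DERIV_add[OF log_mean_has_derivative[OF r] DERIV_ln_divide[OF r(1)]] this]
    have "(?F has_real_derivative - (1 - (1 - r\<^sup>2) * moment 1 r) / (2 * r) + 1 / r + - (inverse r ^ 3 / 2)) (at r)" .
    moreover have "- (1 - (1 - r\<^sup>2) * moment 1 r) / (2 * r) + 1 / r + - (inverse r ^ 3 / 2)
      = ((1 - r\<^sup>2) * moment 1 r - (1 - r\<^sup>2)) / (2 * r) - (r\<^sup>2 - 1)\<^sup>2 / (2 * r ^ 3)"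
      using r by (simp add: field_simps power2_eq_square power3_eq_cube)
    moreover have "((1 - r\<^sup>2) * moment 1 r - (1 - r\<^sup>2)) / (2 * r) \<le> 0"
      using poisson_factor_bounds[OF r d] r by (intro divide_nonpos_pos) auto
    moreover have "0 \<le> (r\<^sup>2 - 1)\<^sup>2 / (2 * r ^ 3)"
      using r by simp
    ultimately show "\<exists>y. (?F has_real_derivative y) (at r) \<and> y \<le> 0"
      by (intro exI conjI) (assumption, linarith)
  next
    show "continuous_on {\<rho>..1} ?F"
    proof (intro continuous_on_add)
      show "continuous_on {\<rho>..1} (profile_mean 0)"
        by (rule continuous_on_subset[OF log_mean_continuous[OF d]]) (use \<rho> in auto)
      show "continuous_on {\<rho>..1} ln"
        by (rule continuous_on_ln[OF continuous_on_id]) (use \<rho> in auto)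
      show "continuous_on {\<rho>..1} (\<lambda>r. inverse r ^ 2 / 4)"
        by (intro continuous_intros) (use \<rho> in auto)
    qed
  qed (use \<rho> in auto)
  then show ?thesis by simp
qed

end

section \<open>The potential of a uniformly charged sphere\<close>

lemma sphere_uniform_measurable_cong [measurable_cong]: "sets (sphere_uniform R) = sets borel"
  by simp

lemma orthogonal_transformation_measurable:
  fixes T :: "'a::euclidean_space \<Rightarrow> 'a"
  assumes "orthogonal_transformation T"
  shows "T \<in> borel_measurable borel"
  by (intro borel_measurable_continuous_onI linear_continuous_on)
    (simp add: linear_linear orthogonal_transformation_linear[OF assms])

lemma integral_sphere_orthogonal:
  fixes T :: "'a::euclidean_space \<Rightarrow> 'a" and h :: "'a \<Rightarrow> real"
  assumes T: "orthogonal_transformation T" and h: "h \<in> borel_measurable borel"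
  shows "(\<integral>y. h (T y) \<partial>sphere_uniform R) = (\<integral>y. h y \<partial>sphere_uniform R)"
proof -
  note [measurable] = orthogonal_transformation_measurable[OF T] h
  have "(\<integral>y. h y \<partial>distr (sphere_uniform R) borel T) = (\<integral>y. h (T y) \<partial>sphere_uniform R)"
    by (intro integral_distr) auto
  then show ?thesis by (simp add: sphere_uniform_orthogonal[OF T])
qed

lemma sphere_uniform_borel_prob: "sphere_uniform R \<in> borel_prob_measures"
  by (simp add: borel_prob_measures_def prob_space_sphere_uniform)

text \<open>
  The points that are projected to \<open>x\<close> lie on a line through the origin, which is a null set in dimension at least
  \<open>2\<close>.
\<close>

lemma sphere_uniform_no_atom:
  fixes x :: "'a::euclidean_space"
  assumes "DIM('a) \<ge> 2" "R > 0"
  shows "AE y in sphere_uniform R. x \<noteq> y"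
  unfolding sphere_uniform_def
proof (subst AE_distr_iff)
  have "dim (span {x}) \<le> card {x}"
    by (intro dim_le_card) auto
  then have "negligible (span {x})"
    using assms by (intro negligible_lowdim) auto
  then have "span {x} \<in> null_sets lborel"
    by (simp add: negligible_iff_null_sets null_sets_completion_iff closed_span borel_closed)
  then have "AE z in lborel. z \<notin> span {x}"
    by (rule AE_not_in)
  moreover have "x \<noteq> (R / norm z) *\<^sub>R z" if "z \<notin> span {x}" for z
  proof
    assume x: "x = (R / norm z) *\<^sub>R z"
    have "z \<noteq> 0" using that span_zero by auto
    with x assms have "z = (norm z / R) *\<^sub>R x" by simp
    with that show False by (metis span_base span_scale insertI1)
  qed
  ultimately show "AE z in uniform_measure lborel (ball (0::'a) 1). x \<noteq> (R / norm z) *\<^sub>R z"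
    by (intro AE_uniform_measureI) (auto elim!: AE_mp)
qed auto

text \<open>
  For orthonormal \<open>e\<close> and \<open>v\<close>, the rotation by the angle \<open>\<theta>\<close> in the plane that they span, and the identity on its
  orthogonal complement.
\<close>

definition plane_rotation :: "'a::euclidean_space \<Rightarrow> 'a \<Rightarrow> real \<Rightarrow> 'a \<Rightarrow> 'a" where
  "plane_rotation e v \<theta> y =
     y + ((cos \<theta> - 1) * (y \<bullet> e) - sin \<theta> * (y \<bullet> v)) *\<^sub>R e + (sin \<theta> * (y \<bullet> e) + (cos \<theta> - 1) * (y \<bullet> v)) *\<^sub>R v"

lemma plane_rotation:
  assumes e: "norm e = 1" and v: "norm v = 1" and ev: "e \<bullet> v = 0"
  shows "orthogonal_transformation (plane_rotation e v \<theta>)"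
    and "plane_rotation e v \<theta> y \<bullet> e = cos \<theta> * (y \<bullet> e) - sin \<theta> * (y \<bullet> v)"
    and "plane_rotation e v \<theta> y \<bullet> v = sin \<theta> * (y \<bullet> e) + cos \<theta> * (y \<bullet> v)"
proof -
  have ee: "e \<bullet> e = 1" "v \<bullet> v = 1" "v \<bullet> e = 0"
    using e v ev by (simp_all add: norm_eq_1 inner_commute)
  show "plane_rotation e v \<theta> y \<bullet> e = cos \<theta> * (y \<bullet> e) - sin \<theta> * (y \<bullet> v)"
    "plane_rotation e v \<theta> y \<bullet> v = sin \<theta> * (y \<bullet> e) + cos \<theta> * (y \<bullet> v)"
    by (simp_all add: plane_rotation_def inner_add_left ee ev algebra_simps)
  have lin: "linear (plane_rotation e v \<theta>)"
    by (rule linearI) (simp_all add: plane_rotation_def inner_add_left algebra_simps)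
  have "norm (plane_rotation e v \<theta> y) = norm y" for y
  proof -
    define a b where "a = y \<bullet> e" and "b = y \<bullet> v"
    define p q where "p = (cos \<theta> - 1) * a - sin \<theta> * b" and "q = sin \<theta> * a + (cos \<theta> - 1) * b"
    have "(norm (plane_rotation e v \<theta> y))\<^sup>2 = (norm y)\<^sup>2 + 2 * p * a + 2 * q * b + p\<^sup>2 + q\<^sup>2"
      unfolding plane_rotation_def power2_norm_eq_inner p_def[symmetric] q_def[symmetric] a_def[symmetric] b_def[symmetric]
      by (simp add: inner_add_left inner_add_right ee ev power2_eq_square a_def b_def inner_commute algebra_simps)
    also have "2 * p * a + 2 * q * b + p\<^sup>2 + q\<^sup>2 = ((cos \<theta>)\<^sup>2 + (sin \<theta>)\<^sup>2 - 1) * (a\<^sup>2 + b\<^sup>2)"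
    proof -
      have "2 * ((c - 1) * a - s * b) * a + 2 * (s * a + (c - 1) * b) * b + ((c - 1) * a - s * b)\<^sup>2 + (s * a + (c - 1) * b)\<^sup>2
        = (c\<^sup>2 + s\<^sup>2 - 1) * (a\<^sup>2 + b\<^sup>2)" for c s :: real
        by (simp add: power2_eq_square algebra_simps)
      then show ?thesis unfolding p_def q_def by blast
    qed
    then have "(norm y)\<^sup>2 + 2 * p * a + 2 * q * b + p\<^sup>2 + q\<^sup>2 = (norm y)\<^sup>2"
      by simp
    finally show ?thesis by simp
  qed
  with lin show "orthogonal_transformation (plane_rotation e v \<theta>)"
    by (simp add: orthogonal_transformation)
qed

text \<open>
  By rotation invariance the mean of \<open>(y \<bullet> v) * g (y \<bullet> e)\<close> does not change when \<open>y\<close> is rotated by \<open>\<theta>\<close> in the plane of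
  \<open>e\<close> and \<open>v\<close>. The claim is that its derivative at \<open>\<theta> = 0\<close> vanishes.
\<close>

lemma sphere_infinitesimal_rotation:
  fixes e v :: "'a::euclidean_space" and g g' :: "real \<Rightarrow> real"
  assumes e: "norm e = 1" and v: "norm v = 1" and ev: "e \<bullet> v = 0"
    and [measurable]: "g \<in> borel_measurable borel" "g' \<in> borel_measurable borel"
    and deriv: "\<And>x. x \<in> {-1..1} \<Longrightarrow> (g has_real_derivative g' x) (at x)"
    and cont: "continuous_on {-1..1} g'"
  shows "(\<integral>y. (y \<bullet> e) * g (y \<bullet> e) - (y \<bullet> v)\<^sup>2 * g' (y \<bullet> e) \<partial>sphere_uniform 1) = 0"
proof -
  interpret S: prob_space "sphere_uniform 1 :: 'a measure" by (rule prob_space_sphere_uniform)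
  define G where "G \<theta> y = (sin \<theta> * (y \<bullet> e) + cos \<theta> * (y \<bullet> v)) * g (cos \<theta> * (y \<bullet> e) - sin \<theta> * (y \<bullet> v))" for \<theta> y
  define G' where "G' \<theta> y = (cos \<theta> * (y \<bullet> e) - sin \<theta> * (y \<bullet> v)) * g (cos \<theta> * (y \<bullet> e) - sin \<theta> * (y \<bullet> v))
      - (sin \<theta> * (y \<bullet> e) + cos \<theta> * (y \<bullet> v))\<^sup>2 * g' (cos \<theta> * (y \<bullet> e) - sin \<theta> * (y \<bullet> v))" for \<theta> y
  have [measurable]: "G \<theta> \<in> borel_measurable borel" "G' \<theta> \<in> borel_measurable borel" for \<theta>
    unfolding G_def G'_def by measurable
  have bdd: "\<exists>B. \<forall>x\<in>{-1..1::real}. \<bar>f x\<bar> \<le> B" if "continuous_on {-1..1} f" for f :: "real \<Rightarrow> real"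
  proof -
    have "bounded (f ` {-1..1})"
      using compact_imp_bounded[OF compact_continuous_image[OF that]] by simp
    then show ?thesis by (auto simp: bounded_iff)
  qed
  have "continuous_on {-1..1} g"
    using deriv by (intro DERIV_continuous_on) (auto intro: has_field_derivative_at_within)
  then obtain A where A: "\<And>x. x \<in> {-1..1} \<Longrightarrow> \<bar>g x\<bar> \<le> A" using bdd by blast
  obtain B where B: "\<And>x. x \<in> {-1..1} \<Longrightarrow> \<bar>g' x\<bar> \<le> B" using bdd[OF cont] by blast
  have coord: "\<bar>cos \<theta> * (y \<bullet> e) - sin \<theta> * (y \<bullet> v)\<bar> \<le> 1" "\<bar>sin \<theta> * (y \<bullet> e) + cos \<theta> * (y \<bullet> v)\<bar> \<le> 1"
    if "norm y = 1" for \<theta> y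
  proof -
    have n: "norm (plane_rotation e v \<theta> y) = 1"
      using orthogonal_transformation_norm[OF plane_rotation(1)[OF e v ev]] that by simp
    show "\<bar>cos \<theta> * (y \<bullet> e) - sin \<theta> * (y \<bullet> v)\<bar> \<le> 1"
      using Cauchy_Schwarz_ineq2[of "plane_rotation e v \<theta> y" e] n e
      by (simp add: plane_rotation(2)[OF e v ev])
    show "\<bar>sin \<theta> * (y \<bullet> e) + cos \<theta> * (y \<bullet> v)\<bar> \<le> 1"
      using Cauchy_Schwarz_ineq2[of "plane_rotation e v \<theta> y" v] n v
      by (simp add: plane_rotation(3)[OF e v ev])
  qed
  have sphere: "AE y in sphere_uniform 1. norm (y :: 'a) = 1"
    by (rule AE_sphere_uniform) simp
  have G_int: "integrable (sphere_uniform 1) (G \<theta>)" for \<theta>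
  proof (rule S.integrable_const_bound[where B = "1 * A"])
    show "AE y in sphere_uniform 1. norm (G \<theta> y) \<le> 1 * A"
      using sphere
    proof eventually_elim
      case (elim y)
      show ?case
        unfolding G_def real_norm_def abs_mult
        using coord[OF elim, of \<theta>] abs_le_D1[OF coord(1)[OF elim, of \<theta>]] abs_le_D2[OF coord(1)[OF elim, of \<theta>]]
        by (intro mult_mono A) auto
    qed
  qed measurable
  have "((\<lambda>\<theta>. \<integral>y. G \<theta> y \<partial>sphere_uniform 1) has_real_derivative (\<integral>y. G' 0 y \<partial>sphere_uniform 1)) (at 0)"
  proof (rule has_real_derivative_integral[where a = "-1" and b = 1 and B = "A + B"])
    show "finite_measure (sphere_uniform 1 :: 'a measure)" by unfold_locales
    show "G' 0 \<in> borel_measurable (sphere_uniform 1)" by measurable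
    show "AE y in sphere_uniform 1. \<forall>\<theta>\<in>{-1<..<1}. ((\<lambda>\<theta>. G \<theta> y) has_real_derivative G' \<theta> y) (at \<theta>) \<and> \<bar>G' \<theta> y\<bar> \<le> A + B"
      using sphere
    proof (eventually_elim, intro ballI conjI)
      fix y :: 'a and \<theta> :: real assume y: "norm y = 1"
      let ?a = "cos \<theta> * (y \<bullet> e) - sin \<theta> * (y \<bullet> v)" and ?b = "sin \<theta> * (y \<bullet> e) + cos \<theta> * (y \<bullet> v)"
      have a: "?a \<in> {-1..1}" using coord(1)[OF y, of \<theta>] by (simp add: abs_le_iff)
      have da: "((\<lambda>\<theta>. cos \<theta> * (y \<bullet> e) - sin \<theta> * (y \<bullet> v)) has_real_derivative - ?b) (at \<theta>)"
        by (auto intro!: derivative_eq_intros)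
      have db: "((\<lambda>\<theta>. sin \<theta> * (y \<bullet> e) + cos \<theta> * (y \<bullet> v)) has_real_derivative ?a) (at \<theta>)"
        by (auto intro!: derivative_eq_intros)
      have "?a * g ?a + g' ?a * - ?b * ?b = G' \<theta> y"
        by (simp add: G'_def power2_eq_square algebra_simps)
      with DERIV_mult[OF db DERIV_chain2[OF deriv[OF a] da]]
      show "((\<lambda>\<theta>. G \<theta> y) has_real_derivative G' \<theta> y) (at \<theta>)"
        by (simp only: G_def)
      have "\<bar>G' \<theta> y\<bar> \<le> \<bar>?a * g ?a\<bar> + \<bar>?b\<^sup>2 * g' ?a\<bar>"
        unfolding G'_def by (rule abs_triangle_ineq4)
      also have "\<bar>?a * g ?a\<bar> \<le> 1 * A"
        unfolding abs_mult using coord(1)[OF y, of \<theta>] by (intro mult_mono A[OF a]) auto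
      also have "\<bar>?b\<^sup>2 * g' ?a\<bar> \<le> 1 * B"
        unfolding abs_mult using coord(2)[OF y, of \<theta>] by (intro mult_mono B[OF a]) (auto simp: abs_square_le_1)
      finally show "\<bar>G' \<theta> y\<bar> \<le> A + B" by simp
    qed
  qed (use G_int in auto)
  moreover have "(\<integral>y. G \<theta> y \<partial>sphere_uniform 1) = (\<integral>y. (y \<bullet> v) * g (y \<bullet> e) \<partial>sphere_uniform 1)" for \<theta>
    using integral_sphere_orthogonal[OF plane_rotation(1)[OF e v ev], of "\<lambda>y. (y \<bullet> v) * g (y \<bullet> e)" 1 \<theta>]
    by (simp add: plane_rotation(2,3)[OF e v ev] G_def)
  ultimately have "((\<lambda>\<theta>. \<integral>y. (y \<bullet> v) * g (y \<bullet> e) \<partial>sphere_uniform 1) has_real_derivative (\<integral>y. G' 0 y \<partial>sphere_uniform 1)) (at 0)"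
    by simp
  then have "(\<integral>y. G' 0 y \<partial>sphere_uniform 1) = 0"
    by (rule DERIV_unique) simp
  then show ?thesis by (simp add: G'_def)
qed

text \<open>
  An arbitrary basis vector; by rotation invariance its choice does not affect the law of the latitude.
\<close>

definition pole :: "'a::euclidean_space" where "pole = (SOME b. b \<in> Basis)"

lemma pole_Basis: "pole \<in> Basis"
  unfolding pole_def by (rule SOME_Basis)

lemma norm_pole [simp]: "norm (pole :: 'a::euclidean_space) = 1"
  using pole_Basis by (rule norm_Basis)

definition latitude :: "'a::euclidean_space itself \<Rightarrow> real measure" where
  "latitude _ = distr (sphere_uniform 1 :: 'a measure) borel (\<lambda>y. y \<bullet> pole)"

lemma sets_latitude [simp]: "sets (latitude TYPE('a::euclidean_space)) = sets borel"
  by (simp add: latitude_def)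

text \<open>
  Summing \<open>sphere_infinitesimal_rotation\<close> over the \<open>d - 1\<close> basis vectors \<open>v\<close> other than the pole produces the factor \<open>d - 1\<close> on
  the left, and on the right \<open>1 - (y \<bullet> pole)\<^sup>2\<close> as the sum of the squares of the other coordinates.
\<close>

lemma latitude_law_sphere:
  assumes dim: "DIM('a::euclidean_space) \<ge> 3"
  shows "latitude_law (latitude TYPE('a)) DIM('a)"
proof -
  interpret S: prob_space "sphere_uniform 1 :: 'a measure" by (rule prob_space_sphere_uniform)
  have sphere: "AE y in sphere_uniform 1. norm (y :: 'a) = 1"
    by (rule AE_sphere_uniform) simp
  have prob: "prob_space (latitude TYPE('a))"
    unfolding latitude_def by (rule S.prob_space_distr) simp
  show ?thesis
  proof (intro latitude_law.intro prob latitude_law_axioms.intro)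
    show "AE x in latitude TYPE('a). - 1 \<le> x \<and> x \<le> 1"
      unfolding latitude_def
    proof (subst AE_distr_iff)
      show "AE y in sphere_uniform 1. - 1 \<le> y \<bullet> (pole :: 'a) \<and> y \<bullet> pole \<le> 1"
        using sphere
      proof eventually_elim
        case (elim y)
        then show ?case using Cauchy_Schwarz_ineq2[of y pole] by (auto simp: abs_le_iff)
      qed
    qed auto
    have "AE y in sphere_uniform 1. pole \<noteq> (y :: 'a)"
      by (rule sphere_uniform_no_atom) (use dim in auto)
    then show "AE x in latitude TYPE('a). x \<noteq> 1"
      unfolding latitude_def
    proof (subst AE_distr_iff)
      assume "AE y in sphere_uniform 1. pole \<noteq> (y :: 'a)"
      then show "AE y in sphere_uniform 1. y \<bullet> (pole :: 'a) \<noteq> 1"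
        using sphere
      proof eventually_elim
        case (elim y)
        have "y \<bullet> y = 1" "pole \<bullet> (pole :: 'a) = 1"
          using elim(2) by (simp_all only: norm_eq_1[symmetric] norm_pole)
        then have "(norm (y - pole))\<^sup>2 = 2 - 2 * (y \<bullet> pole)"
          by (simp add: power2_norm_eq_inner inner_diff inner_commute)
        then show ?case using elim(1) by auto
      qed
    qed auto
    fix g g' :: "real \<Rightarrow> real"
    assume g [measurable]: "g \<in> borel_measurable borel" "g' \<in> borel_measurable borel"
      and deriv: "\<And>x. x \<in> {-1..1} \<Longrightarrow> (g has_real_derivative g' x) (at x)" and cont: "continuous_on {-1..1} g'"
    let ?e = "pole :: 'a"
    have bdd: "integrable (sphere_uniform 1) (\<lambda>y :: 'a. c y * f (y \<bullet> ?e))"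
      if f [measurable]: "f \<in> borel_measurable borel" and fc: "continuous_on {-1..1} f"
        and c [measurable]: "c \<in> borel_measurable borel" and c1: "\<And>y. norm y = 1 \<Longrightarrow> \<bar>c y\<bar> \<le> 1" for f :: "real \<Rightarrow> real" and c
    proof -
      have "bounded (f ` {-1..1})"
        using compact_imp_bounded[OF compact_continuous_image[OF fc]] by simp
      then obtain B where B: "\<forall>x\<in>{-1..1}. \<bar>f x\<bar> \<le> B" by (auto simp: bounded_iff)
      show ?thesis
      proof (rule S.integrable_const_bound[where B = "1 * B"])
        show "AE y in sphere_uniform 1. norm (c y * f (y \<bullet> ?e)) \<le> 1 * B"
          using sphere
        proof eventually_elim
          case (elim y)
          have "y \<bullet> ?e \<in> {-1..1}"
            using Cauchy_Schwarz_ineq2[of y ?e] elim by (auto simp: abs_le_iff)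
          then show ?case
            unfolding real_norm_def abs_mult by (intro mult_mono c1 bspec[OF B] elim) auto
        qed
      qed measurable
    qed
    have gc: "continuous_on {-1..1} g"
      using deriv by (intro DERIV_continuous_on) (auto intro: has_field_derivative_at_within)
    have coord: "\<bar>y \<bullet> b\<bar> \<le> 1" if "norm y = 1" "b \<in> Basis" for y b :: 'a
      using Cauchy_Schwarz_ineq2[of y b] that by simp
    have i1: "integrable (sphere_uniform 1) (\<lambda>y :: 'a. (y \<bullet> ?e) * g (y \<bullet> ?e))"
      by (intro bdd gc g coord pole_Basis) auto
    have i2: "integrable (sphere_uniform 1) (\<lambda>y :: 'a. (y \<bullet> b)\<^sup>2 * g' (y \<bullet> ?e))" if "b \<in> Basis" for b
      using coord that by (intro bdd cont g) (auto simp: abs_square_le_1)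
    have each: "(\<integral>y. (y \<bullet> ?e) * g (y \<bullet> ?e) \<partial>sphere_uniform 1) = (\<integral>y. (y \<bullet> b)\<^sup>2 * g' (y \<bullet> ?e) \<partial>sphere_uniform 1)"
      if b: "b \<in> Basis - {?e}" for b
    proof -
      have "?e \<bullet> b = 0"
        using b by (intro inner_not_same_Basis pole_Basis) auto
      from sphere_infinitesimal_rotation[OF norm_pole _ this g deriv cont] b
      show ?thesis using i1 i2[of b] by simp
    qed
    have "(real DIM('a) - 1) * (\<integral>y. (y \<bullet> ?e) * g (y \<bullet> ?e) \<partial>sphere_uniform 1)
       = (\<Sum>b\<in>Basis - {?e}. (\<integral>y. (y \<bullet> ?e) * g (y \<bullet> ?e) \<partial>sphere_uniform 1))"
      using pole_Basis[where 'a = 'a] dim by (simp add: card_Diff_singleton of_nat_diff)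
    also have "\<dots> = (\<Sum>b\<in>Basis - {?e}. (\<integral>y. (y \<bullet> b)\<^sup>2 * g' (y \<bullet> ?e) \<partial>sphere_uniform 1))"
      by (rule sum.cong[OF refl each])
    also have "\<dots> = (\<integral>y. (\<Sum>b\<in>Basis - {?e}. (y \<bullet> b)\<^sup>2 * g' (y \<bullet> ?e)) \<partial>sphere_uniform 1)"
      using i2 by (intro Bochner_Integration.integral_sum[symmetric]) auto
    also have "\<dots> = (\<integral>y. (1 - (y \<bullet> ?e)\<^sup>2) * g' (y \<bullet> ?e) \<partial>sphere_uniform 1)"
    proof (rule integral_cong_AE)
      show "AE y in sphere_uniform 1. (\<Sum>b\<in>Basis - {?e}. (y \<bullet> b)\<^sup>2 * g' (y \<bullet> ?e)) = (1 - (y \<bullet> ?e)\<^sup>2) * g' (y \<bullet> ?e)"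
        using sphere
      proof eventually_elim
        case (elim y)
        have "(\<Sum>b\<in>Basis. (y \<bullet> b)\<^sup>2) = (norm y)\<^sup>2"
          unfolding power2_norm_eq_inner euclidean_inner[of y y] by (simp add: power2_eq_square)
        then have "(\<Sum>b\<in>Basis - {?e}. (y \<bullet> b)\<^sup>2) = 1 - (y \<bullet> ?e)\<^sup>2"
          using elim pole_Basis[where 'a = 'a] by (simp add: sum_diff1)
        then show ?case by (simp add: sum_distrib_right[symmetric])
      qed
    qed (auto intro!: borel_measurable_sum)
    finally show "(real DIM('a) - 1) * (\<integral>x. x * g x \<partial>latitude TYPE('a)) = (\<integral>x. (1 - x\<^sup>2) * g' x \<partial>latitude TYPE('a))"
      unfolding latitude_def by (simp add: integral_distr)
  qed (use dim in auto)
qed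

text \<open>
  The reflection in the hyperplane orthogonal to \<open>x - norm x *\<^sub>R pole\<close>.
\<close>

lemma reflection_to_pole:
  fixes x :: "'a::euclidean_space"
  obtains T :: "'a \<Rightarrow> 'a" where "orthogonal_transformation T" "T x = norm x *\<^sub>R pole"
proof (cases "x = norm x *\<^sub>R pole")
  case True
  then show ?thesis using that[of "\<lambda>x. x"] orthogonal_transformation_id by auto
next
  case False
  define w where "w = x - norm x *\<^sub>R pole"
  have w: "w \<bullet> w > 0" using False by (simp add: w_def)
  define T where "T y = y - (2 * (y \<bullet> w) / (w \<bullet> w)) *\<^sub>R w" for y
  have lin: "linear T"
    by (rule linearI) (simp_all add: T_def inner_add_left add_divide_distrib algebra_simps)
  have "norm (T y) = norm y" for y
  proof -
    have "(norm (T y))\<^sup>2 = (norm y)\<^sup>2 - 2 * (2 * (y \<bullet> w) / (w \<bullet> w)) * (y \<bullet> w) + (2 * (y \<bullet> w) / (w \<bullet> w))\<^sup>2 * (w \<bullet> w)"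
      unfolding T_def power2_norm_eq_inner
      by (simp add: inner_diff_left inner_diff_right inner_commute power2_eq_square)
    also have "\<dots> = (norm y)\<^sup>2"
      using w by (simp add: power2_eq_square)
    finally show ?thesis by simp
  qed
  then have "orthogonal_transformation T"
    using lin by (simp add: orthogonal_transformation)
  moreover have "2 * (x \<bullet> w) = w \<bullet> w"
  proof -
    have "pole \<bullet> (pole :: 'a) = 1" "x \<bullet> x = norm x * norm x"
      by (simp_all only: norm_eq_1[symmetric] norm_pole dot_square_norm power2_eq_square)
    then show ?thesis
      by (simp add: w_def inner_diff_left inner_diff_right inner_commute algebra_simps)
  qed
  then have "T x = norm x *\<^sub>R pole"
    using w by (simp add: T_def) (simp add: w_def)
  ultimately show ?thesis by (rule that)
qed

lemma sphere_uniform_scale: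
  "sphere_uniform R = distr (sphere_uniform 1 :: 'a::euclidean_space measure) borel (\<lambda>y. R *\<^sub>R y)"
  unfolding sphere_uniform_def by (subst distr_distr) (auto simp: comp_def)

text \<open>
  The distance of \<open>norm x *\<^sub>R pole\<close> to \<open>R *\<^sub>R z\<close> depends symmetrically on \<open>R\<close> and \<open>norm x\<close>. So an outer point can be
  replaced by an inner point of a larger sphere, and the ratio \<open>m / M\<close> is always at most \<open>1\<close>.
\<close>

lemma distr_sphere_distance:
  fixes x :: "'a::euclidean_space"
  assumes R: "R > 0"
  defines "M \<equiv> max R (norm x)" and "m \<equiv> min R (norm x)"
  shows "distr (sphere_uniform R) borel (\<lambda>y. norm (x - y))
     = distr (latitude TYPE('a)) borel (\<lambda>z. M * sqrt (dist_sq (m / M) z))"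
proof -
  obtain T :: "'a \<Rightarrow> 'a" where T: "orthogonal_transformation T" "T x = norm x *\<^sub>R pole"
    using reflection_to_pole by blast
  note [measurable] = orthogonal_transformation_measurable[OF T(1)]
  have lin: "linear T" using T(1) by (rule orthogonal_transformation_linear)
  let ?f = "\<lambda>z :: 'a. norm (norm x *\<^sub>R pole - R *\<^sub>R z)"
  have "norm (x - R *\<^sub>R y) = ?f (T y)" for y
    using orthogonal_transformation_norm[OF T(1), of "x - R *\<^sub>R y"]
    by (simp add: linear_diff[OF lin] linear_scale[OF lin] T(2))
  then have "distr (sphere_uniform R) borel (\<lambda>y. norm (x - y)) = distr (sphere_uniform 1) borel (?f \<circ> T)"
    by (subst sphere_uniform_scale, subst distr_distr) (auto simp: comp_def)
  also have "\<dots> = distr (distr (sphere_uniform 1) borel T) borel ?f"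
    by (subst distr_distr) auto
  also have "\<dots> = distr (sphere_uniform 1) borel ?f"
    by (simp add: sphere_uniform_orthogonal[OF T(1)])
  also have "\<dots> = distr (sphere_uniform 1) borel (\<lambda>z. M * sqrt (dist_sq (m / M) (z \<bullet> (pole :: 'a))))"
  proof (rule distr_cong_AE)
    show "AE z in sphere_uniform 1. ?f z = M * sqrt (dist_sq (m / M) (z \<bullet> pole))"
      using AE_sphere_uniform[of 1, OF zero_less_one]
    proof eventually_elim
      case (elim z)
      have M: "M > 0" "M * m = R * norm x" "M\<^sup>2 + m\<^sup>2 = R\<^sup>2 + (norm x)\<^sup>2"
        using R by (auto simp: M_def m_def max_def min_def)
      have "(?f z)\<^sup>2 = (norm x)\<^sup>2 + R\<^sup>2 - 2 * (R * norm x) * (z \<bullet> pole)"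
      proof -
        have "pole \<bullet> (pole :: 'a) = 1" "z \<bullet> z = 1"
          using elim by (simp_all only: norm_eq_1[symmetric] norm_pole)
        then show ?thesis
          unfolding power2_norm_eq_inner[of "norm x *\<^sub>R pole - R *\<^sub>R z"]
          by (simp add: inner_diff_left inner_diff_right inner_commute power2_eq_square algebra_simps)
      qed
      also have "\<dots> = M\<^sup>2 + m\<^sup>2 - 2 * (M * m) * (z \<bullet> pole)"
        using M by simp
      also have "\<dots> = M\<^sup>2 * dist_sq (m / M) (z \<bullet> pole)"
        using M(1) by (simp add: dist_sq_def field_simps power2_eq_square)
      finally have "sqrt ((?f z)\<^sup>2) = sqrt (M\<^sup>2 * dist_sq (m / M) (z \<bullet> pole))"
        by simp
      then show ?case
        using M(1) by (simp add: real_sqrt_mult)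
    qed
  qed auto
  also have "\<dots> = distr (latitude TYPE('a)) borel (\<lambda>z. M * sqrt (dist_sq (m / M) z))"
    unfolding latitude_def by (subst distr_distr) (auto simp: comp_def)
  finally show ?thesis .
qed

lemma sphere_potential:
  fixes x :: "'a::euclidean_space"
  assumes R: "R > 0" and dim: "DIM('a) \<ge> 3"
  defines "M \<equiv> max R (norm x)" and "m \<equiv> min R (norm x)"
  assumes int: "integrable (latitude TYPE('a)) (\<lambda>z. riesz_profile s (sqrt (dist_sq (m / M) z)))"
  shows "integrable (sphere_uniform R) (\<lambda>y. riesz_profile s (norm (x - y)))"
    and "(\<integral>y. riesz_profile s (norm (x - y)) \<partial>sphere_uniform R)
      = (if s = 0 then latitude_law.profile_mean (latitude TYPE('a)) s (m / M) - ln M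
         else M powr (- s) * latitude_law.profile_mean (latitude TYPE('a)) s (m / M))"
proof -
  interpret latitude_law "latitude TYPE('a)" "DIM('a)"
    by (rule latitude_law_sphere[OF dim])
  have M: "M > 0" and t: "0 \<le> m / M" "m / M \<le> 1"
    using R by (auto simp: M_def m_def)
  let ?k = "\<lambda>z. riesz_profile s (sqrt (dist_sq (m / M) z))"
  let ?g = "\<lambda>z. if s = 0 then ?k z - ln M else M powr (- s) * ?k z"
  have AE: "AE z in latitude TYPE('a). riesz_profile s (M * sqrt (dist_sq (m / M) z)) = ?g z"
    using range no_pole
  proof eventually_elim
    case (elim z)
    have "dist_sq t z = (1 - t)\<^sup>2 + 2 * t * (1 - z)" for t
      by (simp add: dist_sq_def power2_eq_square algebra_simps)
    from this[of "m / M"] have "dist_sq (m / M) z = (1 - m / M)\<^sup>2 + 2 * (m / M) * (1 - z)" .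
    moreover have "0 < (1 - m / M)\<^sup>2 \<or> 0 < 2 * (m / M) * (1 - z)"
      using elim t by (cases "m / M = 1") auto
    moreover have "0 \<le> (1 - m / M)\<^sup>2" by simp
    moreover have "0 \<le> 2 * (m / M) * (1 - z)"
      using elim t by (intro mult_nonneg_nonneg) auto
    ultimately have "dist_sq (m / M) z > 0" by linarith
    then show ?case by (intro riesz_profile_scale M) simp
  qed
  have gi: "integrable (latitude TYPE('a)) ?g"
    using int by (cases "s = 0") simp_all
  have i: "integrable (latitude TYPE('a)) (\<lambda>z. riesz_profile s (M * sqrt (dist_sq (m / M) z)))"
    by (rule integrable_cong_AE_imp[OF gi]) (use AE in \<open>auto elim!: AE_mp\<close>)
  have "integrable (distr (sphere_uniform R) borel (\<lambda>y. norm (x - y))) (riesz_profile s)"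
    unfolding distr_sphere_distance[OF R] M_def[symmetric] m_def[symmetric]
    using i by (subst integrable_distr_eq) auto
  then show "integrable (sphere_uniform R) (\<lambda>y. riesz_profile s (norm (x - y)))"
    by (subst (asm) integrable_distr_eq) auto
  have "(\<integral>y. riesz_profile s (norm (x - y)) \<partial>sphere_uniform R)
     = (\<integral>r. riesz_profile s r \<partial>distr (sphere_uniform R) borel (\<lambda>y. norm (x - y)))"
    by (subst integral_distr) auto
  also have "\<dots> = (\<integral>z. riesz_profile s (M * sqrt (dist_sq (m / M) z)) \<partial>latitude TYPE('a))"
    unfolding distr_sphere_distance[OF R] M_def[symmetric] m_def[symmetric]
    by (subst integral_distr) auto
  also have "\<dots> = (\<integral>z. ?g z \<partial>latitude TYPE('a))"
    by (rule integral_cong_AE) (use AE gi in auto)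
  also have "\<dots> = (if s = 0 then profile_mean s (m / M) - ln M else M powr (- s) * profile_mean s (m / M))"
    unfolding profile_mean_def using int by (cases "s = 0") (simp_all add: prob_space)
  finally show "(\<integral>y. riesz_profile s (norm (x - y)) \<partial>sphere_uniform R)
      = (if s = 0 then profile_mean s (m / M) - ln M else M powr (- s) * profile_mean s (m / M))" .
qed

lemma sphere_potential_biharmonic:
  fixes x :: "'a::euclidean_space"
  assumes R: "R > 0" and dim: "DIM('a) \<ge> 3" and s: "s = real DIM('a) - 4"
  defines "M \<equiv> max R (norm x)" and "m \<equiv> min R (norm x)"
  shows "integrable (sphere_uniform R) (\<lambda>y. riesz_profile s (norm (x - y)))"
    and "(\<integral>y. riesz_profile s (norm (x - y)) \<partial>sphere_uniform R)
      = riesz_profile s M - riesz_slope s / (s + 4) * m\<^sup>2 * M powr (- s - 2)"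
proof -
  interpret latitude_law "latitude TYPE('a)" "DIM('a)"
    by (rule latitude_law_sphere[OF dim])
  have M: "M > 0" and t: "0 \<le> m / M" "m / M \<le> 1"
    using R by (auto simp: M_def m_def)
  note pm = profile_mean_biharmonic_closed[OF t s]
  note sp = sphere_potential[OF R dim, of s x, folded M_def m_def, OF pm(2)]
  show "integrable (sphere_uniform R) (\<lambda>y. riesz_profile s (norm (x - y)))"
    by (rule sp(1))
  have e: "M powr (- s - 2) = M powr (- s) / M\<^sup>2"
    using M by (simp add: powr_diff)
  have d: "real DIM('a) = s + 4" using s by simp
  show "(\<integral>y. riesz_profile s (norm (x - y)) \<partial>sphere_uniform R)
      = riesz_profile s M - riesz_slope s / (s + 4) * m\<^sup>2 * M powr (- s - 2)"
    unfolding sp(2) pm(1) e d by (cases "s = 0") (simp_all add: riesz_profile_def power_divide algebra_simps)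
qed

section \<open>Polar coordinates and mixtures\<close>

lemma content_unit_ball: "emeasure lborel (ball (0 :: 'a::euclidean_space) 1) = ennreal (unit_ball_vol DIM('a))"
  by (simp add: emeasure_ball)

lemma sphere_area_eq: "sphere_area TYPE('a::euclidean_space) = DIM('a) * unit_ball_vol DIM('a)"
proof -
  have "Gamma (real DIM('a) / 2 + 1) = real DIM('a) / 2 * Gamma (real DIM('a) / 2)"
    by (rule Gamma_plus1) (auto dest!: nonpos_Ints_nonpos)
  then show ?thesis
    unfolding sphere_area_def unit_ball_vol_def by (simp only:) simp
qed

lemma sphere_area_pos: "sphere_area TYPE('a::euclidean_space) > 0"
  unfolding sphere_area_eq by (intro mult_pos_pos) auto

text \<open>
  The image of Lebesgue measure under the norm; see \<open>polar_decomposition\<close>.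
\<close>

definition radius_measure :: "'a::euclidean_space itself \<Rightarrow> real measure" where
  "radius_measure _ = density lborel (\<lambda>r. ennreal (sphere_area TYPE('a) * r ^ (DIM('a) - 1)) * indicator {0<..} r)"

lemma sets_radius_measure [simp, measurable_cong]: "sets (radius_measure TYPE('a::euclidean_space)) = sets borel"
  by (simp add: radius_measure_def)

lemma sigma_finite_radius_measure: "sigma_finite_measure (radius_measure TYPE('a::euclidean_space))"
  unfolding radius_measure_def
  by (subst sigma_finite_measure.sigma_finite_iff_density_finite[OF sigma_finite_lborel]) (auto simp: indicator_def intro!: AE_I2)

lemma emeasure_radius_measure_lessThan:
  assumes "\<rho> > 0"
  shows "emeasure (radius_measure TYPE('a::euclidean_space)) {..<\<rho>} = ennreal (unit_ball_vol DIM('a) * \<rho> ^ DIM('a))"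
proof -
  have "emeasure (radius_measure TYPE('a)) {..<\<rho>}
    = (\<integral>\<^sup>+r. ennreal (sphere_area TYPE('a) * r ^ (DIM('a) - 1)) * indicator {0<..} r * indicator {..<\<rho>} r \<partial>lborel)"
    unfolding radius_measure_def by (subst emeasure_density) auto
  also have "\<dots> = (\<integral>\<^sup>+r. ennreal (sphere_area TYPE('a) * \<bar>r\<bar> ^ (DIM('a) - 1)) * indicator {0..\<rho>} r \<partial>lborel)"
  proof (rule nn_integral_cong_AE)
    show "AE r in lborel. ennreal (sphere_area TYPE('a) * r ^ (DIM('a) - 1)) * indicator {0<..} r * indicator {..<\<rho>} r
      = ennreal (sphere_area TYPE('a) * \<bar>r\<bar> ^ (DIM('a) - 1)) * indicator {0..\<rho>} r"
      using AE_lborel_singleton[of "0::real"] AE_lborel_singleton[of \<rho>]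
      by eventually_elim (auto simp: indicator_def)
  qed
  also have "\<dots> = ennreal (unit_ball_vol DIM('a) * \<rho> ^ DIM('a) - unit_ball_vol DIM('a) * 0 ^ DIM('a))"
  proof (rule nn_integral_FTC_Icc)
    show "((\<lambda>r. unit_ball_vol DIM('a) * r ^ DIM('a)) has_real_derivative sphere_area TYPE('a) * \<bar>r\<bar> ^ (DIM('a) - 1)) (at r)"
      if "r \<in> {0..\<rho>}" for r
      using that by (auto intro!: derivative_eq_intros simp: sphere_area_eq)
    show "0 \<le> sphere_area TYPE('a) * \<bar>r\<bar> ^ (DIM('a) - 1)" for r
      using sphere_area_pos[where 'a = 'a] by simp
  qed (use assms in auto)
  finally show ?thesis by (simp add: power_0_left)
qed

text \<open>
  This is homogeneity of Lebesgue measure, since the uniform measure on the sphere is the normalized cone measure.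
\<close>

lemma emeasure_cone:
  fixes B :: "'a::euclidean_space set"
  assumes B [measurable]: "B \<in> sets borel" and \<rho>: "\<rho> > 0"
  shows "emeasure lborel {x. norm x < \<rho> \<and> (1 / norm x) *\<^sub>R x \<in> B}
    = ennreal (unit_ball_vol DIM('a) * \<rho> ^ DIM('a)) * emeasure (sphere_uniform 1) B"
proof -
  let ?C = "\<lambda>\<rho>. {x :: 'a. norm x < \<rho> \<and> (1 / norm x) *\<^sub>R x \<in> B}"
  have [measurable]: "?C \<rho> \<in> sets borel" for \<rho>
    by measurable
  have "emeasure lborel (?C \<rho>) = (\<integral>\<^sup>+x. indicator (?C \<rho>) x \<partial>lborel)"
    by simp
  also have "\<dots> = ennreal (\<rho> ^ DIM('a)) * (\<integral>\<^sup>+z. indicator (?C \<rho>) (0 + \<rho> *\<^sub>R z) \<partial>lborel)"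
    by (rule nn_integral_lborel_affine[OF \<rho>]) measurable
  also have "(\<lambda>z. indicator (?C \<rho>) (0 + \<rho> *\<^sub>R z)) = (indicator (?C 1) :: 'a \<Rightarrow> ennreal)"
    using \<rho> by (auto simp: fun_eq_iff indicator_def)
  also have "(\<integral>\<^sup>+z. indicator (?C 1) z \<partial>lborel) = emeasure lborel (?C 1)"
    by simp
  also have "?C 1 = ball 0 1 \<inter> (\<lambda>x. (1 / norm x) *\<^sub>R x) -` B"
    by auto
  finally have *: "emeasure lborel (?C \<rho>) = ennreal (\<rho> ^ DIM('a)) * emeasure lborel (ball 0 1 \<inter> (\<lambda>x. (1 / norm x) *\<^sub>R x) -` B)" .
  have m: "(\<lambda>x :: 'a. (1 / norm x) *\<^sub>R x) -` B \<in> sets borel"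
    using measurable_sets[of "\<lambda>x :: 'a. (1 / norm x) *\<^sub>R x" borel borel B] by simp
  have "emeasure (sphere_uniform 1) B
    = emeasure lborel (ball 0 1 \<inter> (\<lambda>x. (1 / norm x) *\<^sub>R x) -` B) / ennreal (unit_ball_vol DIM('a))"
    unfolding sphere_uniform_def using m
    by (subst emeasure_distr) (auto simp: content_unit_ball)
  moreover have "ennreal (unit_ball_vol DIM('a)) \<noteq> 0" "ennreal (unit_ball_vol DIM('a)) \<noteq> \<top>"
    using unit_ball_vol_pos[of "real DIM('a)"] by (simp_all del: unit_ball_vol_pos)
  ultimately have e: "ennreal (unit_ball_vol DIM('a)) * emeasure (sphere_uniform 1) B
    = emeasure lborel (ball 0 1 \<inter> (\<lambda>x. (1 / norm x) *\<^sub>R x) -` B)"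
    by (simp only: ennreal_times_divide mult.commute[of "ennreal (unit_ball_vol DIM('a))"])
      (rule mult_divide_eq_ennreal)
  show ?thesis
    unfolding * e[symmetric] using \<rho> by (simp add: ennreal_mult ac_simps)
qed

text \<open>
  For a fixed set \<open>B\<close> of directions both sides are measures in the radial variable, and \<open>emeasure_cone\<close> says that they
  agree on the intervals \<open>{..<\<rho>}\<close>, which generate the Borel sets.
\<close>

lemma polar_decomposition:
  "distr lborel (borel \<Otimes>\<^sub>M borel) (\<lambda>x :: 'a::euclidean_space. (norm x, (1 / norm x) *\<^sub>R x))
     = radius_measure TYPE('a) \<Otimes>\<^sub>M sphere_uniform 1"
proof (rule pair_measure_eqI[symmetric])
  interpret S: prob_space "sphere_uniform 1 :: 'a measure" by (rule prob_space_sphere_uniform)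
  show "sigma_finite_measure (radius_measure TYPE('a))" by (rule sigma_finite_radius_measure)
  show "sigma_finite_measure (sphere_uniform 1 :: 'a measure)" by unfold_locales
  show "sets (radius_measure TYPE('a) \<Otimes>\<^sub>M (sphere_uniform 1 :: 'a measure))
    = sets (distr lborel (borel \<Otimes>\<^sub>M borel) (\<lambda>x :: 'a. (norm x, (1 / norm x) *\<^sub>R x)))"
    by (simp cong: sets_pair_measure_cong)
  fix A :: "real set" and B :: "'a set"
  assume "A \<in> sets (radius_measure TYPE('a))" "B \<in> sets (sphere_uniform 1)"
  then have A [measurable]: "A \<in> sets borel" and B [measurable]: "B \<in> sets borel" by auto
  define N1 where "N1 = scale_measure (emeasure (sphere_uniform 1) B) (radius_measure TYPE('a))"
  define N2 where "N2 = distr (density lborel (indicator {x :: 'a. (1 / norm x) *\<^sub>R x \<in> B})) borel norm"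
  have [measurable]: "{x :: 'a. (1 / norm x) *\<^sub>R x \<in> B} \<in> sets borel" by measurable
  have N2: "emeasure N2 X = emeasure lborel {x :: 'a. norm x \<in> X \<and> (1 / norm x) *\<^sub>R x \<in> B}"
    if X [measurable]: "X \<in> sets borel" for X
  proof -
    have m: "norm -` X \<in> sets (borel :: 'a measure)"
      using measurable_sets[of "norm :: 'a \<Rightarrow> real" borel borel X] by simp
    have "emeasure N2 X = (\<integral>\<^sup>+x. indicator {x :: 'a. (1 / norm x) *\<^sub>R x \<in> B} x * indicator (norm -` X) x \<partial>lborel)"
      unfolding N2_def using m by (simp add: emeasure_distr emeasure_density)
    also have "\<dots> = (\<integral>\<^sup>+x. indicator {x :: 'a. norm x \<in> X \<and> (1 / norm x) *\<^sub>R x \<in> B} x \<partial>lborel)"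
      by (intro nn_integral_cong) (auto simp: indicator_def)
    finally show ?thesis by simp
  qed
  have "N1 = N2"
  proof (rule measure_eqI_generator_eq[where E = "range lessThan" and \<Omega> = UNIV and A = "\<lambda>i. {..<real i}"])
    show "Int_stable (range lessThan :: real set set)"
    proof -
      have "{..<a} \<inter> {..<b} = {..<min a b}" for a b :: real
        by auto
      then show ?thesis by (auto simp: Int_stable_def)
    qed
    show "sets N1 = sigma_sets UNIV (range lessThan)" "sets N2 = sigma_sets UNIV (range lessThan)"
      unfolding N1_def N2_def by (simp_all add: borel_Iio sets_measure_of)
    show "(\<Union>i. {..<real i}) = UNIV"
      using reals_Archimedean2 by auto
    show eq: "emeasure N1 X = emeasure N2 X" if X': "X \<in> range lessThan" for X
    proof -
      obtain \<rho> where X: "X = {..<\<rho>}" using X' by auto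
      show ?thesis
      proof (cases "\<rho> > 0")
        case True
        then show ?thesis
          unfolding X by (simp add: N2 emeasure_cone N1_def emeasure_radius_measure_lessThan mult.commute)
      next
        case False
        have "emeasure (radius_measure TYPE('a)) {..<\<rho>}
          = (\<integral>\<^sup>+r. ennreal (sphere_area TYPE('a) * r ^ (DIM('a) - 1)) * indicator {0<..} r * indicator {..<\<rho>} r \<partial>lborel)"
          unfolding radius_measure_def by (subst emeasure_density) auto
        also have "\<dots> = (\<integral>\<^sup>+r. 0 \<partial>(lborel :: real measure))"
          by (intro nn_integral_cong) (use False in \<open>auto simp: indicator_def\<close>)
        finally have "emeasure (radius_measure TYPE('a)) {..<\<rho>} = 0"
          by simp
        moreover have "{x :: 'a. norm x < \<rho> \<and> (1 / norm x) *\<^sub>R x \<in> B} = {}"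
          using False norm_ge_zero order_le_less_trans by blast
        then have "emeasure lborel {x :: 'a. norm x < \<rho> \<and> (1 / norm x) *\<^sub>R x \<in> B} = 0"
          by (simp only: emeasure_empty)
        ultimately show ?thesis
          unfolding X by (simp add: N2 N1_def)
      qed
    qed
    show "emeasure N1 {..<real i} \<noteq> \<infinity>" for i
    proof (cases i)
      case 0
      then have "emeasure N1 {..<real i} = emeasure N2 {..<0}" using eq by simp
      also have "\<dots> = emeasure lborel ({} :: 'a set)"
        by (simp add: N2)
      finally show ?thesis by simp
    next
      case (Suc n)
      then have "real i > 0" by simp
      then show ?thesis
        by (simp add: N1_def emeasure_radius_measure_lessThan ennreal_mult_eq_top_iff)
    qed
  qed auto
  then have "emeasure (sphere_uniform 1) B * emeasure (radius_measure TYPE('a)) A = emeasure N2 A"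
    by (simp add: N1_def[symmetric] emeasure_scale_measure[symmetric] del: emeasure_scale_measure)
  also have "\<dots> = emeasure lborel ((\<lambda>x :: 'a. (norm x, (1 / norm x) *\<^sub>R x)) -` (A \<times> B))"
    unfolding N2[OF A] by (rule arg_cong[where f = "emeasure lborel"]) auto
  finally show "emeasure (radius_measure TYPE('a)) A * emeasure (sphere_uniform 1) B
    = emeasure (distr lborel (borel \<Otimes>\<^sub>M borel) (\<lambda>x :: 'a. (norm x, (1 / norm x) *\<^sub>R x))) (A \<times> B)"
    by (subst emeasure_distr) (auto simp: mult.commute)
qed

lemma nn_integral_polar:
  fixes h :: "'a::euclidean_space \<Rightarrow> ennreal"
  assumes h [measurable]: "h \<in> borel_measurable borel"
  shows "(\<integral>\<^sup>+x. h x \<partial>lborel)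
    = (\<integral>\<^sup>+r. ennreal (sphere_area TYPE('a) * r ^ (DIM('a) - 1)) * indicator {0<..} r * (\<integral>\<^sup>+y. h y \<partial>sphere_uniform r) \<partial>lborel)"
proof -
  interpret S: prob_space "sphere_uniform 1 :: 'a measure" by (rule prob_space_sphere_uniform)
  have sph: "(\<integral>\<^sup>+y. h y \<partial>sphere_uniform r) = (\<integral>\<^sup>+y. h (r *\<^sub>R y) \<partial>sphere_uniform 1)" for r
    by (subst sphere_uniform_scale) (simp add: nn_integral_distr)
  have "(\<integral>\<^sup>+x. h x \<partial>lborel) = (\<integral>\<^sup>+x. (\<lambda>(r, y). h (r *\<^sub>R y)) (norm x, (1 / norm x) *\<^sub>R x) \<partial>lborel)"
  proof (rule nn_integral_cong)
    fix x :: 'a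
    show "h x = (\<lambda>(r, y). h (r *\<^sub>R y)) (norm x, (1 / norm x) *\<^sub>R x)"
      by (cases "x = 0") auto
  qed
  also have "\<dots> = (\<integral>\<^sup>+p. (\<lambda>(r, y). h (r *\<^sub>R y)) p \<partial>(radius_measure TYPE('a) \<Otimes>\<^sub>M sphere_uniform 1))"
    unfolding polar_decomposition[symmetric] by (subst nn_integral_distr) auto
  also have "\<dots> = (\<integral>\<^sup>+r. (\<integral>\<^sup>+y. h (r *\<^sub>R y) \<partial>sphere_uniform 1) \<partial>radius_measure TYPE('a))"
    by (subst S.nn_integral_fst[symmetric]) auto
  also have "\<dots> = (\<integral>\<^sup>+r. ennreal (sphere_area TYPE('a) * r ^ (DIM('a) - 1)) * indicator {0<..} r * (\<integral>\<^sup>+y. h (r *\<^sub>R y) \<partial>sphere_uniform 1) \<partial>lborel)"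
    unfolding radius_measure_def by (subst nn_integral_density) auto
  finally show ?thesis by (simp only: sph)
qed

text \<open>
  The density of the norm under \<^const>\<open>radial_density\<close> with \<open>\<alpha> + s = a\<close>, when \<open>s\<close> is the dimension minus \<open>4\<close>: the surface
  factor \<open>r ^ (d - 1)\<close> turns the exponent \<open>\<alpha> - 4\<close> into \<open>a - 1\<close>.
\<close>

definition radial_weight :: "real \<Rightarrow> real \<Rightarrow> real \<Rightarrow> real" where
  "radial_weight a R r = indicator {0<..R} r * (a / R powr a * r powr (a - 1))"

lemma radial_weight_measurable [measurable]: "radial_weight a R \<in> borel_measurable borel"
  unfolding radial_weight_def by measurable

lemma radial_density_measurable [measurable]: "radial_density s \<alpha> R \<in> borel_measurable (borel :: 'a::euclidean_space measure)"
  unfolding radial_density_def by measurable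

lemma nn_integral_sphere_measurable [measurable]:
  fixes h :: "'a::euclidean_space \<Rightarrow> ennreal"
  assumes [measurable]: "h \<in> borel_measurable borel"
  shows "(\<lambda>r. \<integral>\<^sup>+y. h y \<partial>sphere_uniform r) \<in> borel_measurable borel"
proof -
  interpret S: prob_space "sphere_uniform 1 :: 'a measure" by (rule prob_space_sphere_uniform)
  have "(\<integral>\<^sup>+y. h y \<partial>sphere_uniform r) = (\<integral>\<^sup>+y. h (r *\<^sub>R y) \<partial>sphere_uniform 1)" for r
    by (subst sphere_uniform_scale) (simp add: nn_integral_distr)
  then show ?thesis by simp
qed

lemma nn_integral_radial_density:
  fixes h :: "'a::euclidean_space \<Rightarrow> ennreal"
  assumes h [measurable]: "h \<in> borel_measurable borel" and R: "R > 0" and s: "s = real DIM('a) - 4" and a: "\<alpha> + s > 0"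
  shows "(\<integral>\<^sup>+x. h x \<partial>density lborel (\<lambda>x. ennreal (radial_density s \<alpha> R x)))
    = (\<integral>\<^sup>+r. ennreal (radial_weight (\<alpha> + s) R r) * (\<integral>\<^sup>+y. h y \<partial>sphere_uniform r) \<partial>lborel)"
proof -
  have "(\<integral>\<^sup>+x. h x \<partial>density lborel (\<lambda>x. ennreal (radial_density s \<alpha> R x)))
     = (\<integral>\<^sup>+x. ennreal (radial_density s \<alpha> R x) * h x \<partial>lborel)"
    by (subst nn_integral_density) auto
  also have "\<dots> = (\<integral>\<^sup>+r. ennreal (sphere_area TYPE('a) * r ^ (DIM('a) - 1)) * indicator {0<..} r
      * (\<integral>\<^sup>+y. ennreal (radial_density s \<alpha> R y) * h y \<partial>sphere_uniform r) \<partial>lborel)"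
    by (rule nn_integral_polar) measurable
  also have "\<dots> = (\<integral>\<^sup>+r. ennreal (radial_weight (\<alpha> + s) R r) * (\<integral>\<^sup>+y. h y \<partial>sphere_uniform r) \<partial>lborel)"
  proof (rule nn_integral_cong)
    fix r :: real
    show "ennreal (sphere_area TYPE('a) * r ^ (DIM('a) - 1)) * indicator {0<..} r
        * (\<integral>\<^sup>+y. ennreal (radial_density s \<alpha> R y) * h y \<partial>sphere_uniform r)
      = ennreal (radial_weight (\<alpha> + s) R r) * (\<integral>\<^sup>+y. h y \<partial>sphere_uniform r)"
    proof (cases "r > 0")
      case True
      let ?A = "sphere_area TYPE('a)"
      let ?f = "(\<alpha> + s) / (R powr (\<alpha> + s) * ?A) * r powr (\<alpha> - 4) * indicator {..R} r"
      have "(\<integral>\<^sup>+y. ennreal (radial_density s \<alpha> R y) * h y \<partial>sphere_uniform r) = (\<integral>\<^sup>+y. ennreal ?f * h y \<partial>sphere_uniform r)"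
      proof (rule nn_integral_cong_AE)
        show "AE y in sphere_uniform r. ennreal (radial_density s \<alpha> R y) * h y = ennreal ?f * h y"
          using AE_sphere_uniform[OF True]
          by eventually_elim (auto simp: radial_density_def indicator_def)
      qed
      also have "\<dots> = ennreal ?f * (\<integral>\<^sup>+y. h y \<partial>sphere_uniform r)"
        by (rule nn_integral_cmult) simp
      finally have eq: "(\<integral>\<^sup>+y. ennreal (radial_density s \<alpha> R y) * h y \<partial>sphere_uniform r) = ennreal ?f * (\<integral>\<^sup>+y. h y \<partial>sphere_uniform r)" .
      have "r powr (\<alpha> + s - 1) = r ^ (DIM('a) - 1) * r powr (\<alpha> - 4)"
        using True s by (simp add: powr_realpow[symmetric] powr_add[symmetric] of_nat_diff add.commute)
      then have "?A * r ^ (DIM('a) - 1) * ?f = radial_weight (\<alpha> + s) R r"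
        using True sphere_area_pos[where 'a = 'a] by (simp add: radial_weight_def indicator_def)
      moreover have "ennreal (?A * r ^ (DIM('a) - 1)) * ennreal ?f = ennreal (?A * r ^ (DIM('a) - 1) * ?f)"
        using True sphere_area_pos[where 'a = 'a] a by (intro ennreal_mult[symmetric]) auto
      ultimately show ?thesis
        unfolding eq using True by (simp add: mult.assoc[symmetric])
    qed (simp add: radial_weight_def)
  qed
  finally show ?thesis .
qed

lemma has_bochner_integral_radial_density:
  fixes h :: "'a::euclidean_space \<Rightarrow> real"
  assumes h [measurable]: "h \<in> borel_measurable borel" and R: "R > 0" and s: "s = real DIM('a) - 4" and a: "\<alpha> + s > 0"
    and lower: "\<And>r. 0 < r \<Longrightarrow> r \<le> R \<Longrightarrow> AE y in sphere_uniform r. 0 \<le> h y"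
    and int: "\<And>r. 0 < r \<Longrightarrow> r \<le> R \<Longrightarrow> integrable (sphere_uniform r) h"
    and I: "has_bochner_integral lborel (\<lambda>r. radial_weight (\<alpha> + s) R r * (\<integral>y. h y \<partial>sphere_uniform r)) I"
    and nonneg: "AE y in density lborel (\<lambda>x. ennreal (radial_density s \<alpha> R x)). 0 \<le> h y"
  shows "has_bochner_integral (density lborel (\<lambda>x. ennreal (radial_density s \<alpha> R x))) h I"
proof (rule has_bochner_integral_nn_integral)
  show "h \<in> borel_measurable (density lborel (\<lambda>x. ennreal (radial_density s \<alpha> R x)))" by simp
  have pos: "0 \<le> radial_weight (\<alpha> + s) R r * (\<integral>y. h y \<partial>sphere_uniform r)" for r
  proof (cases "0 < r \<and> r \<le> R")
    case True
    then show ?thesis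
      using a lower[of r] by (intro mult_nonneg_nonneg integral_nonneg_AE) (auto simp: radial_weight_def)
  qed (auto simp: radial_weight_def indicator_def)
  show "0 \<le> I"
    unfolding has_bochner_integral_integral_eq[OF I, symmetric]
    by (rule Bochner_Integration.integral_nonneg) (rule pos)
  have "(\<integral>\<^sup>+x. ennreal (h x) \<partial>density lborel (\<lambda>x. ennreal (radial_density s \<alpha> R x)))
     = (\<integral>\<^sup>+r. ennreal (radial_weight (\<alpha> + s) R r) * (\<integral>\<^sup>+y. ennreal (h y) \<partial>sphere_uniform r) \<partial>lborel)"
    by (rule nn_integral_radial_density[OF _ R s a]) measurable
  also have "\<dots> = (\<integral>\<^sup>+r. ennreal (radial_weight (\<alpha> + s) R r * (\<integral>y. h y \<partial>sphere_uniform r)) \<partial>lborel)"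
  proof (rule nn_integral_cong)
    fix r
    show "ennreal (radial_weight (\<alpha> + s) R r) * (\<integral>\<^sup>+y. ennreal (h y) \<partial>sphere_uniform r)
      = ennreal (radial_weight (\<alpha> + s) R r * (\<integral>y. h y \<partial>sphere_uniform r))"
    proof (cases "0 < r \<and> r \<le> R")
      case True
      then have "(\<integral>\<^sup>+y. ennreal (h y) \<partial>sphere_uniform r) = ennreal (\<integral>y. h y \<partial>sphere_uniform r)"
        using lower int by (intro nn_integral_eq_integral) auto
      moreover have "0 \<le> radial_weight (\<alpha> + s) R r"
        using a True by (simp add: radial_weight_def)
      ultimately show ?thesis by (simp add: ennreal_mult')
    qed (auto simp: radial_weight_def indicator_def)
  qed
  also have "\<dots> = ennreal I"
  proof -
    have "integrable lborel (\<lambda>r. radial_weight (\<alpha> + s) R r * (\<integral>y. h y \<partial>sphere_uniform r))"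
      using I by (simp add: has_bochner_integral_iff)
    then show ?thesis
      using pos has_bochner_integral_integral_eq[OF I] by (simp add: nn_integral_eq_integral)
  qed
  finally show "(\<integral>\<^sup>+x. ennreal (h x) \<partial>density lborel (\<lambda>x. ennreal (radial_density s \<alpha> R x))) = ennreal I" .
qed (rule nonneg)

text \<open>
  The transition from the integral that the fundamental theorem of calculus provides to a Lebesgue integral. The
  functions \<open>q\<close> and \<open>W\<close> are related on \<open>{0<..R}\<close> only, because \<open>W r\<close> will be an integral over a sphere of
  radius \<open>r\<close>.
\<close>

lemma has_bochner_integral_radial_weight:
  assumes R: "R > 0" and a: "a > 0"
    and I: "(q has_integral I) {0..R}" and q [measurable]: "q \<in> borel_measurable borel"
    and q_eq: "\<And>r. 0 < r \<Longrightarrow> r \<le> R \<Longrightarrow> q r = a * r powr (a - 1) * W r"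
    and nonneg: "\<And>r. 0 < r \<Longrightarrow> r \<le> R \<Longrightarrow> 0 \<le> W r"
  shows "has_bochner_integral lborel (\<lambda>r. radial_weight a R r * W r) (I / R powr a)"
proof -
  have qI: "((\<lambda>r. indicator {0<..R} r * q r) has_integral I) UNIV"
  proof -
    have "((\<lambda>r. if r \<in> {0..R} then q r else 0) has_integral I) UNIV"
      using I by (simp only: has_integral_restrict_UNIV)
    then show ?thesis
      by (rule has_integral_spike[of "{0}", rotated 2]) (auto simp: indicator_def)
  qed
  have nn: "0 \<le> indicator {0<..R} r * q r" for r
    using q_eq[of r] nonneg[of r] a by (auto simp: indicator_def)
  have "(\<integral>\<^sup>+r. ennreal (indicator {0<..R} r * q r) \<partial>lborel) = ennreal I"
    by (rule nn_integral_has_integral_lborel[OF _ nn qI]) measurable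
  moreover have "0 \<le> I"
    by (rule has_integral_nonneg[OF qI]) (use nn in auto)
  ultimately have "has_bochner_integral lborel (\<lambda>r. indicator {0<..R} r * q r) I"
    using nn by (intro has_bochner_integral_nn_integral) auto
  from has_bochner_integral_mult_right[OF this, of "1 / R powr a"]
  have "has_bochner_integral lborel (\<lambda>r. 1 / R powr a * (indicator {0<..R} r * q r)) (I / R powr a)"
    by simp
  moreover have "(\<lambda>r. 1 / R powr a * (indicator {0<..R} r * q r)) = (\<lambda>r. radial_weight a R r * W r)"
    using q_eq by (auto simp: radial_weight_def indicator_def fun_eq_iff)
  ultimately show ?thesis by simp
qed

text \<open>
  A mixture of two probability measures is the law of a two-stage experiment, which begins with a Bernoulli variable that selects one of
  them.
\<close>

lemma nn_integral_mixture:
  fixes h :: "'a::topological_space \<Rightarrow> ennreal"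
  assumes b: "0 \<le> b" "b \<le> 1" and \<mu>: "\<mu> \<in> borel_prob_measures" and \<nu>: "\<nu> \<in> borel_prob_measures"
    and h: "h \<in> borel_measurable borel"
  shows "(\<integral>\<^sup>+x. h x \<partial>mixture b \<mu> \<nu>) = ennreal b * (\<integral>\<^sup>+x. h x \<partial>\<mu>) + ennreal (1 - b) * (\<integral>\<^sup>+x. h x \<partial>\<nu>)"
proof -
  let ?N = "\<lambda>i. if i then \<mu> else \<nu>"
  have N: "?N \<in> measurable (measure_pmf (bernoulli_pmf b)) (subprob_algebra borel)"
    using \<mu> \<nu> by (auto simp: borel_prob_measures_def space_subprob_algebra prob_space_imp_subprob_space)
  have s: "sets \<mu> = sets borel" "sets \<nu> = sets borel"
    using \<mu> \<nu> by (auto simp: borel_prob_measures_def)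
  have "mixture b \<mu> \<nu> = measure_pmf (bernoulli_pmf b) \<bind> ?N"
  proof (rule measure_eqI)
    show "sets (mixture b \<mu> \<nu>) = sets (measure_pmf (bernoulli_pmf b) \<bind> ?N)"
      using s by (subst sets_bind[of _ _ borel]) auto
    fix A assume "A \<in> sets (mixture b \<mu> \<nu>)"
    then have A: "A \<in> sets borel" by simp
    then show "emeasure (mixture b \<mu> \<nu>) A = emeasure (measure_pmf (bernoulli_pmf b) \<bind> ?N) A"
      using b by (simp add: emeasure_mixture[OF s] emeasure_bind[OF _ N] mult.commute)
  qed
  then show ?thesis
    using b by (simp add: nn_integral_bind[OF h N] mult.commute)
qed

lemma mixture_borel_prob:
  fixes \<mu> \<nu> :: "'a::topological_space measure"
  assumes b: "0 \<le> b" "b \<le> 1" and \<mu>: "\<mu> \<in> borel_prob_measures" and \<nu>: "\<nu> \<in> borel_prob_measures"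
  shows "mixture b \<mu> \<nu> \<in> borel_prob_measures"
proof -
  have s: "sets \<mu> = sets borel" "sets \<nu> = sets borel" and p: "prob_space \<mu>" "prob_space \<nu>"
    using \<mu> \<nu> by (auto simp: borel_prob_measures_def)
  have "space \<mu> = UNIV" "space \<nu> = UNIV"
    using s[THEN sets_eq_imp_space_eq] by auto
  then have "emeasure (mixture b \<mu> \<nu>) UNIV = ennreal b * 1 + ennreal (1 - b) * 1"
    using prob_space.emeasure_space_1[OF p(1)] prob_space.emeasure_space_1[OF p(2)]
    by (simp add: emeasure_mixture[OF s])
  also have "\<dots> = 1" using b by (simp add: ennreal_plus[symmetric] del: ennreal_plus)
  finally have "prob_space (mixture b \<mu> \<nu>)"
    using sets_eq_imp_space_eq[OF sets_mixture[of b \<mu> \<nu>]] by (intro prob_spaceI) simp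
  then show ?thesis by (simp add: borel_prob_measures_def)
qed

lemma AE_mixture:
  assumes \<mu>: "\<mu> \<in> borel_prob_measures" and \<nu>: "\<nu> \<in> borel_prob_measures"
    and P: "{x. \<not> P x} \<in> sets borel" and AE: "AE x in \<mu>. P x" "AE x in \<nu>. P x"
  shows "AE x in mixture b \<mu> \<nu>. P x"
proof (rule AE_I[where N = "{x. \<not> P x}"])
  have s: "sets \<mu> = sets borel" "sets \<nu> = sets borel"
    using \<mu> \<nu> by (auto simp: borel_prob_measures_def)
  have sp: "space \<mu> = UNIV" "space \<nu> = UNIV"
    using s[THEN sets_eq_imp_space_eq] by auto
  have "emeasure \<mu> {x. \<not> P x} = 0" "emeasure \<nu> {x. \<not> P x} = 0"
    using AE P s sp by (auto simp: AE_iff_measurable[OF _ refl])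
  then show "emeasure (mixture b \<mu> \<nu>) {x. \<not> P x} = 0"
    by (simp add: emeasure_mixture[OF s P])
qed (use P in auto)

lemma has_bochner_integral_mixture:
  fixes h :: "'a::topological_space \<Rightarrow> real"
  assumes b: "0 \<le> b" "b \<le> 1" and \<mu>: "\<mu> \<in> borel_prob_measures" and \<nu>: "\<nu> \<in> borel_prob_measures"
    and h [measurable]: "h \<in> borel_measurable borel"
    and I: "has_bochner_integral \<mu> h I" "has_bochner_integral \<nu> h J"
  shows "has_bochner_integral (mixture b \<mu> \<nu>) h (b * I + (1 - b) * J)"
proof -
  note nn = nn_integral_mixture[OF b \<mu> \<nu>]
  have i: "integrable \<mu> h" "integrable \<nu> h" using I by (auto simp: has_bochner_integral_iff)
  note fin = i[unfolded real_integrable_def]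
  have p: "(\<integral>\<^sup>+x. ennreal (h x) \<partial>mixture b \<mu> \<nu>) = ennreal b * (\<integral>\<^sup>+x. ennreal (h x) \<partial>\<mu>) + ennreal (1 - b) * (\<integral>\<^sup>+x. ennreal (h x) \<partial>\<nu>)"
    by (rule nn) measurable
  have m: "(\<integral>\<^sup>+x. ennreal (- h x) \<partial>mixture b \<mu> \<nu>) = ennreal b * (\<integral>\<^sup>+x. ennreal (- h x) \<partial>\<mu>) + ennreal (1 - b) * (\<integral>\<^sup>+x. ennreal (- h x) \<partial>\<nu>)"
    by (rule nn) measurable
  have real: "\<exists>A\<ge>0. X = ennreal A" if "X \<noteq> \<infinity>" for X
    using that by (cases X) auto
  obtain A where A: "(\<integral>\<^sup>+x. ennreal (h x) \<partial>\<mu>) = ennreal A" "0 \<le> A" using real fin by blast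
  obtain B where B: "(\<integral>\<^sup>+x. ennreal (- h x) \<partial>\<mu>) = ennreal B" "0 \<le> B" using real fin by blast
  obtain C where C: "(\<integral>\<^sup>+x. ennreal (h x) \<partial>\<nu>) = ennreal C" "0 \<le> C" using real fin by blast
  obtain D where D: "(\<integral>\<^sup>+x. ennreal (- h x) \<partial>\<nu>) = ennreal D" "0 \<le> D" using real fin by blast
  note ABCD = A(1) B(1) C(1) D(1) and nonneg = A(2) B(2) C(2) D(2)
  have IJ: "I = A - B" "J = C - D"
    using has_bochner_integral_integral_eq[OF I(1)] has_bochner_integral_integral_eq[OF I(2)]
    unfolding real_lebesgue_integral_def[OF i(1)] real_lebesgue_integral_def[OF i(2)] ABCD
    using nonneg by auto
  have p': "(\<integral>\<^sup>+x. ennreal (h x) \<partial>mixture b \<mu> \<nu>) = ennreal (b * A + (1 - b) * C)"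
    unfolding p ABCD using b nonneg by (simp add: ennreal_mult ennreal_plus)
  have m': "(\<integral>\<^sup>+x. ennreal (- h x) \<partial>mixture b \<mu> \<nu>) = ennreal (b * B + (1 - b) * D)"
    unfolding m ABCD using b nonneg by (simp add: ennreal_mult ennreal_plus)
  have int: "integrable (mixture b \<mu> \<nu>) h"
  proof -
    have "h \<in> borel_measurable (mixture b \<mu> \<nu>)"
      by (subst measurable_cong_sets[OF sets_mixture refl]) (rule h)
    then show ?thesis
      unfolding real_integrable_def p' m' by simp
  qed
  have "(\<integral>x. h x \<partial>mixture b \<mu> \<nu>) = (b * A + (1 - b) * C) - (b * B + (1 - b) * D)"
    unfolding real_lebesgue_integral_def[OF int] p' m'
    using b nonneg by (subst (1 2) enn2real_ennreal) auto
  also have "\<dots> = b * I + (1 - b) * J"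
    unfolding IJ by (simp add: algebra_simps)
  finally show ?thesis using int by (simp add: has_bochner_integral_iff)
qed

section \<open>Spheres as equilibrium measures\<close>

lemma riesz_profile_deriv:
  assumes "r > 0"
  shows "(riesz_profile s has_real_derivative - riesz_slope s * r powr (- s - 1)) (at r)"
proof (cases "s = 0")
  case True
  have "((\<lambda>r. - ln r) has_real_derivative - (1 / r)) (at r)"
    using assms by (auto intro!: derivative_eq_intros simp: divide_inverse)
  then show ?thesis
    using assms True by (simp add: riesz_profile_def[abs_def] riesz_slope_def powr_minus divide_inverse)
next
  case False
  have "((\<lambda>r. sgn s * r powr (- s)) has_real_derivative sgn s * (- s * r powr (- s - 1))) (at r)"
    using assms by (auto intro!: derivative_eq_intros)
  moreover have "sgn s * (- s * r powr (- s - 1)) = - riesz_slope s * r powr (- s - 1)"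
    using False by (simp add: riesz_slope_def abs_sgn)
  moreover have "riesz_profile s = (\<lambda>r. sgn s * r powr (- s))"
    using False by (simp add: fun_eq_iff riesz_profile_def)
  ultimately show ?thesis
    by (simp only:)
qed

text \<open>
  Young's inequality for \<open>t powr \<alpha>\<close> and \<open>1\<close> with the weights \<open>2 / \<alpha>\<close> and \<open>1 - 2 / \<alpha>\<close>.
\<close>

lemma young_square:
  fixes t \<alpha> :: real
  assumes "t \<ge> 0" "\<alpha> \<ge> 2"
  shows "t\<^sup>2 \<le> 2 / \<alpha> * t powr \<alpha> + (1 - 2 / \<alpha>)"
proof (cases "t = 0")
  case False
  then have t: "t > 0" using assms by simp
  have "(t powr \<alpha>) powr (2 / \<alpha>) * 1 powr (1 - 2 / \<alpha>) \<le> 2 / \<alpha> * t powr \<alpha> + (1 - 2 / \<alpha>) * 1"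
    by (rule Youngs_inequality_0) (use assms t in auto)
  moreover have "(t powr \<alpha>) powr (2 / \<alpha>) = t\<^sup>2"
    using assms t by (simp add: powr_powr powr_numeral)
  ultimately show ?thesis by simp
qed (use assms in simp)

text \<open>
  With \<open>u = ln t\<close> this follows from \<open>exp (- 2 * u) \<ge> 1 - 2 * u\<close> and \<open>exp (b * u) \<ge> 1 + b * u\<close>: the linear terms
  cancel.
\<close>

lemma power_mean_bound:
  fixes t a b :: real
  assumes t: "t \<ge> 1" and b: "0 < b" "b \<le> a"
  shows "b + 2 \<le> b * inverse (t\<^sup>2) + 2 * t powr a"
proof -
  define u where "u = ln t"
  have "exp (- (2 * u)) = inverse (t\<^sup>2)"
    using t by (simp add: u_def exp_minus exp_double)
  then have "1 - 2 * u \<le> inverse (t\<^sup>2)"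
    using exp_ge_add_one_self[of "- (2 * u)"] by simp
  then have "b * (1 - 2 * u) \<le> b * inverse (t\<^sup>2)"
    using b by (intro mult_left_mono) auto
  then have "b - 2 * (b * u) \<le> b * inverse (t\<^sup>2)"
    by (simp add: algebra_simps)
  moreover have "1 + b * u \<le> t powr b"
    using exp_ge_add_one_self[of "b * u"] t by (simp add: u_def powr_def)
  moreover have "t powr b \<le> t powr a"
    using t b by (intro powr_mono) auto
  ultimately show ?thesis by linarith
qed

text \<open>
  Outside the ball of radius \<open>R\<close> both kinds of equilibrium measures have a potential plus field of the form
  \<open>\<Psi>\<close>, with \<open>b = a\<close> for the mixture and \<open>b = s + 2\<close> for the sphere (where \<open>b \<le> a\<close> is the condition \<open>\<alpha> \<ge> 2\<close>). With
  \<open>t = r / R\<close> the derivative of \<open>\<Psi>\<close> is a positive multiple of \<open>b / t\<^sup>2 + 2 * t powr a - (b + 2)\<close>.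
\<close>

lemma outer_potential_monotone:
  fixes R \<rho> s \<alpha> a b \<gamma> :: real
  assumes s: "s > -2" and a: "a = \<alpha> + s" and b: "0 < b" "b \<le> a" and R: "0 < R" "R \<le> \<rho>"
    and \<gamma>: "\<gamma> * \<alpha> = 2 * riesz_slope s / ((b + 2) * R powr a)"
  defines "\<Psi> \<equiv> \<lambda>r. riesz_profile s r - riesz_slope s * b / ((s + 2) * (b + 2)) * R\<^sup>2 * r powr (- s - 2) + \<gamma> * r powr \<alpha>"
  shows "\<Psi> R \<le> \<Psi> \<rho>"
proof (rule DERIV_nonneg_imp_nondecreasing[OF R(2)])
  fix r assume "R \<le> r" "r \<le> \<rho>"
  then have r: "0 < r" "R \<le> r" using R by auto
  define c where "c = riesz_slope s"
  define P where "P = r powr (- s - 1)"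
  define t where "t = r / R"
  have t: "t \<ge> 1" using r R by (simp add: t_def)
  have c: "c > 0" by (simp add: c_def riesz_slope_pos)
  have e1: "r powr (- s - 2 - 1) = P * inverse (r\<^sup>2)"
    using r by (simp add: P_def powr_minus[symmetric] powr_add[symmetric] flip: powr_numeral)
  have e2: "r powr (\<alpha> - 1) = P * r powr a"
    using r by (simp add: P_def a powr_add[symmetric])
  have ta: "t powr a = r powr a / R powr a"
    using r R by (simp add: t_def powr_divide)
  have "(\<Psi> has_real_derivative - c * P - c * b / ((s + 2) * (b + 2)) * R\<^sup>2 * ((- s - 2) * r powr (- s - 2 - 1)) + \<gamma> * (\<alpha> * r powr (\<alpha> - 1))) (at r)"
    unfolding \<Psi>_def c_def P_def
    by (intro DERIV_add DERIV_diff DERIV_cmult riesz_profile_deriv has_real_derivative_powr r)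
  moreover have "- c * P - c * b / ((s + 2) * (b + 2)) * R\<^sup>2 * ((- s - 2) * r powr (- s - 2 - 1)) + \<gamma> * (\<alpha> * r powr (\<alpha> - 1))
    = P * c / (b + 2) * (b * inverse (t\<^sup>2) + 2 * t powr a - (b + 2))"
  proof -
    have "c * b / ((s + 2) * (b + 2)) * R\<^sup>2 * ((- s - 2) * r powr (- s - 2 - 1)) = - (P * c / (b + 2) * (b * inverse (t\<^sup>2)))"
    proof -
      have "w / k * Q * (- k * X) = - (w * Q * X)" if "k \<noteq> 0" for w k Q X :: real
        using that by simp
      from this[of "s + 2" "c * b / (b + 2)" "R\<^sup>2" "P * inverse (r\<^sup>2)"]
      have "c * b / ((s + 2) * (b + 2)) * R\<^sup>2 * ((- s - 2) * (P * inverse (r\<^sup>2))) = - (c * b / (b + 2) * R\<^sup>2 * (P * inverse (r\<^sup>2)))"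
        using s by (simp add: mult.commute[of "s + 2"])
      moreover have "inverse ((r / R)\<^sup>2) = R\<^sup>2 * inverse (r\<^sup>2)"
        by (simp add: power_divide field_simps)
      ultimately show ?thesis
        unfolding e1 t_def by (simp add: divide_inverse)
    qed
    moreover have "\<gamma> * (\<alpha> * r powr (\<alpha> - 1)) = P * c / (b + 2) * (2 * t powr a)"
      unfolding mult.assoc[symmetric] \<gamma> e2 ta c_def[symmetric] by simp
    moreover have "c * P = P * c / (b + 2) * (b + 2)"
      using b by simp
    ultimately show ?thesis by (simp only: right_diff_distrib distrib_left)
  qed
  moreover have "0 \<le> P * c / (b + 2) * (b * inverse (t\<^sup>2) + 2 * t powr a - (b + 2))"
    using power_mean_bound[OF t b] c b by (intro mult_nonneg_nonneg divide_nonneg_nonneg) (auto simp: P_def)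
  ultimately show "\<exists>y. (\<Psi> has_real_derivative y) (at r) \<and> 0 \<le> y"
    by (intro exI conjI) (assumption, linarith)
qed

text \<open>
  With \<open>u = max (norm x) (norm y)\<close> the distance is at most \<open>2 * u\<close>, and one of the two field terms is
  \<open>\<gamma> * u powr \<alpha>\<close>. So it suffices to bound a function of \<open>u\<close> from below. For \<open>s < 0\<close> the field
  dominates the kernel at infinity because \<open>\<alpha> > - s\<close>.
\<close>

lemma confinement:
  fixes \<gamma> \<alpha> s :: real
  assumes \<gamma>: "\<gamma> > 0" and \<alpha>: "\<alpha> > 0" and a: "\<alpha> + s > 0"
  obtains C where "C \<ge> 0" and
    "\<And>x y :: 'a::euclidean_space. x \<noteq> y \<or> s < 0 \<Longrightarrow>
       - C \<le> 2 * riesz_profile s (norm (x - y)) + \<gamma> * norm x powr \<alpha> + \<gamma> * norm y powr \<alpha>"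
proof -
  have "\<exists>C\<ge>0. \<forall>u\<ge>0. (u > 0 \<or> s < 0) \<longrightarrow> - C \<le> 2 * riesz_profile s (2 * u) + \<gamma> * u powr \<alpha>"
  proof (cases s "0::real" rule: linorder_cases)
    case greater
    then show ?thesis
      using \<gamma> by (intro exI[of _ 0]) (auto simp: riesz_profile_def)
  next
    case equal
    \<comment> \<open>The bound \<open>ln z \<le> z - 1\<close> is used for \<open>z = \<delta> * u powr \<alpha>\<close>, with \<open>\<delta>\<close> such that the powers of \<open>u\<close> cancel.\<close>
    define \<delta> where "\<delta> = \<gamma> * \<alpha> / 2"
    have \<delta>: "\<delta> > 0" using \<gamma> \<alpha> by (simp add: \<delta>_def)
    define C where "C = 2 * ln 2 - 2 / \<alpha> * (1 + ln \<delta>)"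
    have "- C \<le> 2 * riesz_profile s (2 * u) + \<gamma> * u powr \<alpha>" if u: "u > 0" for u
    proof -
      have "ln (\<delta> * u powr \<alpha>) \<le> \<delta> * u powr \<alpha> - 1"
        using u \<delta> by (intro ln_le_minus_one) auto
      then have "ln \<delta> + \<alpha> * ln u \<le> \<delta> * u powr \<alpha> - 1"
        using u \<delta> by (simp add: ln_mult ln_powr)
      then have "2 / \<alpha> * (ln \<delta> + \<alpha> * ln u) \<le> 2 / \<alpha> * (\<delta> * u powr \<alpha> - 1)"
        using \<alpha> by (intro mult_left_mono) auto
      moreover have "2 / \<alpha> * (ln \<delta> + \<alpha> * ln u) = 2 / \<alpha> * ln \<delta> + 2 * ln u"
        using \<alpha> by (simp add: field_simps)
      moreover have "2 / \<alpha> * (\<delta> * u powr \<alpha> - 1) = \<gamma> * u powr \<alpha> - 2 / \<alpha>"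
        using \<alpha> by (simp add: \<delta>_def field_simps)
      moreover have "2 * riesz_profile s (2 * u) = - 2 * ln 2 - 2 * ln u"
        using u equal by (simp add: riesz_profile_def ln_mult)
      moreover have "C = 2 * ln 2 - 2 / \<alpha> - 2 / \<alpha> * ln \<delta>"
        unfolding C_def distrib_left by simp
      ultimately show ?thesis by linarith
    qed
    then have *: "- max 0 C \<le> 2 * riesz_profile s (2 * u) + \<gamma> * u powr \<alpha>" if "u > 0" for u
      by (rule order_trans[rotated]) (use that in auto)
    show ?thesis
      using equal * by (intro exI[of _ "max 0 C"]) auto
  next
    case less
    define K where "K = 2 * 2 powr (- s)"
    have K: "K > 0" by (simp add: K_def)
    \<comment> \<open>Beyond \<open>u0\<close> the field is larger than the kernel; up to \<open>u0\<close> the kernel is bounded.\<close>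
    define u0 where "u0 = (K / \<gamma>) powr (1 / (\<alpha> + s))"
    have u0: "u0 > 0" "u0 powr (\<alpha> + s) = K / \<gamma>"
      using K \<gamma> a by (auto simp: u0_def powr_powr)
    have "- (K * u0 powr (- s)) \<le> 2 * riesz_profile s (2 * u) + \<gamma> * u powr \<alpha>" if u: "u \<ge> 0" for u
    proof -
      have k: "2 * riesz_profile s (2 * u) = - (K * u powr (- s))"
        using less u by (simp add: riesz_profile_def K_def powr_mult)
      show ?thesis
      proof (cases "u \<le> u0")
        case True
        then have "K * u powr (- s) \<le> K * u0 powr (- s)"
          using u less K by (intro mult_left_mono powr_mono2) auto
        moreover have "0 \<le> \<gamma> * u powr \<alpha>" using \<gamma> by simp
        ultimately show ?thesis unfolding k by linarith
      next
        case False
        then have "u0 powr (\<alpha> + s) \<le> u powr (\<alpha> + s)"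
          using u0 a by (intro powr_mono2) auto
        then have "K \<le> \<gamma> * u powr (\<alpha> + s)"
          using u0 \<gamma> by (simp add: field_simps)
        then have "K * u powr (- s) \<le> \<gamma> * u powr (\<alpha> + s) * u powr (- s)"
          by (intro mult_right_mono) auto
        also have "\<dots> = \<gamma> * u powr \<alpha>"
          using False u0 by (simp add: mult.assoc powr_add[symmetric])
        finally show ?thesis unfolding k using K u0 by (smt (verit) mult_nonneg_nonneg powr_ge_zero)
      qed
    qed
    then show ?thesis
      using K by (intro exI[of _ "K * u0 powr (- s)"]) auto
  qed
  then obtain C where C: "C \<ge> 0" "\<And>u. u \<ge> 0 \<Longrightarrow> u > 0 \<or> s < 0 \<Longrightarrow> - C \<le> 2 * riesz_profile s (2 * u) + \<gamma> * u powr \<alpha>"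
    by blast
  show ?thesis
  proof (rule that[OF C(1)])
    fix x y :: 'a assume xy: "x \<noteq> y \<or> s < 0"
    define u where "u = max (norm x) (norm y)"
    have u: "u \<ge> 0" "u > 0 \<or> s < 0"
      using xy norm_ge_zero[of x] by (auto simp: u_def less_max_iff_disj le_max_iff_disj)
    have le: "norm (x - y) \<le> 2 * u"
      using norm_triangle_ineq4[of x y] by (simp add: u_def max_def split: if_splits)
    have "riesz_profile s (2 * u) \<le> riesz_profile s (norm (x - y))"
      using xy le riesz_profile_antimono[of "norm (x - y)" "2 * u" s] riesz_profile_antimono_neg[of s "norm (x - y)" "2 * u"]
      by auto
    moreover have "\<gamma> * u powr \<alpha> \<le> \<gamma> * norm x powr \<alpha> + \<gamma> * norm y powr \<alpha>"
      using \<gamma> by (auto simp: u_def max_def)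
    ultimately show "- C \<le> 2 * riesz_profile s (norm (x - y)) + \<gamma> * norm x powr \<alpha> + \<gamma> * norm y powr \<alpha>"
      using C(2)[OF u] by linarith
  qed
qed

lemma power_field_integrable:
  fixes \<mu> :: "'a::euclidean_space measure"
  assumes \<mu>: "\<mu> \<in> borel_prob_measures" and R: "AE x in \<mu>. norm x \<le> R" and "\<gamma> > 0" "\<alpha> > 0"
  shows "integrable \<mu> (\<lambda>x. \<gamma> * norm x powr \<alpha>)"
proof -
  interpret prob_space \<mu> using \<mu> by (simp add: borel_prob_measures_def)
  have [measurable_cong]: "sets \<mu> = sets borel" using \<mu> by (simp add: borel_prob_measures_def)
  show ?thesis
  proof (rule integrable_const_bound[where B = "\<gamma> * R powr \<alpha>"])
    show "AE x in \<mu>. norm (\<gamma> * norm x powr \<alpha>) \<le> \<gamma> * R powr \<alpha>"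
      using R by eventually_elim (use assms in \<open>auto intro!: mult_left_mono powr_mono2\<close>)
  qed measurable
qed

text \<open>
  With \<open>t = norm x / R\<close>, the lemmas \<open>log_mean_inside\<close> and \<open>log_mean_outside\<close> say that the potential exceeds its value on
  the sphere by at least \<open>(1 - t\<^sup>2) / 4\<close>, on both sides of the sphere. By \<open>young_square\<close> the field exceeds its value there by at
  least \<open>(t\<^sup>2 - 1) / 4\<close>.
\<close>

lemma sphere_equilibrium_log:
  fixes V :: "'a::euclidean_space \<Rightarrow> real"
  assumes dim4: "DIM('a) \<ge> 4" and \<gamma>: "\<gamma> > 0" and \<alpha>: "\<alpha> \<ge> 2"
    and V: "V = (\<lambda>x. \<gamma> * norm x powr \<alpha>)"
  shows "is_equilibrium_measure 0 V (sphere_uniform ((1 / (2 * \<gamma> * \<alpha>)) powr (1 / \<alpha>)))"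
proof -
  define R where "R = (1 / (2 * \<gamma> * \<alpha>)) powr (1 / \<alpha>)"
  have R: "R > 0" and R\<alpha>: "R powr \<alpha> = 1 / (2 * \<gamma> * \<alpha>)"
    using \<gamma> \<alpha> by (auto simp: R_def powr_powr)
  have dim3: "DIM('a) \<ge> 3" using dim4 by simp
  interpret latitude_law "latitude TYPE('a)" "DIM('a)"
    by (rule latitude_law_sphere[OF dim3])
  let ?U = "\<lambda>x :: 'a. \<integral>y. riesz_profile 0 (norm (x - y)) \<partial>sphere_uniform R"
  define M m where "M x = max R (norm x)" and "m x = min R (norm x)" for x :: 'a
  have M: "M x > 0" "0 \<le> m x / M x" "m x / M x \<le> 1" for x
    using R by (auto simp: M_def m_def)
  note sp = sphere_potential[OF R dim3, of 0, folded M_def m_def, OF log_mean_integrable[OF M(2,3) dim4]]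
  have U: "?U x = profile_mean 0 (m x / M x) - ln (M x)" for x
    using sp(2)[of x] by simp
  define c where "c = profile_mean 0 1 - ln R + \<gamma> * R powr \<alpha>"
  have Rg: "\<gamma> * R powr \<alpha> = 1 / (2 * \<alpha>)"
    using \<gamma> \<alpha> by (simp add: R\<alpha>)
  have young: "1 / (2 * \<alpha>) + (t\<^sup>2 - 1) / 4 \<le> t powr \<alpha> / (2 * \<alpha>)" if "t \<ge> 0" for t
  proof -
    have "t powr \<alpha> / (2 * \<alpha>) = (2 / \<alpha> * t powr \<alpha>) / 4" "1 / (2 * \<alpha>) = (2 / \<alpha>) / 4"
      using \<alpha> by (auto simp: field_simps)
    then show ?thesis
      using young_square[OF that \<alpha>] by (simp add: field_simps)
  qed
  have pm_neg: "profile_mean 0 t \<le> 0" if "0 \<le> t" "t \<le> 1" for t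
  proof (cases "t = 1")
    case True
    have "profile_mean 0 1 + 1 / 4 \<le> profile_mean 0 0 + 0\<^sup>2 / 4"
      by (rule log_mean_inside[OF _ _ dim4]) auto
    then show ?thesis using True by (simp add: profile_mean_0 riesz_profile_def)
  next
    case False
    then show ?thesis using that log_mean_le[of t, OF _ _ dim4] by simp
  qed
  obtain C where C: "C \<ge> 0" "\<And>x y :: 'a. x \<noteq> y \<or> (0::real) < 0 \<Longrightarrow> - C \<le> 2 * riesz_profile 0 (norm (x - y)) + \<gamma> * norm x powr \<alpha> + \<gamma> * norm y powr \<alpha>"
    by (rule confinement[of \<gamma> \<alpha> 0]) (use \<gamma> \<alpha> in auto)
  have sphere: "AE x in sphere_uniform R. norm (x :: 'a) = R"
    by (rule AE_sphere_uniform[OF R])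
  show ?thesis
    unfolding R_def[symmetric]
  proof (rule equilibrium_criterion[where C = C and B = "- ln R" and c = c])
    show "V \<in> borel_measurable borel" unfolding V by measurable
    show "V x \<ge> 0" for x unfolding V using \<gamma> by simp
    show "- C \<le> 2 * riesz_profile 0 (norm (x - y)) + V x + V y" if "x \<noteq> y \<or> (0::real) < 0" for x y
      unfolding V by (rule C(2)[OF that])
    show "sphere_uniform R \<in> borel_prob_measures" by (rule sphere_uniform_borel_prob)
    show "AE y in sphere_uniform R. x \<noteq> y" for x :: 'a
      by (rule sphere_uniform_no_atom) (use dim4 R in auto)
    show "integrable (sphere_uniform R) V"
      unfolding V
    proof (rule power_field_integrable[OF sphere_uniform_borel_prob])
      show "AE x in sphere_uniform R. norm (x :: 'a) \<le> R"
        using sphere by eventually_elim simp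
    qed (use \<gamma> \<alpha> in auto)
    show "integrable (sphere_uniform R) (\<lambda>y. riesz_profile 0 (norm (x - y)))" for x :: 'a
      by (rule sp(1))
    show "?U x \<le> - ln R" for x
    proof -
      have "ln R \<le> ln (M x)" using R by (simp add: M_def)
      then show ?thesis unfolding U using pm_neg[OF M(2,3)[of x]] by linarith
    qed
    show "AE x in sphere_uniform R. ?U x + V x = c"
      using sphere
    proof eventually_elim
      case (elim x)
      then show ?case unfolding U V using R by (simp add: M_def m_def c_def)
    qed
    show "c \<le> ?U x + V x" for x
    proof (cases "norm x \<le> R")
      case True
      define t where "t = norm x / R"
      have t: "0 \<le> t" "t \<le> 1" using True R by (auto simp: t_def)
      have "V x = (\<gamma> * R powr \<alpha>) * t powr \<alpha>"
        unfolding V t_def using R by (simp add: powr_divide)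
      then have Vx: "V x = t powr \<alpha> / (2 * \<alpha>)" unfolding Rg by simp
      have "m x / M x = t" "M x = R" using True by (auto simp: M_def m_def t_def)
      then have Ux: "?U x = profile_mean 0 t - ln R" unfolding U by simp
      show ?thesis
        unfolding Ux Vx c_def Rg using young[OF t(1)] log_mean_inside[OF t dim4] by argo
    next
      case False
      define t where "t = R / norm x"
      have x: "norm x > 0" using False R by linarith
      have t: "0 < t" "t \<le> 1" using False R x by (auto simp: t_def)
      have nx: "norm x = R * inverse t" using x R by (simp add: t_def)
      have "V x = (\<gamma> * R powr \<alpha>) * inverse t powr \<alpha>"
        unfolding V nx using R t by (simp add: powr_mult)
      then have Vx: "V x = inverse t powr \<alpha> / (2 * \<alpha>)" unfolding Rg by simp
      have "m x / M x = t" "M x = norm x" using False by (auto simp: M_def m_def t_def)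
      moreover have "ln (norm x) = ln R - ln t"
        unfolding nx using R t by (simp add: ln_mult ln_inverse)
      ultimately have Ux: "?U x = profile_mean 0 t - (ln R - ln t)" unfolding U by simp
      have "1 / (2 * \<alpha>) + (inverse t ^ 2 - 1) / 4 \<le> inverse t powr \<alpha> / (2 * \<alpha>)"
        by (rule young) (use t in simp)
      then show ?thesis
        unfolding Ux Vx c_def Rg using log_mean_outside[OF t dim4] by argo
    qed
  qed (use C in auto)
qed

text \<open>
  Inside the sphere \<open>U + V\<close> equals \<open>riesz_profile s R + K * (2 / \<alpha> * t powr \<alpha> - t\<^sup>2)\<close> with \<open>t = norm x / R\<close>, for a constant
  \<open>K \<ge> 0\<close> and the given \<open>R\<close>. By \<open>young_square\<close> this is smallest at \<open>t = 1\<close>.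
\<close>

lemma sphere_equilibrium_biharmonic:
  fixes V :: "'a::euclidean_space \<Rightarrow> real"
  assumes dim: "DIM('a) \<ge> 3" and s: "s = real DIM('a) - 4" and \<gamma>: "\<gamma> > 0" and \<alpha>: "\<alpha> \<ge> 2"
    and V: "V = (\<lambda>x. \<gamma> * norm x powr \<alpha>)"
  shows "is_equilibrium_measure s V (sphere_uniform (sphere_radius s \<gamma> \<alpha>))"
proof -
  define R where "R = sphere_radius s \<gamma> \<alpha>"
  define c where "c = riesz_slope s"
  define a where "a = \<alpha> + s"
  have s1: "s \<ge> -1" using s dim by simp
  then have a: "a > 0" using \<alpha> by (simp add: a_def)
  have c: "c > 0" by (simp add: c_def riesz_slope_pos)
  have R_eq: "R = (2 * c / ((s + 4) * \<gamma> * \<alpha>)) powr (1 / a)"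
    by (simp add: R_def sphere_radius_def c_def riesz_slope_def a_def ac_simps)
  have R: "R > 0" and Ra: "R powr a = 2 * c / ((s + 4) * \<gamma> * \<alpha>)"
    using \<gamma> \<alpha> c s1 a by (auto simp: R_eq powr_powr)
  have \<gamma>\<alpha>: "\<gamma> * \<alpha> = 2 * c / ((s + 2 + 2) * R powr a)"
  proof -
    have "\<gamma> * \<alpha> = 2 * c / (q * (2 * c / (q * \<gamma> * \<alpha>)))" if "q > 0" for q
      using c \<gamma> \<alpha> that by (simp add: field_simps)
    from this[of "s + 4"] show ?thesis
      unfolding Ra using s1 by (simp add: add.assoc)
  qed
  let ?U = "\<lambda>x :: 'a. \<integral>y. riesz_profile s (norm (x - y)) \<partial>sphere_uniform R"
  note sp = sphere_potential_biharmonic[OF R dim s, folded c_def]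
  have U_in: "?U x = riesz_profile s R - c / (s + 4) * (norm x)\<^sup>2 * R powr (- s - 2)" if "norm x \<le> R" for x :: 'a
    unfolding sp(2) using that by (simp add: max_absorb1 min_absorb2)
  have U_out: "?U x = riesz_profile s (norm x) - c / (s + 4) * R\<^sup>2 * norm x powr (- s - 2)" if "R \<le> norm x" for x :: 'a
    unfolding sp(2) using that by (simp add: max_absorb2 min_absorb1)
  define c0 where "c0 = riesz_profile s R - c / (s + 4) * R\<^sup>2 * R powr (- s - 2) + \<gamma> * R powr \<alpha>"
  obtain C where C: "C \<ge> 0" "\<And>x y :: 'a. x \<noteq> y \<or> s < 0 \<Longrightarrow> - C \<le> 2 * riesz_profile s (norm (x - y)) + \<gamma> * norm x powr \<alpha> + \<gamma> * norm y powr \<alpha>"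
    by (rule confinement[of \<gamma> \<alpha> s]) (use \<gamma> \<alpha> a in \<open>auto simp: a_def\<close>)
  have sphere: "AE x in sphere_uniform R. norm (x :: 'a) = R"
    by (rule AE_sphere_uniform[OF R])
  show ?thesis
    unfolding R_def[symmetric]
  proof (rule equilibrium_criterion[where C = C and B = "riesz_profile s R" and c = c0])
    show "V \<in> borel_measurable borel" unfolding V by measurable
    show "V x \<ge> 0" for x unfolding V using \<gamma> by simp
    show "- C \<le> 2 * riesz_profile s (norm (x - y)) + V x + V y" if "x \<noteq> y \<or> s < 0" for x y
      unfolding V by (rule C(2)[OF that])
    show "sphere_uniform R \<in> borel_prob_measures" by (rule sphere_uniform_borel_prob)
    show "AE y in sphere_uniform R. x \<noteq> y" for x :: 'a
      by (rule sphere_uniform_no_atom) (use dim R in auto)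
    show "integrable (sphere_uniform R) V"
      unfolding V
    proof (rule power_field_integrable[OF sphere_uniform_borel_prob])
      show "AE x in sphere_uniform R. norm (x :: 'a) \<le> R"
        using sphere by eventually_elim simp
    qed (use \<gamma> \<alpha> in auto)
    show "integrable (sphere_uniform R) (\<lambda>y. riesz_profile s (norm (x - y)))" for x :: 'a
      by (rule sp(1))
    show "?U x \<le> riesz_profile s R" for x
    proof (cases "norm x \<le> R")
      case True
      have "0 \<le> c / (s + 4) * (norm x)\<^sup>2 * R powr (- s - 2)"
        using c s1 by simp
      then show ?thesis unfolding U_in[OF True] by linarith
    next
      case False
      then have x: "R \<le> norm x" by simp
      have "0 \<le> c / (s + 4) * R\<^sup>2 * norm x powr (- s - 2)"
        using c s1 by simp
      then show ?thesis
        unfolding U_out[OF x] using riesz_profile_antimono[OF R x, of s] by linarith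
    qed
    show "AE x in sphere_uniform R. ?U x + V x = c0"
      using sphere
    proof eventually_elim
      case (elim x)
      then show ?case using U_out[of x] by (simp add: c0_def V)
    qed
    show "c0 \<le> ?U x + V x" for x
    proof (cases "norm x \<le> R")
      case True
      define t where "t = norm x / R"
      define K where "K = c / (s + 4) * R\<^sup>2 * R powr (- s - 2)"
      have K: "K \<ge> 0" using c s1 by (simp add: K_def)
      have t: "0 \<le> t" "norm x = t * R" using R by (auto simp: t_def)
      have R\<alpha>: "\<gamma> * R powr \<alpha> = 2 / \<alpha> * K"
      proof -
        have "R powr \<alpha> = R powr a * (R\<^sup>2 * R powr (- s - 2))"
          using R by (simp add: a_def powr_add[symmetric] flip: powr_numeral)
        then have "\<gamma> * R powr \<alpha> = \<gamma> * R powr a * (R\<^sup>2 * R powr (- s - 2))"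
          by simp
        also have "\<gamma> * R powr a = 2 / \<alpha> * (c / (s + 4))"
        proof -
          have "\<gamma> * (2 * c / (q * \<gamma> * \<alpha>)) = 2 / \<alpha> * (c / q)" if "q > 0" for q
            using \<gamma> \<alpha> that by (simp add: field_simps)
          from this[of "s + 4"] show ?thesis unfolding Ra using s1 by simp
        qed
        finally show ?thesis by (simp add: K_def)
      qed
      have "?U x + V x = riesz_profile s R + K * (2 / \<alpha> * t powr \<alpha> - t\<^sup>2)"
      proof -
        have "V x = (\<gamma> * R powr \<alpha>) * t powr \<alpha>"
          unfolding V t(2) using t(1) R by (simp add: powr_mult)
        moreover have "c / (s + 4) * (norm x)\<^sup>2 * R powr (- s - 2) = K * t\<^sup>2"
          unfolding t(2) K_def by (simp add: power_mult_distrib)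
        ultimately show ?thesis
          unfolding U_in[OF True] R\<alpha> by (simp add: algebra_simps)
      qed
      moreover have "K * (2 / \<alpha> - 1) \<le> K * (2 / \<alpha> * t powr \<alpha> - t\<^sup>2)"
        using young_square[OF t(1) \<alpha>] by (intro mult_left_mono K) linarith
      moreover have "c0 = riesz_profile s R + K * (2 / \<alpha> - 1)"
        unfolding c0_def R\<alpha> K_def[symmetric] by (simp add: algebra_simps)
      ultimately show ?thesis by linarith
    next
      case False
      then have x: "R \<le> norm x" by simp
      have "c * (s + 2) / ((s + 2) * (s + 2 + 2)) = c / (s + 4)"
        using s1 by simp
      with outer_potential_monotone[of s a \<alpha> "s + 2" R "norm x" \<gamma>] s1 \<alpha> R x \<gamma>\<alpha>
      show ?thesis
        unfolding U_out[OF x] V c0_def by (simp add: a_def c_def add.commute[of 4 s])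
    qed
  qed (use C s1 in auto)
qed

section \<open>The potential of the radial density on the ball\<close>

text \<open>
  The potential at distance \<open>\<rho>\<close> from the origin of the uniform measure on the sphere of radius \<open>r\<close>, for \<open>s\<close> equal to the
  dimension minus \<open>4\<close>; see \<open>sphere_potential_biharmonic\<close>.
\<close>

definition sphere_mean_profile :: "real \<Rightarrow> real \<Rightarrow> real \<Rightarrow> real" where
  "sphere_mean_profile s \<rho> r =
     riesz_profile s (max r \<rho>) - riesz_slope s / (s + 4) * (min r \<rho>)\<^sup>2 * max r \<rho> powr (- s - 2)"

lemma sphere_mean_profile_measurable [measurable]: "sphere_mean_profile s \<rho> \<in> borel_measurable borel"
  unfolding sphere_mean_profile_def by measurable

lemma inner_radial_integral:
  assumes a: "a > 0" and u: "0 \<le> u" "u \<le> \<rho>"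
  shows "((\<lambda>r. a * r powr (a - 1) * sphere_mean_profile s \<rho> r) has_integral
     (riesz_profile s \<rho> * u powr a - riesz_slope s / (s + 4) * \<rho> powr (- s - 2) * (a / (a + 2)) * u powr (a + 2))) {0..u}"
proof -
  define K where "K = riesz_slope s / (s + 4) * \<rho> powr (- s - 2)"
  define F where "F r = riesz_profile s \<rho> * r powr a - K * (a / (a + 2)) * r powr (a + 2)" for r
  have "((\<lambda>r. a * r powr (a - 1) * sphere_mean_profile s \<rho> r) has_integral (F u - F 0)) {0..u}"
  proof (rule fundamental_theorem_of_calculus_interior[OF u(1)])
    show "continuous_on {0..u} F"
      unfolding F_def using a by (intro continuous_intros continuous_on_powr') auto
    fix r assume "r \<in> {0<..<u}"
    then have r: "0 < r" "r < \<rho>" using u by auto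
    have "(F has_real_derivative riesz_profile s \<rho> * (a * r powr (a - 1)) - K * (a / (a + 2)) * ((a + 2) * r powr (a + 2 - 1))) (at r)"
      unfolding F_def by (intro DERIV_diff DERIV_cmult has_real_derivative_powr r)
    moreover have "riesz_profile s \<rho> * (a * r powr (a - 1)) - K * (a / (a + 2)) * ((a + 2) * r powr (a + 2 - 1))
      = a * r powr (a - 1) * sphere_mean_profile s \<rho> r"
    proof -
      have "r powr (a + 2 - 1) = r powr (a - 1) * r\<^sup>2"
        using r by (simp add: powr_add[symmetric] flip: powr_numeral)
      moreover have "sphere_mean_profile s \<rho> r = riesz_profile s \<rho> - K * r\<^sup>2"
        using r by (simp add: sphere_mean_profile_def K_def max_def min_def)
      moreover have "K * (a / (a + 2)) * ((a + 2) * X) = K * a * X" for X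
        using a by simp
      ultimately have "riesz_profile s \<rho> * (a * r powr (a - 1)) - K * (a / (a + 2)) * ((a + 2) * r powr (a + 2 - 1))
        = riesz_profile s \<rho> * (a * r powr (a - 1)) - K * a * (r powr (a - 1) * r\<^sup>2)"
        and "sphere_mean_profile s \<rho> r = riesz_profile s \<rho> - K * r\<^sup>2"
        by (simp_all only:)
      then show ?thesis by (simp only:) (simp add: algebra_simps)
    qed
    ultimately show "(F has_vector_derivative a * r powr (a - 1) * sphere_mean_profile s \<rho> r) (at r)"
      by (simp add: has_real_derivative_iff_has_vector_derivative)
  qed
  then show ?thesis by (simp add: F_def K_def)
qed

text \<open>
  At the origin the kernel may be infinite, but \<open>r powr s * riesz_profile s r\<close> is constant or logarithmic, and the remaining
  factor \<open>r powr \<alpha>\<close> tends to \<open>0\<close>.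
\<close>

lemma continuous_on_powr_times_profile:
  assumes a: "\<alpha> + s > 0" and \<alpha>: "\<alpha> > 0"
  shows "continuous_on {0..} (\<lambda>r. r powr (\<alpha> + s) * riesz_profile s r)"
proof (cases "s = 0")
  case False
  have eq: "r powr (\<alpha> + s) * riesz_profile s r = sgn s * r powr \<alpha>" if "r \<in> {0..}" for r
    using that False by (cases "r = 0") (auto simp: riesz_profile_def powr_add[symmetric])
  have "continuous_on {0..} (\<lambda>r. sgn s * r powr \<alpha>)"
    using \<alpha> by (intro continuous_intros continuous_on_powr') auto
  then show ?thesis by (rule continuous_on_eq) (rule eq[symmetric])
next
  case True
  show ?thesis
    unfolding continuous_on_eq_continuous_within
  proof
    fix r :: real assume r: "r \<in> {0..}"
    show "continuous (at r within {0..}) (\<lambda>r. r powr (\<alpha> + s) * riesz_profile s r)"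
    proof (cases "r = 0")
      case r0: True
      have "((\<lambda>r::real. r powr \<alpha> * - ln r) \<longlongrightarrow> 0) (at_right 0)"
        using \<alpha> by real_asymp
      then show ?thesis
        using True r0 by (simp add: continuous_within at_within_Ici_at_right riesz_profile_def)
    next
      case False
      then have "r > 0" using r by simp
      then have "isCont (\<lambda>r. r powr (\<alpha> + s) * riesz_profile s r) r"
        by (intro continuous_intros DERIV_isCont[OF riesz_profile_deriv]) auto
      then show ?thesis by (rule continuous_at_imp_continuous_within)
    qed
  qed
qed

text \<open>
  The first two terms of \<open>F\<close> arise by partial integration of \<open>a * r powr (a - 1) * riesz_profile s r\<close>. For \<open>\<rho> = 0\<close> the last term,
  which is singular at \<open>r = 0\<close> if \<open>\<alpha> < 2\<close>, has the coefficient \<open>\<rho>\<^sup>2 = 0\<close>.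
\<close>

lemma outer_radial_integral:
  assumes a: "a = \<alpha> + s" "a > 0" and \<alpha>: "\<alpha> > 0" "\<alpha> \<noteq> 2" and \<rho>: "0 \<le> \<rho>" "\<rho> \<le> R"
  defines "F \<equiv> \<lambda>r. r powr a * riesz_profile s r + riesz_slope s / \<alpha> * r powr \<alpha>
       - riesz_slope s / (s + 4) * \<rho>\<^sup>2 * (a / (\<alpha> - 2)) * r powr (\<alpha> - 2)"
  shows "((\<lambda>r. a * r powr (a - 1) * sphere_mean_profile s \<rho> r) has_integral (F R - F \<rho>)) {\<rho>..R}"
proof (rule fundamental_theorem_of_calculus_interior[OF \<rho>(2)])
  have c1: "continuous_on {\<rho>..R} (\<lambda>r. r powr a * riesz_profile s r)"
    unfolding a(1) using a \<alpha> \<rho> by (intro continuous_on_subset[OF continuous_on_powr_times_profile]) auto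
  have c2: "continuous_on {\<rho>..R} (\<lambda>r. riesz_slope s / \<alpha> * r powr \<alpha>)"
    using \<alpha> \<rho> by (intro continuous_on_mult_left continuous_on_powr' continuous_intros) auto
  have c3: "continuous_on {\<rho>..R} (\<lambda>r. riesz_slope s / (s + 4) * \<rho>\<^sup>2 * (a / (\<alpha> - 2)) * r powr (\<alpha> - 2))"
  proof (cases "\<rho> = 0")
    case False
    then show ?thesis using \<rho> by (intro continuous_on_mult_left continuous_on_powr' continuous_intros) auto
  qed simp
  show "continuous_on {\<rho>..R} F"
    unfolding F_def by (intro continuous_on_diff continuous_on_add c1 c2 c3)
  fix r assume "r \<in> {\<rho><..<R}"
  then have r: "0 < r" "\<rho> < r" using \<rho> by auto
  define c K where "c = riesz_slope s" and "K = c / (s + 4) * \<rho>\<^sup>2"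
  define P where "P = r powr (a - 1)"
  have "((\<lambda>r. r powr a * riesz_profile s r) has_real_derivative
      (a * r powr (a - 1)) * riesz_profile s r + (- c * r powr (- s - 1)) * r powr a) (at r)"
    unfolding c_def by (intro DERIV_mult has_real_derivative_powr riesz_profile_deriv r)
  then have "(F has_real_derivative ((a * r powr (a - 1)) * riesz_profile s r + (- c * r powr (- s - 1)) * r powr a)
      + c / \<alpha> * (\<alpha> * r powr (\<alpha> - 1)) - K * (a / (\<alpha> - 2)) * ((\<alpha> - 2) * r powr (\<alpha> - 2 - 1))) (at r)"
    unfolding F_def K_def c_def[symmetric]
    by (intro DERIV_diff DERIV_add DERIV_cmult has_real_derivative_powr r)
  moreover have "((a * r powr (a - 1)) * riesz_profile s r + (- c * r powr (- s - 1)) * r powr a)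
      + c / \<alpha> * (\<alpha> * r powr (\<alpha> - 1)) - K * (a / (\<alpha> - 2)) * ((\<alpha> - 2) * r powr (\<alpha> - 2 - 1))
    = a * r powr (a - 1) * sphere_mean_profile s \<rho> r"
  proof -
    define k Z where "k = riesz_profile s r" and "Z = r powr (- s - 2)"
    have "(- c * r powr (- s - 1)) * r powr a = - (c * r powr (\<alpha> - 1))"
      using r a by (simp add: powr_add[symmetric])
    moreover have "c / \<alpha> * (\<alpha> * X) = c * X" "K * (a / (\<alpha> - 2)) * ((\<alpha> - 2) * X) = K * a * X" for X
      using \<alpha> by simp_all
    moreover have "r powr (\<alpha> - 2 - 1) = P * Z"
      using r a by (simp add: P_def Z_def powr_add[symmetric])
    ultimately have "((a * P) * k + (- c * r powr (- s - 1)) * r powr a)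
        + c / \<alpha> * (\<alpha> * r powr (\<alpha> - 1)) - K * (a / (\<alpha> - 2)) * ((\<alpha> - 2) * r powr (\<alpha> - 2 - 1))
      = (a * P) * k + - (c * r powr (\<alpha> - 1)) + c * r powr (\<alpha> - 1) - K * a * (P * Z)"
      by (simp only:)
    also have "\<dots> = a * P * (k - K * Z)"
      by (simp add: algebra_simps)
    also have "k - K * Z = sphere_mean_profile s \<rho> r"
      using r by (simp add: sphere_mean_profile_def K_def k_def Z_def c_def max_def min_def)
    finally show ?thesis by (simp only: P_def k_def)
  qed
  ultimately show "(F has_vector_derivative a * r powr (a - 1) * sphere_mean_profile s \<rho> r) (at r)"
    by (simp add: has_real_derivative_iff_has_vector_derivative)
qed

lemma radial_density_borel_prob:
  assumes R: "R > 0" and s: "s = real DIM('a) - 4" and a: "\<alpha> + s > 0"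
  shows "density lborel (\<lambda>x :: 'a::euclidean_space. ennreal (radial_density s \<alpha> R x)) \<in> borel_prob_measures"
proof -
  interpret S: prob_space "sphere_uniform r :: 'a measure" for r by (rule prob_space_sphere_uniform)
  let ?a = "\<alpha> + s"
  have hI: "((\<lambda>r. r powr (?a - 1)) has_integral (R powr (?a - 1 + 1) / (?a - 1 + 1))) {0..R}"
    by (rule has_integral_powr_from_0) (use R a in auto)
  have "((\<lambda>r. ?a * r powr (?a - 1)) has_integral R powr ?a) {0..R}"
    using has_integral_mult_right[OF hI, of ?a] a by simp
  then have "has_bochner_integral lborel (\<lambda>r. radial_weight ?a R r * 1) (R powr ?a / R powr ?a)"
    by (intro has_bochner_integral_radial_weight) (use R a in auto)
  moreover have "R powr ?a / R powr ?a = 1" using R by simp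
  ultimately have "has_bochner_integral lborel (\<lambda>r. radial_weight ?a R r) 1"
    by (simp only: mult_1_right)
  then have I: "integrable lborel (radial_weight ?a R)" "(\<integral>r. radial_weight ?a R r \<partial>lborel) = 1"
    by (simp_all only: has_bochner_integral_iff)
  let ?\<mu> = "density lborel (\<lambda>x :: 'a. ennreal (radial_density s \<alpha> R x))"
  have "emeasure ?\<mu> (space ?\<mu>) = (\<integral>\<^sup>+x. 1 \<partial>?\<mu>)"
    by simp
  also have "\<dots> = (\<integral>\<^sup>+r. ennreal (radial_weight ?a R r) * (\<integral>\<^sup>+y. 1 \<partial>(sphere_uniform r :: 'a measure)) \<partial>lborel)"
    by (rule nn_integral_radial_density[OF _ R s a]) simp
  also have "\<dots> = (\<integral>\<^sup>+r. ennreal (radial_weight ?a R r) \<partial>lborel)"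
    by (simp add: S.emeasure_space_1)
  also have "\<dots> = ennreal (\<integral>r. radial_weight ?a R r \<partial>lborel)"
    by (rule nn_integral_eq_integral[OF I(1)]) (use a in \<open>auto simp: radial_weight_def\<close>)
  also have "\<dots> = 1"
    by (simp only: I(2) ennreal_1)
  finally have "prob_space ?\<mu>" by (rule prob_spaceI)
  then show ?thesis by (simp add: borel_prob_measures_def)
qed

lemma AE_radial_density:
  fixes x :: "'a::euclidean_space"
  shows "AE y in density lborel (\<lambda>y :: 'a. ennreal (radial_density s \<alpha> R y)). norm y \<le> R \<and> y \<noteq> x"
proof (subst AE_density)
  show "AE y in lborel. 0 < ennreal (radial_density s \<alpha> R y) \<longrightarrow> norm y \<le> R \<and> y \<noteq> x"
    using AE_lborel_singleton[of x]
    by eventually_elim (auto simp: radial_density_def indicator_def split: if_splits)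
qed measurable

text \<open>
  The measure on the ball is an average of uniform measures on spheres of radius \<open>r \<le> R\<close>. The formula for averages is available for
  nonnegative functions, so the lower bound \<open>riesz_profile s (R + norm x)\<close> of the kernel is subtracted first.
\<close>

lemma ball_potential:
  fixes x :: "'a::euclidean_space"
  assumes R: "R > 0" and dim: "DIM('a) \<ge> 3" and s: "s = real DIM('a) - 4" and a: "\<alpha> + s > 0"
    and I: "((\<lambda>r. (\<alpha> + s) * r powr (\<alpha> + s - 1) * sphere_mean_profile s (norm x) r) has_integral I) {0..R}"
  shows "has_bochner_integral (density lborel (\<lambda>x :: 'a. ennreal (radial_density s \<alpha> R x)))
     (\<lambda>y. riesz_profile s (norm (x - y))) (I / R powr (\<alpha> + s))"
proof -
  let ?a = "\<alpha> + s" and ?\<mu> = "density lborel (\<lambda>x :: 'a. ennreal (radial_density s \<alpha> R x))"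
  interpret P: prob_space ?\<mu>
    using radial_density_borel_prob[OF R s a] by (simp add: borel_prob_measures_def)
  interpret S: prob_space "sphere_uniform r :: 'a measure" for r by (rule prob_space_sphere_uniform)
  define l where "l = riesz_profile s (R + norm x)"
  let ?h = "\<lambda>y. riesz_profile s (norm (x - y)) - l"
  have low: "0 \<le> ?h y" if "norm y \<le> R" "y \<noteq> x" for y
    using that norm_triangle_ineq4[of x y] unfolding l_def
    by (simp, intro riesz_profile_antimono) auto
  have lower: "AE y in sphere_uniform r. 0 \<le> ?h y" if r: "0 < r" "r \<le> R" for r
  proof -
    have "AE y in sphere_uniform r. x \<noteq> y"
      by (rule sphere_uniform_no_atom) (use dim r in auto)
    then show ?thesis
      using AE_sphere_uniform[OF r(1), where 'a = 'a]
    proof eventually_elim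
      case (elim y)
      then show ?case using r by (intro low) auto
    qed
  qed
  have pot: "integrable (sphere_uniform r) (\<lambda>y. riesz_profile s (norm (x - y)))"
    "(\<integral>y. riesz_profile s (norm (x - y)) \<partial>sphere_uniform r) = sphere_mean_profile s (norm x) r" if r: "0 < r" for r
    using sphere_potential_biharmonic[OF r dim s, of x] by (simp_all add: sphere_mean_profile_def)
  have hint: "integrable (sphere_uniform r) ?h" "(\<integral>y. ?h y \<partial>sphere_uniform r) = sphere_mean_profile s (norm x) r - l" if r: "0 < r" for r
    using pot[OF r] by (simp_all add: S.prob_space)
  let ?W = "\<lambda>r. \<integral>y. ?h y \<partial>sphere_uniform r"
  have hI: "((\<lambda>r. r powr (?a - 1)) has_integral (R powr (?a - 1 + 1) / (?a - 1 + 1))) {0..R}"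
    by (rule has_integral_powr_from_0) (use R a in auto)
  have "((\<lambda>r. (?a * l) * r powr (?a - 1)) has_integral (l * R powr ?a)) {0..R}"
    using has_integral_mult_right[OF hI, of "?a * l"] a by simp
  from has_integral_diff[OF I this]
  have qI: "((\<lambda>r. ?a * r powr (?a - 1) * sphere_mean_profile s (norm x) r - (?a * l) * r powr (?a - 1)) has_integral (I - l * R powr ?a)) {0..R}" .
  have "has_bochner_integral lborel (\<lambda>r. radial_weight ?a R r * ?W r) ((I - l * R powr ?a) / R powr ?a)"
  proof (rule has_bochner_integral_radial_weight[OF R a qI])
    show "(\<lambda>r. ?a * r powr (?a - 1) * sphere_mean_profile s (norm x) r - (?a * l) * r powr (?a - 1)) \<in> borel_measurable borel"
      by measurable
    fix r assume r: "0 < r" "r \<le> R"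
    show "?a * r powr (?a - 1) * sphere_mean_profile s (norm x) r - (?a * l) * r powr (?a - 1) = ?a * r powr (?a - 1) * ?W r"
      unfolding hint(2)[OF r(1)] by (simp add: algebra_simps)
    show "0 \<le> ?W r" by (rule integral_nonneg_AE[OF lower[OF r]])
  qed
  then have "has_bochner_integral ?\<mu> ?h ((I - l * R powr ?a) / R powr ?a)"
  proof (rule has_bochner_integral_radial_density[OF _ R s a lower hint(1), rotated -2])
    show "AE y in ?\<mu>. 0 \<le> ?h y"
      using AE_radial_density[where s = s and \<alpha> = \<alpha> and R = R and x = x] by eventually_elim (use low in auto)
  qed auto
  moreover have "has_bochner_integral ?\<mu> (\<lambda>y. l) l"
    by (simp add: has_bochner_integral_iff P.prob_space[simplified])
  ultimately have "has_bochner_integral ?\<mu> (\<lambda>y. ?h y + l) ((I - l * R powr ?a) / R powr ?a + l)"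
    by (rule has_bochner_integral_add)
  moreover have "(I - l * R powr ?a) / R powr ?a + l = I / R powr ?a"
    using R by (simp add: field_simps)
  ultimately show ?thesis by simp
qed

lemma ball_potential_outside:
  fixes x :: "'a::euclidean_space"
  assumes R: "R > 0" and dim: "DIM('a) \<ge> 3" and s: "s = real DIM('a) - 4" and a: "a = \<alpha> + s" "a > 0"
    and x: "R \<le> norm x"
  shows "has_bochner_integral (density lborel (\<lambda>x :: 'a. ennreal (radial_density s \<alpha> R x)))
     (\<lambda>y. riesz_profile s (norm (x - y)))
     (riesz_profile s (norm x) - riesz_slope s / (s + 4) * (a / (a + 2)) * R\<^sup>2 * norm x powr (- s - 2))"
proof -
  have "R powr (a + 2) = R powr a * R\<^sup>2"
    using R by (simp add: powr_add)
  then have "(riesz_profile s (norm x) * R powr a - riesz_slope s / (s + 4) * norm x powr (- s - 2) * (a / (a + 2)) * R powr (a + 2)) / R powr a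
    = riesz_profile s (norm x) - riesz_slope s / (s + 4) * (a / (a + 2)) * R\<^sup>2 * norm x powr (- s - 2)"
    using R by (simp add: diff_divide_distrib)
  with ball_potential[OF R dim s a(2)[unfolded a(1)] inner_radial_integral[OF a(2) _ x, unfolded a(1)]] R
  show ?thesis unfolding a(1) by simp
qed

lemma ball_potential_inside:
  fixes x :: "'a::euclidean_space"
  assumes R: "R > 0" and dim: "DIM('a) \<ge> 3" and s: "s = real DIM('a) - 4" and a: "a = \<alpha> + s" "a > 0"
    and \<alpha>: "0 < \<alpha>" "\<alpha> \<noteq> 2" and x: "norm x \<le> R"
  shows "has_bochner_integral (density lborel (\<lambda>x :: 'a. ennreal (radial_density s \<alpha> R x)))
     (\<lambda>y. riesz_profile s (norm (x - y)))
     ((riesz_profile s R * R powr a + riesz_slope s / \<alpha> * (R powr \<alpha> - norm x powr \<alpha>)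
        - riesz_slope s / (s + 4) * (a / (a + 2)) * norm x powr \<alpha>
        - riesz_slope s / (s + 4) * (a / (\<alpha> - 2)) * ((norm x)\<^sup>2 * R powr (\<alpha> - 2) - norm x powr \<alpha>)) / R powr a)"
proof -
  define c \<rho> where "c = riesz_slope s" and "\<rho> = norm x"
  have \<rho>: "0 \<le> \<rho>" "\<rho> \<le> R" using x by (auto simp: \<rho>_def)
  define F where "F = (\<lambda>r. r powr a * riesz_profile s r + c / \<alpha> * r powr \<alpha> - c / (s + 4) * \<rho>\<^sup>2 * (a / (\<alpha> - 2)) * r powr (\<alpha> - 2))"
  let ?I = "riesz_profile s \<rho> * \<rho> powr a - c / (s + 4) * \<rho> powr (- s - 2) * (a / (a + 2)) * \<rho> powr (a + 2) + (F R - F \<rho>)"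
  have "((\<lambda>r. a * r powr (a - 1) * sphere_mean_profile s \<rho> r) has_integral ?I) {0..R}"
    unfolding F_def c_def
    by (rule has_integral_combine[OF \<rho> inner_radial_integral[OF a(2) \<rho>(1) order_refl] outer_radial_integral[OF a \<alpha> \<rho>]])
  then have "has_bochner_integral (density lborel (\<lambda>x :: 'a. ennreal (radial_density s \<alpha> R x)))
     (\<lambda>y. riesz_profile s (norm (x - y))) (?I / R powr a)"
    unfolding a(1) \<rho>_def by (rule ball_potential[OF R dim s a(2)[unfolded a(1)]])
  moreover have "?I = riesz_profile s R * R powr a + c / \<alpha> * (R powr \<alpha> - \<rho> powr \<alpha>)
        - c / (s + 4) * (a / (a + 2)) * \<rho> powr \<alpha>
        - c / (s + 4) * (a / (\<alpha> - 2)) * (\<rho>\<^sup>2 * R powr (\<alpha> - 2) - \<rho> powr \<alpha>)"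
  proof -
    have "\<rho> powr (- s - 2) * \<rho> powr (a + 2) = \<rho> powr \<alpha>" "\<rho>\<^sup>2 * \<rho> powr (\<alpha> - 2) = \<rho> powr \<alpha>"
      using \<rho> a(1) by (cases "\<rho> = 0"; simp add: powr_add[symmetric] flip: powr_numeral)+
    then have "c / (s + 4) * \<rho> powr (- s - 2) * (a / (a + 2)) * \<rho> powr (a + 2) = c / (s + 4) * (a / (a + 2)) * \<rho> powr \<alpha>"
      "c / (s + 4) * \<rho>\<^sup>2 * (a / (\<alpha> - 2)) * \<rho> powr (\<alpha> - 2) = c / (s + 4) * (a / (\<alpha> - 2)) * \<rho> powr \<alpha>"
    proof -
      assume e: "\<rho> powr (- s - 2) * \<rho> powr (a + 2) = \<rho> powr \<alpha>" "\<rho>\<^sup>2 * \<rho> powr (\<alpha> - 2) = \<rho> powr \<alpha>"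
      have "c / (s + 4) * \<rho> powr (- s - 2) * (a / (a + 2)) * \<rho> powr (a + 2) = c / (s + 4) * (a / (a + 2)) * (\<rho> powr (- s - 2) * \<rho> powr (a + 2))"
        by (simp only: ac_simps)
      then show "c / (s + 4) * \<rho> powr (- s - 2) * (a / (a + 2)) * \<rho> powr (a + 2) = c / (s + 4) * (a / (a + 2)) * \<rho> powr \<alpha>"
        unfolding e(1) .
      have "c / (s + 4) * \<rho>\<^sup>2 * (a / (\<alpha> - 2)) * \<rho> powr (\<alpha> - 2) = c / (s + 4) * (a / (\<alpha> - 2)) * (\<rho>\<^sup>2 * \<rho> powr (\<alpha> - 2))"
        by (simp only: ac_simps)
      then show "c / (s + 4) * \<rho>\<^sup>2 * (a / (\<alpha> - 2)) * \<rho> powr (\<alpha> - 2) = c / (s + 4) * (a / (\<alpha> - 2)) * \<rho> powr \<alpha>"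
        unfolding e(2) .
    qed
    then show ?thesis
      unfolding F_def by (simp only:) (simp add: right_diff_distrib ac_simps)
  qed
  ultimately show ?thesis by (simp only: c_def \<rho>_def)
qed

section \<open>Mixtures of a ball and a sphere as equilibrium measures\<close>

text \<open>
  The potential of the mixture is computed from those of its two parts. Inside the ball its coefficients of
  \<open>norm x powr \<alpha>\<close> and \<open>(norm x)\<^sup>2\<close> are \<open>- \<gamma>\<close> and \<open>0\<close>, so \<open>U + V\<close> is constant there. Outside,
  \<open>outer_potential_monotone\<close> applies with \<open>b = a\<close>.
\<close>

lemma mixture_equilibrium:
  fixes V :: "'a::euclidean_space \<Rightarrow> real"
  assumes dim: "DIM('a) \<ge> 3" and s: "s = real DIM('a) - 4" and \<gamma>: "\<gamma> > 0" and \<alpha>: "0 < \<alpha>" "\<alpha> < 2" "\<alpha> + s > 0"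
    and V: "V = (\<lambda>x. \<gamma> * norm x powr \<alpha>)"
  shows "is_equilibrium_measure s V (ball_sphere_mixture s \<gamma> \<alpha>)"
proof -
  define R where "R = mixture_radius s \<gamma> \<alpha>"
  define c where "c = riesz_slope s"
  define a where "a = \<alpha> + s"
  define b where "b = mixture_weight s \<alpha>"
  have s1: "s \<ge> -1" using s dim by simp
  have a: "a > 0" using \<alpha> by (simp add: a_def)
  have c: "c > 0" by (simp add: c_def riesz_slope_pos)
  have b: "0 \<le> b" "b \<le> 1" "b = (2 - \<alpha>) / (s + 2)" "1 - b = a / (s + 2)"
    using \<alpha> s1 by (auto simp: b_def mixture_weight_def a_def field_simps)
  have R_eq: "R = (2 * c / ((a + 2) * \<gamma> * \<alpha>)) powr (1 / a)"
    by (simp add: R_def mixture_radius_def c_def riesz_slope_def a_def ac_simps)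
  have R: "R > 0" and Ra: "R powr a = 2 * c / ((a + 2) * \<gamma> * \<alpha>)"
    using \<gamma> \<alpha> c a by (auto simp: R_eq powr_powr)
  have \<gamma>\<alpha>: "\<gamma> * \<alpha> = 2 * c / ((a + 2) * R powr a)"
  proof -
    have "\<gamma> * \<alpha> = 2 * c / (q * (2 * c / (q * \<gamma> * \<alpha>)))" if "q > 0" for q
      using c \<gamma> \<alpha> that by (simp add: field_simps)
    from this[of "a + 2"] show ?thesis unfolding Ra using a by simp
  qed
  define \<mu>f where "\<mu>f = density lborel (\<lambda>x :: 'a. ennreal (radial_density s \<alpha> R x))"
  define \<mu> where "\<mu> = mixture b \<mu>f (sphere_uniform R)"
  have \<mu>_eq: "ball_sphere_mixture s \<gamma> \<alpha> = \<mu>"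
    by (simp add: ball_sphere_mixture_def Let_def \<mu>_def \<mu>f_def R_def b_def)
  have \<mu>f_prob: "\<mu>f \<in> borel_prob_measures"
    unfolding \<mu>f_def by (rule radial_density_borel_prob[OF R s \<alpha>(3)])
  note \<sigma>_prob = sphere_uniform_borel_prob[of R, where 'a = 'a]
  have \<mu>_prob: "\<mu> \<in> borel_prob_measures"
    unfolding \<mu>_def by (rule mixture_borel_prob[OF b(1,2) \<mu>f_prob \<sigma>_prob])
  let ?k = "\<lambda>x y :: 'a. riesz_profile s (norm (x - y))"
  let ?U = "\<lambda>x :: 'a. \<integral>y. ?k x y \<partial>\<mu>"
  define K where "K = c / (s + 4)"
  define Q where "Q = R powr (\<alpha> - 2)"
  have sphere: "has_bochner_integral (sphere_uniform R) (?k x)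
      (riesz_profile s (max R (norm x)) - K * (min R (norm x))\<^sup>2 * max R (norm x) powr (- s - 2))" for x
    using sphere_potential_biharmonic[OF R dim s, of x] by (simp add: has_bochner_integral_iff K_def c_def)
  define Uin where "Uin x = b * ((riesz_profile s R * R powr a + c / \<alpha> * (R powr \<alpha> - norm x powr \<alpha>)
        - K * (a / (a + 2)) * norm x powr \<alpha>
        - K * (a / (\<alpha> - 2)) * ((norm x)\<^sup>2 * Q - norm x powr \<alpha>)) / R powr a)
      + (1 - b) * (riesz_profile s R - K * (norm x)\<^sup>2 * R powr (- s - 2))" for x :: 'a
  define Uout where "Uout x = b * (riesz_profile s (norm x) - K * (a / (a + 2)) * R\<^sup>2 * norm x powr (- s - 2))
      + (1 - b) * (riesz_profile s (norm x) - K * R\<^sup>2 * norm x powr (- s - 2))" for x :: 'a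
  have hb_in: "has_bochner_integral \<mu> (?k x) (Uin x)" if "norm x \<le> R" for x
  proof -
    have "has_bochner_integral \<mu>f (?k x) ((riesz_profile s R * R powr a + c / \<alpha> * (R powr \<alpha> - norm x powr \<alpha>)
        - K * (a / (a + 2)) * norm x powr \<alpha>
        - K * (a / (\<alpha> - 2)) * ((norm x)\<^sup>2 * Q - norm x powr \<alpha>)) / R powr a)"
      unfolding \<mu>f_def K_def Q_def c_def
      by (rule ball_potential_inside[OF R dim s a_def a \<alpha>(1) _ that]) (use \<alpha> in simp)
    moreover have "has_bochner_integral (sphere_uniform R) (?k x) (riesz_profile s R - K * (norm x)\<^sup>2 * R powr (- s - 2))"
      using sphere[of x] that by (simp add: max_absorb1 min_absorb2)
    ultimately show ?thesis
      unfolding \<mu>_def Uin_def by (intro has_bochner_integral_mixture b \<mu>f_prob \<sigma>_prob) auto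
  qed
  have hb_out: "has_bochner_integral \<mu> (?k x) (Uout x)" if "R \<le> norm x" for x
  proof -
    have "has_bochner_integral \<mu>f (?k x) (riesz_profile s (norm x) - K * (a / (a + 2)) * R\<^sup>2 * norm x powr (- s - 2))"
      unfolding \<mu>f_def K_def c_def by (rule ball_potential_outside[OF R dim s a_def a that])
    moreover have "has_bochner_integral (sphere_uniform R) (?k x) (riesz_profile s (norm x) - K * R\<^sup>2 * norm x powr (- s - 2))"
      using sphere[of x] that by (simp add: max_absorb2 min_absorb1)
    ultimately show ?thesis
      unfolding \<mu>_def Uout_def by (intro has_bochner_integral_mixture b \<mu>f_prob \<sigma>_prob) auto
  qed
  define c0 where "c0 = riesz_profile s R + b * (c / \<alpha>) * (R powr \<alpha> / R powr a)"
  have U_in: "?U x + V x = c0" if x: "norm x \<le> R" for x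
  proof -
    define e f S where "e = 2 - \<alpha>" and "f = a + 2" and "S = s + 2"
    have pos: "e > 0" "f > 0" "S > 0" "\<alpha> > 0" using \<alpha> a s1 by (auto simp: e_def f_def S_def)
    have ef: "e + f = s + 4" "e * f + a * \<alpha> = 2 * S"
      by (simp_all add: e_def f_def S_def a_def algebra_simps)
    have bS: "b = e / S" "1 - b = a / S" using b by (simp_all add: e_def S_def)
    have Kef: "K = c / (e + f)" by (simp add: K_def ef)
    have frac: "a / f / (e + f) + a / e / (e + f) = a / (e * f)"
    proof -
      have sum: "a / f + a / e = a / (e * f) * (e + f)"
        using pos by (simp add: field_simps)
      show ?thesis
        unfolding add_divide_distrib[symmetric] sum using pos by simp
    qed
    \<comment> \<open>The coefficient of \<open>norm x powr \<alpha>\<close>: it cancels the external field.\<close>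
    have X: "b * (c / \<alpha> + K * (a / f) + K * (a / e)) = \<gamma> * R powr a"
    proof -
      have "K * (a / f) + K * (a / e) = c * (a / (e * f))"
        unfolding frac[symmetric] Kef by (simp add: algebra_simps add_divide_distrib)
      then have "b * (c / \<alpha> + K * (a / f) + K * (a / e)) = e / S * (c / \<alpha> + c * (a / (e * f)))"
        by (simp add: bS add.assoc)
      also have "\<dots> = c * (e * f + a * \<alpha>) / (S * \<alpha> * f)"
        using pos by (simp add: field_simps)
      also have "\<dots> = 2 * c / (\<alpha> * f)"
        unfolding ef using pos by simp
      also have "\<dots> = \<gamma> * R powr a"
        unfolding Ra f_def[symmetric] using pos \<gamma> by (simp add: field_simps)
      finally show ?thesis .
    qed
    \<comment> \<open>The coefficient of the square of the norm: the ball and the sphere cancel each other.\<close>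
    have Y: "b * (a / e) = 1 - b"
      using pos bS by simp
    have RQ: "R powr (- s - 2) = Q / R powr a"
      using R by (simp add: Q_def a_def powr_diff[symmetric] minus_diff_commute)
    have am: "a / (\<alpha> - 2) = - (a / e)"
    proof -
      have "\<alpha> - 2 = - e" by (simp add: e_def)
      then show ?thesis by simp
    qed
    define A N T where "A = R powr a" and "N = norm x powr \<alpha>" and "T = (norm x)\<^sup>2"
    have A: "A > 0" using R by (simp add: A_def)
    have "Uin x = riesz_profile s R + b * (c / \<alpha>) * (R powr \<alpha> / A)
        - (b * (c / \<alpha> + K * (a / f) + K * (a / e))) * N / A + (b * (a / e) - (1 - b)) * K * T * Q / A"
      unfolding Uin_def am RQ f_def[symmetric] A_def[symmetric] N_def[symmetric] T_def[symmetric]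
      using A by (simp add: divide_inverse algebra_simps disjI2)
    also have "\<dots> = c0 - \<gamma> * N"
      unfolding X Y c0_def A_def[symmetric] using A by simp
    finally show ?thesis
      using has_bochner_integral_integral_eq[OF hb_in[OF x]] by (simp add: V N_def)
  qed
  have U_out: "?U x = riesz_profile s (norm x) - c * a / ((s + 2) * (a + 2)) * R\<^sup>2 * norm x powr (- s - 2)" if x: "R \<le> norm x" for x
  proof -
    define f S where "f = a + 2" and "S = s + 2"
    have pos: "f > 0" "S > 0" "s + 4 > 0" using a s1 by (auto simp: f_def S_def)
    have bS: "b = (2 - \<alpha>) / S" "1 - b = a / S" using b by (simp_all add: S_def)
    have s4: "s + 4 = (2 - \<alpha>) + f" by (simp add: f_def a_def)
    have "b * (a / f) + (1 - b) = a * ((2 - \<alpha>) + f) / (S * f)"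
      unfolding bS(2) unfolding bS(1) using pos by (simp add: field_simps)
    then have "K * (b * (a / f) + (1 - b)) = c * a / (S * f)"
      unfolding K_def s4 using pos s4 by simp
    moreover have "Uout x = riesz_profile s (norm x) - K * (b * (a / f) + (1 - b)) * R\<^sup>2 * norm x powr (- s - 2)"
      unfolding Uout_def f_def[symmetric] by (simp add: algebra_simps)
    ultimately show ?thesis
      using has_bochner_integral_integral_eq[OF hb_out[OF x]] by (simp add: S_def f_def)
  qed
  obtain C where C: "C \<ge> 0" "\<And>x y :: 'a. x \<noteq> y \<or> s < 0 \<Longrightarrow> - C \<le> 2 * riesz_profile s (norm (x - y)) + \<gamma> * norm x powr \<alpha> + \<gamma> * norm y powr \<alpha>"
    by (rule confinement[of \<gamma> \<alpha> s]) (use \<gamma> \<alpha> in auto)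
  have ball: "AE x in \<mu>. norm x \<le> R"
    unfolding \<mu>_def
  proof (rule AE_mixture[OF \<mu>f_prob \<sigma>_prob])
    show "AE x in \<mu>f. norm x \<le> R"
      unfolding \<mu>f_def using AE_radial_density[where x = 0] by eventually_elim simp
    show "AE x in sphere_uniform R. norm (x :: 'a) \<le> R"
      using AE_sphere_uniform[OF R] by eventually_elim simp
  qed measurable
  show ?thesis
    unfolding \<mu>_eq
  proof (rule equilibrium_criterion[where C = C and B = "max c0 (riesz_profile s R)" and c = c0])
    show "V \<in> borel_measurable borel" unfolding V by measurable
    show "V x \<ge> 0" for x unfolding V using \<gamma> by simp
    show "- C \<le> 2 * riesz_profile s (norm (x - y)) + V x + V y" if "x \<noteq> y \<or> s < 0" for x y
      unfolding V by (rule C(2)[OF that])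
    show "\<mu> \<in> borel_prob_measures" by (rule \<mu>_prob)
    show "AE y in \<mu>. x \<noteq> y" for x :: 'a
      unfolding \<mu>_def
    proof (rule AE_mixture[OF \<mu>f_prob \<sigma>_prob])
      show "AE y in \<mu>f. x \<noteq> y"
        unfolding \<mu>f_def using AE_radial_density[where x = x] by eventually_elim auto
      show "AE y in sphere_uniform R. x \<noteq> y"
        by (rule sphere_uniform_no_atom) (use dim R in auto)
    qed simp
    show "integrable \<mu> V"
      unfolding V by (rule power_field_integrable[OF \<mu>_prob ball \<gamma> \<alpha>(1)])
    show "integrable \<mu> (\<lambda>y. riesz_profile s (norm (x - y)))" for x :: 'a
      using hb_in[of x] hb_out[of x] by (cases "norm x \<le> R") (auto simp: has_bochner_integral_iff)
    show "?U x \<le> max c0 (riesz_profile s R)" for x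
    proof (cases "norm x \<le> R")
      case True
      have "0 \<le> V x" unfolding V using \<gamma> by simp
      then show ?thesis using U_in[OF True] by linarith
    next
      case False
      then have x: "R \<le> norm x" by simp
      have "0 \<le> c * a / ((s + 2) * (a + 2)) * R\<^sup>2 * norm x powr (- s - 2)"
        using c a s1 by simp
      then show ?thesis
        using U_out[OF x] riesz_profile_antimono[OF R x, of s] by linarith
    qed
    show "AE x in \<mu>. ?U x + V x = c0"
      using ball by eventually_elim (rule U_in)
    show "c0 \<le> ?U x + V x" for x
    proof (cases "norm x \<le> R")
      case True
      then show ?thesis using U_in[OF True] by simp
    next
      case False
      then have x: "R \<le> norm x" by simp
      \<comment> \<open>The constant is read off at a point of the sphere, where the inner and the outer formula are both valid.\<close>
      define x0 :: 'a where "x0 = R *\<^sub>R pole"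
      have x0: "norm x0 = R" using R by (simp add: x0_def)
      have "c0 = ?U x0 + V x0" using U_in[of x0] x0 by simp
      also have "\<dots> = riesz_profile s R - c * a / ((s + 2) * (a + 2)) * R\<^sup>2 * R powr (- s - 2) + \<gamma> * R powr \<alpha>"
        using U_out[of x0] x0 by (simp add: V)
      also have "\<dots> \<le> riesz_profile s (norm x) - c * a / ((s + 2) * (a + 2)) * R\<^sup>2 * norm x powr (- s - 2) + \<gamma> * norm x powr \<alpha>"
        unfolding c_def by (rule outer_potential_monotone[OF _ a_def a order_refl R x \<gamma>\<alpha>[unfolded c_def]]) (use s1 in simp)
      also have "\<dots> = ?U x + V x" unfolding U_out[OF x] V ..
      finally show ?thesis .
    qed
  qed (use C s1 in auto)
qed

section \<open>The point mass\<close>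

text \<open>
  Equality in the triangle inequality for \<open>x\<close> and \<open>- y\<close>: nonzero vectors with this property point in opposite
  directions.
\<close>

lemma sgn_inner_antipodal:
  fixes x y :: "'a::real_inner"
  assumes "norm x + norm y \<le> norm (x - y)"
  shows "sgn x \<bullet> sgn y = - (of_bool (x \<noteq> 0) * of_bool (y \<noteq> 0))"
proof (cases "x = 0 \<or> y = 0")
  case False
  have "(norm x + norm y)\<^sup>2 \<le> (norm (x - y))\<^sup>2"
    using assms by (intro power_mono) auto
  then have "norm x * norm y \<le> - (x \<bullet> y)"
    by (simp add: power2_norm_eq_inner inner_diff inner_commute power2_sum)
  moreover have "- (x \<bullet> y) \<le> norm x * norm y"
    using Cauchy_Schwarz_ineq2[of x y] by linarith
  ultimately have "x \<bullet> y = - (norm x * norm y)" by linarith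
  then show ?thesis using False by (simp add: sgn_div_norm field_simps)
qed auto

text \<open>
  The integral is the squared norm of the mean of \<open>sgn\<close>.
\<close>

lemma sgn_inner_integral_nonneg:
  fixes \<nu> :: "'a::euclidean_space measure"
  assumes "finite_measure \<nu>" and [measurable_cong]: "sets \<nu> = sets borel"
  shows "integrable (\<nu> \<Otimes>\<^sub>M \<nu>) (\<lambda>p. sgn (fst p) \<bullet> sgn (snd p))"
    and "0 \<le> (\<integral>p. sgn (fst p) \<bullet> sgn (snd p) \<partial>(\<nu> \<Otimes>\<^sub>M \<nu>))"
proof -
  interpret finite_measure \<nu> by fact
  interpret N: pair_sigma_finite \<nu> \<nu> ..
  interpret NN: finite_measure "\<nu> \<Otimes>\<^sub>M \<nu>"
    by (rule finite_measure_pair_measure) (rule assms(1))+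
  have [measurable]: "(sgn :: 'a \<Rightarrow> 'a) \<in> borel_measurable borel"
    unfolding sgn_div_norm[abs_def] by measurable
  have n: "norm (sgn z) \<le> 1" for z :: 'a
    by (simp add: norm_sgn)
  have s: "integrable \<nu> (\<lambda>y. sgn y)"
    by (rule integrable_const_bound[where B = 1]) (auto simp: n)
  show i: "integrable (\<nu> \<Otimes>\<^sub>M \<nu>) (\<lambda>p. sgn (fst p) \<bullet> sgn (snd p))"
  proof (rule NN.integrable_const_bound[where B = 1])
    show "AE p in \<nu> \<Otimes>\<^sub>M \<nu>. norm (sgn (fst p) \<bullet> sgn (snd p)) \<le> 1"
    proof (rule AE_I2)
      fix p :: "'a \<times> 'a"
      have "norm (sgn (fst p) \<bullet> sgn (snd p)) \<le> norm (sgn (fst p)) * norm (sgn (snd p))"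
        by (simp add: Cauchy_Schwarz_ineq2)
      also have "\<dots> \<le> 1 * 1" by (intro mult_mono n) auto
      finally show "norm (sgn (fst p) \<bullet> sgn (snd p)) \<le> 1" by simp
    qed
  qed measurable
  have "(\<integral>p. sgn (fst p) \<bullet> sgn (snd p) \<partial>(\<nu> \<Otimes>\<^sub>M \<nu>)) = (\<integral>x. (\<integral>y. sgn x \<bullet> sgn y \<partial>\<nu>) \<partial>\<nu>)"
    using N.integral_fst'[OF i] by simp
  also have "\<dots> = (\<integral>x. sgn x \<bullet> (\<integral>y. sgn y \<partial>\<nu>) \<partial>\<nu>)"
    using s by simp
  also have "\<dots> = (\<integral>x. sgn x \<partial>\<nu>) \<bullet> (\<integral>y. sgn y \<partial>\<nu>)"
    using s by simp
  finally show "0 \<le> (\<integral>p. sgn (fst p) \<bullet> sgn (snd p) \<partial>(\<nu> \<Otimes>\<^sub>M \<nu>))" by simp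
qed

text \<open>
  The integrand \<open>\<gamma> * norm x + \<gamma> * norm y - norm (x - y)\<close> of the energy is nonnegative. If another measure \<open>\<nu>\<close> also has
  energy zero, almost all pairs satisfy the hypothesis of \<open>sgn_inner_antipodal\<close>, so the integral of \<open>sgn x \<bullet> sgn y\<close> is
  minus the square of the mass of \<open>- {0}\<close>. As this integral is nonnegative, the mass is \<open>0\<close>.
\<close>

lemma point_mass_equilibrium:
  fixes V :: "'a::euclidean_space \<Rightarrow> real"
  assumes \<gamma>: "\<gamma> \<ge> 1" and V: "V = (\<lambda>x. \<gamma> * norm x)"
  shows "is_equilibrium_measure (-1) V (return borel 0)"
proof -
  define g where "g p = \<gamma> * norm (fst p) + \<gamma> * norm (snd p) - norm (fst p - snd p)" for p :: "'a \<times> 'a"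
  have lower: "norm (fst p) + norm (snd p) - norm (fst p - snd p) \<le> g p" for p
  proof -
    have "1 * norm (fst p) \<le> \<gamma> * norm (fst p)" "1 * norm (snd p) \<le> \<gamma> * norm (snd p)"
      using \<gamma> by (intro mult_right_mono; simp)+
    then show ?thesis unfolding g_def by linarith
  qed
  have g0: "0 \<le> g p" for p
    using lower[of p] norm_triangle_ineq4[of "fst p" "snd p"] by linarith
  have F: "(\<lambda>(x, y). riesz_kernel (-1) (x - y) + ereal (V x) + ereal (V y)) = (\<lambda>p. ereal (g p))"
    by (auto simp: fun_eq_iff riesz_kernel_def g_def V)
  have energy: "energy (-1) V \<nu> = enn2ereal (\<integral>\<^sup>+p. ennreal (g p) \<partial>(\<nu> \<Otimes>\<^sub>M \<nu>))" for \<nu> :: "'a measure"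
    unfolding energy_def F ereal_integral_def
    using g0 by (simp add: ennreal_neg zero_ennreal.rep_eq)
  let ?\<delta> = "return borel (0 :: 'a)"
  have \<delta>: "?\<delta> \<in> borel_prob_measures"
    by (simp add: borel_prob_measures_def prob_space_return)
  have g_meas [measurable]: "g \<in> borel_measurable (borel \<Otimes>\<^sub>M borel)"
    unfolding g_def by measurable
  have \<delta>_energy: "energy (-1) V ?\<delta> = 0"
  proof -
    interpret D: prob_space ?\<delta> by (simp add: prob_space_return)
    have "(\<integral>\<^sup>+p. ennreal (g p) \<partial>(?\<delta> \<Otimes>\<^sub>M ?\<delta>)) = (\<integral>\<^sup>+x. (\<integral>\<^sup>+y. ennreal (g (x, y)) \<partial>?\<delta>) \<partial>?\<delta>)"
    proof (rule D.nn_integral_fst[symmetric])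
      have "(\<lambda>p. ennreal (g p)) \<in> borel_measurable (borel \<Otimes>\<^sub>M borel)" by measurable
      then show "(\<lambda>p. ennreal (g p)) \<in> borel_measurable (?\<delta> \<Otimes>\<^sub>M ?\<delta>)"
        by (simp cong: measurable_cong_sets sets_pair_measure_cong)
    qed
    also have "\<dots> = (\<integral>\<^sup>+x. ennreal (g (x, 0)) \<partial>?\<delta>)"
      by (intro nn_integral_cong nn_integral_return) auto
    also have "\<dots> = ennreal (g (0, 0))"
      by (intro nn_integral_return) auto
    finally show ?thesis by (simp add: energy g_def zero_ennreal.rep_eq)
  qed
  have min: "is_minimizer (-1) V ?\<delta>"
  proof -
    have "energy (-1) V ?\<delta> \<le> energy (-1) V \<nu>" for \<nu>
      unfolding \<delta>_energy unfolding energy by simp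
    then show ?thesis using \<delta> by (simp add: is_minimizer_def)
  qed
  have "\<nu> = ?\<delta>" if \<nu>: "is_minimizer (-1) V \<nu>" for \<nu>
  proof -
    have \<nu>': "\<nu> \<in> borel_prob_measures" and le: "energy (-1) V \<nu> \<le> 0"
      using \<nu> \<delta> unfolding is_minimizer_def \<delta>_energy[symmetric] by auto
    interpret prob_space \<nu> by (rule borel_prob_measuresD(1)[OF \<nu>'])
    interpret N: pair_prob_space \<nu> \<nu> ..
    note sets_\<nu> [measurable_cong] = borel_prob_measuresD(2)[OF \<nu>']
    have gm: "(\<lambda>p. ennreal (g p)) \<in> borel_measurable (\<nu> \<Otimes>\<^sub>M \<nu>)"
      by measurable
    have "(\<integral>\<^sup>+p. ennreal (g p) \<partial>(\<nu> \<Otimes>\<^sub>M \<nu>)) = 0"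
    proof -
      have "(\<integral>\<^sup>+p. ennreal (g p) \<partial>(\<nu> \<Otimes>\<^sub>M \<nu>)) \<le> 0"
        unfolding less_eq_ennreal.rep_eq zero_ennreal.rep_eq using le unfolding energy .
      then show ?thesis by simp
    qed
    then have "AE p in \<nu> \<Otimes>\<^sub>M \<nu>. ennreal (g p) = 0"
      by (simp add: nn_integral_0_iff_AE[OF gm])
    then have "AE p in \<nu> \<Otimes>\<^sub>M \<nu>. sgn (fst p) \<bullet> sgn (snd p) = - (of_bool (fst p \<noteq> 0) * of_bool (snd p \<noteq> 0))"
    proof eventually_elim
      case (elim p)
      then have "g p \<le> 0" by (simp add: ennreal_eq_0_iff)
      then show ?case using lower[of p] by (intro sgn_inner_antipodal) linarith
    qed
    then have "(\<integral>p. sgn (fst p) \<bullet> sgn (snd p) \<partial>(\<nu> \<Otimes>\<^sub>M \<nu>)) = (\<integral>p. - (of_bool (fst p \<noteq> 0) * of_bool (snd p \<noteq> 0)) \<partial>(\<nu> \<Otimes>\<^sub>M \<nu>))"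
    proof (rule integral_cong_AE[rotated 2])
      show "(\<lambda>p. sgn (fst p) \<bullet> sgn (snd p)) \<in> borel_measurable (\<nu> \<Otimes>\<^sub>M \<nu>)"
        using sgn_inner_integral_nonneg(1)[OF finite_measure_axioms sets_\<nu>] by simp
      show "(\<lambda>p. - (of_bool (fst p \<noteq> 0) * of_bool (snd p \<noteq> 0)) :: real) \<in> borel_measurable (\<nu> \<Otimes>\<^sub>M \<nu>)"
        by measurable
    qed
    also have "\<dots> = - ((prob (- {0}))\<^sup>2)"
    proof -
      have i: "integrable (\<nu> \<Otimes>\<^sub>M \<nu>) (\<lambda>p. of_bool (fst p \<noteq> 0) * of_bool (snd p \<noteq> 0) :: real)"
      proof (rule N.integrable_const_bound[where B = 1])
        show "(\<lambda>p. of_bool (fst p \<noteq> 0) * of_bool (snd p \<noteq> 0) :: real) \<in> borel_measurable (\<nu> \<Otimes>\<^sub>M \<nu>)"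
          by measurable
      qed auto
      have ind: "(of_bool (z \<noteq> 0) :: real) = indicator (- {0}) z" for z :: 'a
        by (simp add: indicator_def)
      have "(\<integral>p. (of_bool (fst p \<noteq> 0) * of_bool (snd p \<noteq> 0) :: real) \<partial>(\<nu> \<Otimes>\<^sub>M \<nu>))
         = (\<integral>x. (\<integral>y. of_bool (x \<noteq> 0) * of_bool (y \<noteq> 0) \<partial>\<nu>) \<partial>\<nu>)"
        using N.integral_fst'[OF i, symmetric] unfolding fst_conv snd_conv .
      also have "\<dots> = (\<integral>x. of_bool (x \<noteq> 0) * prob (- {0}) \<partial>\<nu>)"
        unfolding ind by (simp add: sets_\<nu>)
      also have "\<dots> = prob (- {0}) * prob (- {0})"
        unfolding ind by (simp add: sets_\<nu>)
      finally show ?thesis by (simp add: power2_eq_square)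
    qed
    finally have "prob (- {0}) = 0"
      using sgn_inner_integral_nonneg(2)[OF finite_measure_axioms sets_\<nu>] by simp
    then have "emeasure \<nu> (- {0}) = 0"
      by (simp add: emeasure_eq_measure)
    then have null: "- {0} \<in> null_sets \<nu>"
      by (simp add: null_sets_def sets_\<nu>)
    show ?thesis
    proof (rule measure_eqI)
      show "sets \<nu> = sets ?\<delta>" using sets_\<nu> by simp
      fix A assume "A \<in> sets \<nu>"
      then have A: "A \<in> sets borel" using sets_\<nu> by simp
      have AE0: "AE x in \<nu>. x = 0"
        using AE_not_in[OF null] by eventually_elim simp
      have "emeasure \<nu> A = emeasure \<nu> (if 0 \<in> A then space \<nu> else {})"
      proof (rule emeasure_eq_AE)
        show "AE x in \<nu>. x \<in> A \<longleftrightarrow> x \<in> (if 0 \<in> A then space \<nu> else {})"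
          using AE0 AE_space by eventually_elim simp
      qed (use \<open>A \<in> sets \<nu>\<close> in simp_all)
      then show "emeasure \<nu> A = emeasure ?\<delta> A"
        using A by (auto simp: emeasure_space_1)
    qed
  qed
  with min show ?thesis
    unfolding is_equilibrium_measure_def by blast
qed

section \<open>Equilibrium measures for power fields\<close>

theorem theorem1p2:
  fixes \<gamma> \<alpha> s :: real and V :: "real ^ 'n \<Rightarrow> real"
  assumes "\<gamma> > 0" and "\<alpha> > 0" and "s > -2"
    and "V = (\<lambda>x. \<gamma> * norm x powr \<alpha>)"
  shows
    "(CARD('n) \<ge> 4 \<and> s = real CARD('n) - 4 \<longrightarrow>
        (\<alpha> < 2 \<longrightarrow> is_equilibrium_measure s V (ball_sphere_mixture s \<gamma> \<alpha>)) \<and>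
        (\<alpha> \<ge> 2 \<longrightarrow> is_equilibrium_measure s V (sphere_uniform (sphere_radius s \<gamma> \<alpha>)))) \<and>
     (CARD('n) \<ge> 4 \<and> s = 0 \<and> \<alpha> \<ge> 2 \<longrightarrow>
        is_equilibrium_measure s V (sphere_uniform ((1 / (2 * \<gamma> * \<alpha>)) powr (1 / \<alpha>)))) \<and>
     (CARD('n) = 3 \<and> s = real CARD('n) - 4 \<longrightarrow>
        (\<alpha> = 1 \<and> \<gamma> \<ge> 1 \<longrightarrow> is_equilibrium_measure s V (return borel 0)) \<and>
        (1 < \<alpha> \<and> \<alpha> < 2 \<longrightarrow> is_equilibrium_measure s V (ball_sphere_mixture s \<gamma> \<alpha>)) \<and>
        (\<alpha> \<ge> 2 \<longrightarrow> is_equilibrium_measure s V (sphere_uniform (sphere_radius s \<gamma> \<alpha>))))"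
proof (intro conjI impI; elim conjE)
  assume "4 \<le> CARD('n)" "s = real CARD('n) - 4" "\<alpha> < 2"
  then show "is_equilibrium_measure s V (ball_sphere_mixture s \<gamma> \<alpha>)"
    using assms by (intro mixture_equilibrium) auto
next
  assume "4 \<le> CARD('n)" "s = real CARD('n) - 4" "2 \<le> \<alpha>"
  then show "is_equilibrium_measure s V (sphere_uniform (sphere_radius s \<gamma> \<alpha>))"
    using assms by (intro sphere_equilibrium_biharmonic) auto
next
  assume "4 \<le> CARD('n)" "s = 0" "2 \<le> \<alpha>"
  then show "is_equilibrium_measure s V (sphere_uniform ((1 / (2 * \<gamma> * \<alpha>)) powr (1 / \<alpha>)))"
    using assms by (simp only:) (intro sphere_equilibrium_log, auto)
next
  assume "CARD('n) = 3" "s = real CARD('n) - 4" "\<alpha> = 1" "1 \<le> \<gamma>"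
  then show "is_equilibrium_measure s V (return borel 0)"
    using assms point_mass_equilibrium[of \<gamma> V] by simp
next
  assume "CARD('n) = 3" "s = real CARD('n) - 4" "1 < \<alpha>" "\<alpha> < 2"
  then show "is_equilibrium_measure s V (ball_sphere_mixture s \<gamma> \<alpha>)"
    using assms by (intro mixture_equilibrium) auto
next
  assume "CARD('n) = 3" "s = real CARD('n) - 4" "2 \<le> \<alpha>"
  then show "is_equilibrium_measure s V (sphere_uniform (sphere_radius s \<gamma> \<alpha>))"
    using assms by (intro sphere_equilibrium_biharmonic) auto
qed

end
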